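(* Let $n\ge1$ be an integer and $A\in M_{2\times2}(\Lambda)$. Suppose $A$ is special relative to $n$ and $\Phi_n\nmid\det(A)$. Then $\nabla A_{(n)}$ is defined and equals $\mathrm{ord}_{\epsilon_n}(\det A(\epsilon_n))$, where the connecting map $A_{(n)}\to A_{(n-1)}$ is the natural projection.
   Context: $\Lambda=\mathbb{Z}_p[[X]]$ ($p$ an odd prime), $\omega_n=(1+X)^{p^n}-1$, $\Lambda_n=\Lambda/(\omega_n)$, $\Phi_0=X$ and $\Phi_m$ ($m\ge1$) the $p^m$-th cyclotomic polynomial in $1+X$, so $\omega_n=\prod_{m=0}^n\Phi_m$. $\epsilon_m=\zeta_{p^m}-1$, and $\mathrm{ord}_{\epsilon_n}$ is the valuation on $\mathbb{Q}_p(\zeta_{p^n})$ normalized so that $\mathrm{ord}_{\epsilon_n}(\epsilon_n)=1$. For $A=\begin{bmatrix}a&c\\ b&d\end{bmatrix}\in M_{2\times2}(\Lambda)$, $A_{(n)}=\Lambda^{\oplus2}/\langle\omega_nI_2,A\rangle$, the quotient of $\Lambda^{\oplus 2}$ by the submodule generated by the columns of $\omega_nI_2$ and of $A$. $A$ is special relative to $n$ if for every $0\le m\le n$ with $\Phi_m\mid\det A$, either $\Phi_m$ divides both $a,b$ or $\Phi_m$ divides both $c,d$. Kobayashi rank: for a projective system $(M_n)_{n\ge1}$ of finitely generated $\mathbb{Z}_p$-modules, if $\pi_n:M_n\to M_{n-1}$ has finite kernel and cokernel, $\nabla M_n:=\mathrm{length}_{\mathbb{Z}_p}(\ker\pi_n)-\mathrm{length}_{\mathbb{Z}_p}(\mathrm{coker}\,\pi_n)+\dim_{\mathbb{Q}_p}M_{n-1}\otimes\mathbb{Q}_p$.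 *)

theory Defs
  imports
    "HOL-Analysis.Analysis"
    "HOL-Algebra.Free_Abelian_Groups"
    "HOL-Algebra.Generated_Fields"
    "HOL-Algebra.Algebraic_Closure_Type"
    "HOL-Computational_Algebra.Computational_Algebra"
    "Jordan_Normal_Form.Missing_VectorSpace"
    "Berlekamp_Zassenhaus.Finite_Field"
begin

section \<open>The $p$-adic integers\<close>

text \<open>The prime $p$ is the cardinality of the type parameter, so that a statement about
  \<open>'p :: prime_card\<close> is a statement about every prime $p$.
  The type is the inverse limit of the rings $\mathbb{Z}/p^n$, the residues being represented
  by $0, \dots, p^n - 1$.\<close>

typedef ('p :: prime_card) padic_int =
  "{x :: nat \<Rightarrow> int. \<forall>n. x n \<in> {0..<int CARD('p) ^ n} \<and> [x (Suc n) = x n] (mod int CARD('p) ^ n)}"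
  morphisms padic_res Abs_padic_int
  by (rule exI[of _ "\<lambda>_. 0"]) (use prime_card_int[where 'a = 'p] in \<open>auto simp: prime_gt_0_int\<close>)

setup_lifting type_definition_padic_int

lemma padic_modulus_pos: "int CARD('p :: prime_card) ^ n > 0"
  using prime_card_int[where 'a = 'p] by (simp add: prime_gt_0_int)

lemma padic_modulus_mod_mod: "(a :: int) mod int CARD('p :: prime_card) ^ Suc n mod int CARD('p) ^ n = a mod int CARD('p) ^ n"
  by (rule mod_mod_cancel) simp

lemma padic_mod_in:
  assumes "[a (Suc n) = a n] (mod int CARD('p :: prime_card) ^ n)"
  shows "a n mod int CARD('p) ^ n \<in> {0..<int CARD('p) ^ n} \<and>
     [a (Suc n) mod int CARD('p) ^ Suc n = a n mod int CARD('p) ^ n] (mod int CARD('p) ^ n)"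
  using assms padic_modulus_pos[where 'p = 'p, of n] padic_modulus_mod_mod[where 'p = 'p, of "a (Suc n)" n]
  by (simp add: cong_def del: power_Suc)

instantiation padic_int :: (prime_card) comm_ring_1
begin

lift_definition zero_padic_int :: "'a padic_int" is "\<lambda>n. 0 mod int CARD('a) ^ n"
  subgoal for n by (rule padic_mod_in[of "\<lambda>_. 0" n]) simp done

lift_definition one_padic_int :: "'a padic_int" is "\<lambda>n. 1 mod int CARD('a) ^ n"
  subgoal for n by (rule padic_mod_in[of "\<lambda>_. 1" n]) simp done

lift_definition plus_padic_int :: "'a padic_int \<Rightarrow> 'a padic_int \<Rightarrow> 'a padic_int"
  is "\<lambda>x y n. (x n + y n) mod int CARD('a) ^ n"
  subgoal for x y n by (rule padic_mod_in[of "\<lambda>n. x n + y n" n]) (blast intro: cong_add) done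

lift_definition minus_padic_int :: "'a padic_int \<Rightarrow> 'a padic_int \<Rightarrow> 'a padic_int"
  is "\<lambda>x y n. (x n - y n) mod int CARD('a) ^ n"
  subgoal for x y n by (rule padic_mod_in[of "\<lambda>n. x n - y n" n]) (blast intro: cong_diff) done

lift_definition uminus_padic_int :: "'a padic_int \<Rightarrow> 'a padic_int"
  is "\<lambda>x n. (- x n) mod int CARD('a) ^ n"
  subgoal for x n by (rule padic_mod_in[of "\<lambda>n. - x n" n]) (simp add: cong_minus_minus_iff) done

lift_definition times_padic_int :: "'a padic_int \<Rightarrow> 'a padic_int \<Rightarrow> 'a padic_int"
  is "\<lambda>x y n. (x n * y n) mod int CARD('a) ^ n"
  subgoal for x y n by (rule padic_mod_in[of "\<lambda>n. x n * y n" n]) (blast intro: cong_mult) done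

instance
proof
  fix a b c :: "'a padic_int"
  show "a * b * c = a * (b * c)"
    by transfer (simp add: mod_simps ac_simps)
  show "a * b = b * a"
    by transfer (simp add: ac_simps)
  show "1 * a = a"
    by transfer (simp add: mod_simps mod_pos_pos_trivial)
  show "a + b + c = a + (b + c)"
    by transfer (simp add: mod_simps ac_simps)
  show "a + b = b + a"
    by transfer (simp add: ac_simps)
  show "0 + a = a"
    by transfer (simp add: mod_pos_pos_trivial)
  show "- a + a = 0"
    by transfer (simp add: mod_simps)
  show "a - b = a + - b"
    by transfer (simp add: mod_simps)
  show "(a + b) * c = a * c + b * c"
    by transfer (simp add: mod_simps algebra_simps)
  show "(0 :: 'a padic_int) \<noteq> 1"
  proof transfer
    have "int CARD('a) > 1"
      by (rule prime_gt_1_int[OF prime_card_int])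
    then have "0 mod int CARD('a) ^ 1 \<noteq> 1 mod int CARD('a) ^ 1"
      by simp
    then show "(\<lambda>n. 0 mod int CARD('a) ^ n) \<noteq> (\<lambda>n. 1 mod int CARD('a) ^ n)"
      by metis
  qed
qed

end

lemma padic_res_mod:
  "padic_res (x :: 'p :: prime_card padic_int) (n + k) mod int CARD('p) ^ n = padic_res x n"
proof (induction k)
  case 0
  show ?case using padic_res[of x] by (simp add: mod_pos_pos_trivial)
next
  case (Suc k)
  have "[padic_res x (Suc (n + k)) = padic_res x (n + k)] (mod int CARD('p) ^ (n + k))"
    using padic_res[of x] by blast
  then have "[padic_res x (Suc (n + k)) = padic_res x (n + k)] (mod int CARD('p) ^ n)"
    by (rule cong_dvd_modulus) (simp add: le_imp_power_dvd)
  then show ?case using Suc by (simp add: cong_def)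
qed

lemma padic_res_nonzero:
  assumes "(x :: 'p :: prime_card padic_int) \<noteq> 0"
  shows "\<exists>n. \<forall>k. \<not> int CARD('p) ^ n dvd padic_res x (n + k)"
proof -
  obtain n where n: "padic_res x n \<noteq> 0"
    using assms by transfer (auto simp: fun_eq_iff)
  have "\<not> int CARD('p) ^ n dvd padic_res x (n + k)" for k
    using n padic_res_mod[of x n k] by (simp add: dvd_eq_mod_eq_0)
  then show ?thesis by blast
qed

instance padic_int :: (prime_card) idom
proof
  fix x y :: "'a padic_int"
  assume "x \<noteq> 0" "y \<noteq> 0"
  then obtain a b where a: "\<not> int CARD('a) ^ a dvd padic_res x (a + b)"
    and b: "\<not> int CARD('a) ^ b dvd padic_res y (a + b)"
    using padic_res_nonzero by (metis add.commute)
  have p: "Factorial_Ring.prime (int CARD('a))" by (rule prime_card_int)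
  have "\<not> int CARD('a) ^ (a + b) dvd padic_res x (a + b) * padic_res y (a + b)"
  proof
    let ?p = "int CARD('a)" and ?u = "padic_res x (a + b)" and ?w = "padic_res y (a + b)"
    assume d: "?p ^ (a + b) dvd ?u * ?w"
    have nz: "?u \<noteq> 0" "?w \<noteq> 0" using a b by (metis dvd_0_right)+
    have nu: "\<not> is_unit ?p" using p by auto
    have "multiplicity ?p (?u * ?w) = multiplicity ?p ?u + multiplicity ?p ?w"
      using p nz by (simp add: prime_elem_multiplicity_mult_distrib)
    moreover have "a + b \<le> multiplicity ?p (?u * ?w)"
      using d nz nu by (intro multiplicity_geI) auto
    moreover have "multiplicity ?p ?u < a" "multiplicity ?p ?w < b"
      using a b multiplicity_dvd' by (metis not_less)+
    ultimately show False by simp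
  qed
  then have "padic_res (x * y) (a + b) \<noteq> 0"
    by (simp add: times_padic_int.rep_eq dvd_eq_mod_eq_0)
  then show "x * y \<noteq> 0"
    by (auto simp: zero_padic_int.rep_eq)
qed


section \<open>Modules over a commutative ring\<close>

text \<open>Modules are records in the sense of \<^theory>\<open>HOL-Algebra.Module\<close>; their ring
  multiplication and unit play no role.\<close>

definition restrict_scalars :: "('r \<Rightarrow> 's) \<Rightarrow> ('s, 'm) module \<Rightarrow> ('r, 'm) module" where
  "restrict_scalars h M =
     \<lparr>carrier = carrier M, monoid.mult = undefined, one = undefined, ring.zero = \<zero>\<^bsub>M\<^esub>, add = add M,
      smult = (\<lambda>r. smult M (h r))\<rparr>"

definition quotient_module :: "('r, 'm) module \<Rightarrow> 'm set \<Rightarrow> ('r, 'm set) module" where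
  "quotient_module M N =
     \<lparr>carrier = a_rcosets\<^bsub>M\<^esub> N, monoid.mult = undefined, one = undefined, ring.zero = N, add = set_add M,
      smult = (\<lambda>r C. \<Union>x\<in>C. N +>\<^bsub>M\<^esub> (r \<odot>\<^bsub>M\<^esub> x))\<rparr>"

definition finitely_generated_module :: "'r ring \<Rightarrow> ('r, 'm) module \<Rightarrow> bool" where
  "finitely_generated_module R M \<longleftrightarrow>
     (\<exists>S. finite S \<and> S \<subseteq> carrier M \<and> LinearCombinations.module.span R M S = carrier M)"

definition module_length :: "'r ring \<Rightarrow> ('r, 'm) module \<Rightarrow> enat" where
  "module_length R M =
     (SUP k \<in> {k. \<exists>N. (\<forall>i\<le>k. LinearCombinations.submodule R (N i) M) \<and> (\<forall>i<k. N i \<subset> N (Suc i))}.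
        enat k)"

text \<open>Extension of scalars $M \otimes_R S$ along a ring homomorphism \<open>h\<close> from \<open>R\<close> to \<open>S\<close>:
  the free abelian group on the pairs $(x, s)$ modulo the usual relations, with
  $t \cdot (x \otimes s) = x \otimes ts$. The record \<open>tensor_free\<close> is not itself an \<open>S\<close>-module;
  distributivity in the scalar only holds modulo the relations.\<close>

definition tensor_free ::
    "'s ring \<Rightarrow> ('r, 'm) module \<Rightarrow> ('s, ('m \<times> 's) \<Rightarrow>\<^sub>0 int) module" where
  "tensor_free S M =
     \<lparr>carrier = carrier (free_Abelian_group (carrier M \<times> carrier S)),
      monoid.mult = undefined, one = undefined, ring.zero = 0, add = (+),
      smult = (\<lambda>t. frag_extend (\<lambda>(x, s). frag_of (x, t \<otimes>\<^bsub>S\<^esub> s)))\<rparr>"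

definition tensor_relations ::
    "'r ring \<Rightarrow> 's ring \<Rightarrow> ('r \<Rightarrow> 's) \<Rightarrow> ('r, 'm) module \<Rightarrow> (('m \<times> 's) \<Rightarrow>\<^sub>0 int) set" where
  "tensor_relations R S h M =
     {frag_of (x \<oplus>\<^bsub>M\<^esub> y, s) - frag_of (x, s) - frag_of (y, s) | x y s.
        x \<in> carrier M \<and> y \<in> carrier M \<and> s \<in> carrier S} \<union>
     {frag_of (x, s \<oplus>\<^bsub>S\<^esub> t) - frag_of (x, s) - frag_of (x, t) | x s t.
        x \<in> carrier M \<and> s \<in> carrier S \<and> t \<in> carrier S} \<union>
     {frag_of (r \<odot>\<^bsub>M\<^esub> x, s) - frag_of (x, h r \<otimes>\<^bsub>S\<^esub> s) | r x s.
        r \<in> carrier R \<and> x \<in> carrier M \<and> s \<in> carrier S}"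

definition extend_scalars ::
    "'r ring \<Rightarrow> 's ring \<Rightarrow> ('r \<Rightarrow> 's) \<Rightarrow> ('r, 'm) module \<Rightarrow> ('s, (('m \<times> 's) \<Rightarrow>\<^sub>0 int) set) module" where
  "extend_scalars R S h M =
     quotient_module (tensor_free S M)
       (generate (free_Abelian_group (carrier M \<times> carrier S)) (tensor_relations R S h M))"


section \<open>Kobayashi rank\<close>

abbreviation Zp :: "'p :: prime_card padic_int ring" where
  "Zp \<equiv> ring_of_type_algebra"

abbreviation Qp :: "'p :: prime_card padic_int fract ring" where
  "Qp \<equiv> ring_of_type_algebra"

definition Qp_dim :: "('p :: prime_card padic_int, 'm) module \<Rightarrow> nat" where
  "Qp_dim M = vectorspace.dim Qp (extend_scalars Zp Qp (\<lambda>x. Fract x 1) M)"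

text \<open>The value of \<open>\<pi>\<close> at \<open>0\<close> is irrelevant: \<open>\<pi> n\<close> maps \<open>M n\<close> to \<open>M (n - 1)\<close> for $n \ge 1$.\<close>

definition projective_system ::
    "(nat \<Rightarrow> ('p :: prime_card padic_int, 'm) module) \<Rightarrow> (nat \<Rightarrow> 'm \<Rightarrow> 'm) \<Rightarrow> bool" where
  "projective_system M \<pi> \<longleftrightarrow>
     (\<forall>n. finitely_generated_module Zp (M n)) \<and>
     (\<forall>n\<ge>1. mod_hom Zp (M n) (M (n - 1)) (\<pi> n))"

definition ker_module :: "('r, 'm) module \<Rightarrow> ('r, 'k) module \<Rightarrow> ('m \<Rightarrow> 'k) \<Rightarrow> ('r, 'm) module" where
  "ker_module M N f = M\<lparr>carrier := a_kernel M N f\<rparr>"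

definition coker_module :: "('r, 'm) module \<Rightarrow> ('r, 'k) module \<Rightarrow> ('m \<Rightarrow> 'k) \<Rightarrow> ('r, 'k set) module" where
  "coker_module M N f = quotient_module N (f ` carrier M)"

definition kobayashi_rank_defined ::
    "(nat \<Rightarrow> ('p :: prime_card padic_int, 'm) module) \<Rightarrow> (nat \<Rightarrow> 'm \<Rightarrow> 'm) \<Rightarrow> nat \<Rightarrow> bool" where
  "kobayashi_rank_defined M \<pi> n \<longleftrightarrow>
     projective_system M \<pi> \<and>
     finite (carrier (ker_module (M n) (M (n - 1)) (\<pi> n))) \<and>
     finite (carrier (coker_module (M n) (M (n - 1)) (\<pi> n)))"

definition kobayashi_rank ::
    "(nat \<Rightarrow> ('p :: prime_card padic_int, 'm) module) \<Rightarrow> (nat \<Rightarrow> 'm \<Rightarrow> 'm) \<Rightarrow> nat \<Rightarrow> int" where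
  "kobayashi_rank M \<pi> n =
     int (the_enat (module_length Zp (ker_module (M n) (M (n - 1)) (\<pi> n)))) -
     int (the_enat (module_length Zp (coker_module (M n) (M (n - 1)) (\<pi> n)))) +
     int (Qp_dim (M (n - 1)))"


section \<open>Cyclotomic polynomials and the Iwasawa algebra\<close>

definition primitive_unity_root :: "nat \<Rightarrow> 'a :: comm_ring_1 \<Rightarrow> bool" where
  "primitive_unity_root N z \<longleftrightarrow> z ^ N = 1 \<and> (\<forall>k. 0 < k \<and> k < N \<longrightarrow> z ^ k \<noteq> 1)"

definition cyclotomic_poly :: "nat \<Rightarrow> int poly" where
  "cyclotomic_poly N =
     (THE q. map_poly of_int q = (\<Prod>z | primitive_unity_root N z. [:- z, 1 :: complex:]))"

type_synonym 'p iwasawa = "'p padic_int fps"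

definition cyc_factor :: "nat \<Rightarrow> 'p :: prime_card iwasawa" (\<open>\<Phi>\<close>) where
  "\<Phi> m = (if m = 0 then fps_X
          else fps_of_poly (pcompose (map_poly of_int (cyclotomic_poly (CARD('p) ^ m))) [:1, 1:]))"

definition omega :: "nat \<Rightarrow> 'p :: prime_card iwasawa" (\<open>\<omega>\<close>) where
  "\<omega> n = (1 + fps_X) ^ (CARD('p) ^ n) - 1"

definition Lambda2 :: "('p :: prime_card iwasawa, 'p iwasawa ^ 2) module" where
  "Lambda2 = \<lparr>carrier = UNIV, monoid.mult = undefined, one = undefined, ring.zero = 0, add = (+),
              smult = vector_scalar_mult\<rparr>"

definition level_submodule :: "'p :: prime_card iwasawa ^ 2 ^ 2 \<Rightarrow> nat \<Rightarrow> ('p iwasawa ^ 2) set" where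
  "level_submodule A n = Modules.module.span vector_scalar_mult (columns (mat (\<omega> n)) \<union> columns A)"

definition level_module ::
    "'p :: prime_card iwasawa ^ 2 ^ 2 \<Rightarrow> nat \<Rightarrow> ('p padic_int, ('p iwasawa ^ 2) set) module" where
  "level_module A n = restrict_scalars fps_const (quotient_module Lambda2 (level_submodule A n))"

text \<open>The natural projection sends $x + N_n$ to $x + N_{n-1} = (x + N_n) + N_{n-1}$, where
  $N_n \subseteq N_{n-1}$ are the two submodules.\<close>

definition level_proj ::
    "'p :: prime_card iwasawa ^ 2 ^ 2 \<Rightarrow> nat \<Rightarrow> ('p iwasawa ^ 2) set \<Rightarrow> ('p iwasawa ^ 2) set" where
  "level_proj A n C = C <+>\<^bsub>Lambda2\<^esub> level_submodule A (n - 1)"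

definition special_relative_to :: "'p :: prime_card iwasawa ^ 2 ^ 2 \<Rightarrow> nat \<Rightarrow> bool" where
  "special_relative_to A n \<longleftrightarrow>
     (\<forall>m\<le>n. \<Phi> m dvd det A \<longrightarrow>
        (\<Phi> m dvd A $ 1 $ 1 \<and> \<Phi> m dvd A $ 2 $ 1) \<or> (\<Phi> m dvd A $ 1 $ 2 \<and> \<Phi> m dvd A $ 2 $ 2))"


section \<open>Valuations on cyclotomic extensions of $\mathbb{Q}_p$\<close>

type_synonym 'p Qp_closure = "'p padic_int fract alg_closure"

definition of_padic_int :: "'p :: prime_card padic_int \<Rightarrow> 'p Qp_closure" where
  "of_padic_int x = to_ac (Fract x 1)"

definition Qp_adjoin :: "'p :: prime_card Qp_closure \<Rightarrow> 'p Qp_closure set" where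
  "Qp_adjoin z = generate_field ring_of_type_algebra (insert z (range to_ac))"

text \<open>\<open>v\<close> is an additive valuation on the field \<open>K\<close>, its restriction to $\mathbb{Z}_p$ is a positive
  multiple of the $p$-adic valuation (it is nonnegative there, and positive exactly on
  $p\mathbb{Z}_p$), and it is scaled so that \<open>v u = 1\<close>. Values of \<open>v\<close> outside \<open>K\<close> are
  unconstrained.\<close>

definition normalized_valuation ::
    "'p :: prime_card Qp_closure set \<Rightarrow> 'p Qp_closure \<Rightarrow> ('p Qp_closure \<Rightarrow> ereal) \<Rightarrow> bool" where
  "normalized_valuation K u v \<longleftrightarrow>
     (\<forall>x\<in>K. v x \<noteq> -\<infinity> \<and> (v x = \<infinity> \<longleftrightarrow> x = 0)) \<and>
     (\<forall>x\<in>K. \<forall>y\<in>K. v (x * y) = v x + v y) \<and>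
     (\<forall>x\<in>K. \<forall>y\<in>K. min (v x) (v y) \<le> v (x + y)) \<and>
     (\<forall>x. 0 \<le> v (of_padic_int x) \<and> (0 < v (of_padic_int x) \<longleftrightarrow> of_nat CARD('p) dvd x)) \<and>
     v u = 1"

text \<open>The sum of the series \<open>f\<close> at the point \<open>t\<close>, in the topology that \<open>v\<close> defines on \<open>K\<close>.\<close>

definition iwasawa_eval ::
    "'p :: prime_card Qp_closure set \<Rightarrow> ('p Qp_closure \<Rightarrow> ereal) \<Rightarrow> 'p iwasawa \<Rightarrow> 'p Qp_closure \<Rightarrow>
     'p Qp_closure" where
  "iwasawa_eval K v f t =
     (THE y. y \<in> K \<and>
        (\<lambda>N. v (y - (\<Sum>k<N. of_padic_int (fps_nth f k) * t ^ k))) \<longlonglongrightarrow> \<infinity>)"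

end

theory Submission
  imports Defs
begin

text \<open>Put \<open>N\<^sub>k = \<omega>\<^sub>k\<Lambda>\<^sup>2 + A\<Lambda>\<^sup>2\<close>. The projection \<open>A\<^sub>(\<^sub>n\<^sub>) \<rightarrow> A\<^sub>(\<^sub>n\<^sub>-\<^sub>1\<^sub>)\<close> is onto with kernel
  \<open>N\<^sub>n\<^sub>-\<^sub>1/N\<^sub>n\<close>. Write \<open>A = A' diag(u\<^sub>1, u\<^sub>2)\<close>, where \<open>u\<^sub>j\<close> is the product of those
  \<open>\<Phi>\<^sub>m\<close>, \<open>m < n\<close>, that divide the \<open>j\<close>-th column of \<open>A\<close>. Since \<open>A\<close> is special,
  \<open>\<omega>\<^sub>n\<^sub>-\<^sub>1\<close> divides \<open>A x\<close> if and only if \<open>\<omega>\<^sub>n\<^sub>-\<^sub>1\<close> divides each \<open>u\<^sub>j x\<^sub>j\<close>; hence multiplication by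
  \<open>\<omega>\<^sub>n\<^sub>-\<^sub>1\<close> identifies \<open>\<Lambda>\<^sup>2/(\<Phi>\<^sub>n\<Lambda>\<^sup>2 + A'\<Lambda>\<^sup>2)\<close> with the kernel. Over the discrete valuation ring
  \<open>\<Lambda>/(\<Phi>\<^sub>n)\<close>, with uniformizer \<open>X\<close> and residue field of order \<open>p\<close>, this quotient has length
  \<open>ord(det A') = ord(det A) - ord(u\<^sub>1) - ord(u\<^sub>2)\<close>. For \<open>m < n\<close>, each column divisible by \<open>\<Phi>\<^sub>m\<close>
  contributes \<open>deg \<Phi>\<^sub>m\<close> to the rank of \<open>A\<^sub>(\<^sub>n\<^sub>-\<^sub>1\<^sub>)\<close>, and \<open>\<Phi>\<^sub>m\<close> has valuation \<open>deg \<Phi>\<^sub>m\<close> in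
  \<open>\<Lambda>/(\<Phi>\<^sub>n)\<close>, so the rank makes up exactly for \<open>ord(u\<^sub>1) + ord(u\<^sub>2)\<close>.\<close>

section \<open>The $p$-adic integers and Weierstrass division\<close>

text \<open>No quotient ring is formed: \<Lambda>/(\<Phi>_m) is seen through congruences modulo
  \<Phi>_m between power series, and a submodule of \<Lambda>^2/N through its preimage in
  \<Lambda>^2. This works because every \<Phi>_m and \<omega>_k has the shape X^d + p P, which
  permits Weierstrass division. Length and rank are local at different primes. The length of the
  kernel is taken at \<Phi>_n alone, where p is a unit times X^d; simple quotients have order p over
  \<Lambda>/(\<Phi>_n) and over Z_p alike, so the length can be bounded by counting cosets. The rank
  is taken after inverting p, where distinct \<Phi>_m become coprime; it is therefore a sum over m,
  read off the filtration by the N_k. Both halves use that A is special. If the columns were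
  proportional modulo \<Phi>_m and neither were divisible by it, \<Phi>_m could not be split off
  from a column and would still contribute to the rank. Where \<Phi>_m does not divide the
  determinant, Cramer's rule takes over.\<close>

abbreviation pp :: "'p :: prime_card padic_int" where
  "pp \<equiv> of_nat CARD('p)"

lemma padic_res_range: "0 \<le> padic_res (x :: 'p :: prime_card padic_int) n" "padic_res x n < int CARD('p) ^ n"
  using padic_res[of x] by auto

lemma padic_res_of_nat:
  "padic_res (of_nat m :: 'p :: prime_card padic_int) n = int m mod int CARD('p) ^ n"
proof (induction m)
  case 0
  show ?case by (simp add: zero_padic_int.rep_eq)
next
  case (Suc m)
  then show ?case by (simp add: plus_padic_int.rep_eq one_padic_int.rep_eq mod_simps add.commute)
qed

lemma padic_eqI: "(\<And>n. padic_res x n = padic_res y n) \<Longrightarrow> x = y"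
  using padic_res_inject[of x y] by blast

lemma padic_int_of_seq:
  assumes "\<And>n. [a (Suc n) = a n] (mod int CARD('p :: prime_card) ^ n)"
  obtains x :: "'p :: prime_card padic_int" where "\<And>n. padic_res x n = a n mod int CARD('p) ^ n"
proof
  fix n
  show "padic_res (Abs_padic_int (\<lambda>n. a n mod int CARD('p) ^ n) :: 'p padic_int) n = a n mod int CARD('p) ^ n"
    by (subst Abs_padic_int_inverse) (use padic_mod_in[OF assms] in blast)+
qed

text \<open>Dividing by p^k costs k levels of precision: the residue of the quotient modulo p^n is
  read off the residue of x modulo p^(n + k), which is a multiple of p^k.\<close>

lemma pp_power_dvd_iff: "pp ^ k dvd (x :: 'p :: prime_card padic_int) \<longleftrightarrow> padic_res x k = 0"
proof
  assume "pp ^ k dvd x"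
  then obtain y where y: "x = of_nat (CARD('p) ^ k) * y" by (auto simp: dvd_def)
  then have "padic_res x k = int (CARD('p) ^ k) mod int CARD('p) ^ k * padic_res y k mod int CARD('p) ^ k"
    by (simp add: times_padic_int.rep_eq padic_res_of_nat del: of_nat_power)
  then show "padic_res x k = 0" by simp
next
  let ?p = "int CARD('p)"
  assume 0: "padic_res x k = 0"
  have p0: "?p > 0" by simp
  define a where "a n = padic_res x (n + k) div ?p ^ k" for n
  have d: "?p ^ k dvd padic_res x (n + k)" for n
    using padic_res_mod[of x k n] 0 by (simp add: add.commute dvd_eq_mod_eq_0)
  then have a: "padic_res x (n + k) = ?p ^ k * a n" for n by (simp add: a_def)
  have "[a (Suc n) = a n] (mod ?p ^ n)" for n
  proof -
    have "[padic_res x (Suc (n + k)) = padic_res x (n + k)] (mod ?p ^ (n + k))"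
      using padic_res[of x] by blast
    then have "[?p ^ k * a (Suc n) = ?p ^ k * a n] (mod ?p ^ k * ?p ^ n)"
      using a[of n] a[of "Suc n"] by (simp add: power_add mult.commute)
    then show ?thesis
      by (simp add: cong_iff_dvd_diff flip: right_diff_distrib)
  qed
  then obtain y :: "'p padic_int" where y: "\<And>n. padic_res y n = a n mod ?p ^ n"
    using padic_int_of_seq by blast
  have "padic_res x n = padic_res (of_nat (CARD('p) ^ k) * y) n" for n
  proof -
    have "padic_res (of_nat (CARD('p) ^ k) * y) n = (?p ^ k * a n) mod ?p ^ n"
      by (simp add: times_padic_int.rep_eq padic_res_of_nat y mod_simps del: of_nat_power)
         (simp add: mod_simps)
    also have "\<dots> = padic_res x n"
      using padic_res_mod[of x n k] by (simp add: a)
    finally show ?thesis by simp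
  qed
  then have "x = of_nat (CARD('p) ^ k) * y" by (rule padic_eqI)
  then show "pp ^ k dvd x" by simp
qed

lemma padic_int_eq_0I: "(\<And>k. pp ^ k dvd (x :: 'p :: prime_card padic_int)) \<Longrightarrow> x = 0"
  by (rule padic_eqI) (simp add: pp_power_dvd_iff zero_padic_int.rep_eq)

lemma pp_nonzero: "(pp :: 'p :: prime_card padic_int) \<noteq> 0"
proof
  assume "(pp :: 'p padic_int) = 0"
  then have "padic_res (pp :: 'p padic_int) 2 = 0" by (simp add: zero_padic_int.rep_eq)
  then have "int CARD('p) ^ 2 dvd int CARD('p)" by (simp add: padic_res_of_nat dvd_eq_mod_eq_0)
  moreover have "int CARD('p) > 1" using prime_card_int[where 'a='p] prime_gt_1_int by blast
  ultimately show False by (simp add: power2_eq_square)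
qed

lemma pp_not_unit: "\<not> (pp :: 'p :: prime_card padic_int) dvd 1"
proof
  assume "(pp :: 'p padic_int) dvd 1"
  then have "padic_res (1 :: 'p padic_int) 1 = 0" using pp_power_dvd_iff[of 1 "1 :: 'p padic_int"] by (simp only: power_one_right)
  moreover have "int CARD('p) > 1" using prime_card_int[where 'a='p] prime_gt_1_int by blast
  ultimately show False by (simp add: one_padic_int.rep_eq)
qed

text \<open>Completeness of Z_p for series in powers of p. The n-th residue of the limit is that of
  the n-th partial sum; these are compatible because the next term is a multiple of p^n.\<close>

lemma padic_series:
  fixes s :: "nat \<Rightarrow> 'p :: prime_card padic_int"
  obtains L where "\<And>n. pp ^ n dvd L - (\<Sum>i<n. pp ^ i * s i)"
proof -
  let ?p = "int CARD('p)" and ?S = "\<lambda>n. \<Sum>i<n. pp ^ i * s i"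
  have res_diff: "pp ^ n dvd x - y \<longleftrightarrow> [padic_res x n = padic_res y n] (mod ?p ^ n)"
    for x y :: "'p padic_int" and n
    by (simp add: pp_power_dvd_iff minus_padic_int.rep_eq cong_iff_dvd_diff dvd_eq_mod_eq_0)
  have "[padic_res (?S (Suc n)) (Suc n) = padic_res (?S n) n] (mod ?p ^ n)" for n
  proof -
    have "[padic_res (?S (Suc n)) (Suc n) = padic_res (?S (Suc n)) n] (mod ?p ^ n)"
      using padic_res_mod[of "?S (Suc n)" n 1] by (simp add: cong_def mod_mod_trivial del: sum.lessThan_Suc)
         (metis mod_mod_trivial)
    moreover have "pp ^ n dvd ?S (Suc n) - ?S n" by simp
    ultimately show ?thesis using res_diff cong_trans by blast
  qed
  then obtain L :: "'p padic_int" where L: "\<And>n. padic_res L n = padic_res (?S n) n mod ?p ^ n"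
    using padic_int_of_seq[of "\<lambda>n. padic_res (?S n) n"] by blast
  have "pp ^ n dvd L - ?S n" for n
    unfolding res_diff by (simp add: L cong_def)
  then show ?thesis using that by blast
qed

lemma padic_int_mod_pp:
  fixes x :: "'p :: prime_card padic_int"
  obtains j y where "j < CARD('p)" "x = of_nat j + pp * y"
proof -
  define j where "j = nat (padic_res x 1)"
  have j: "int j = padic_res x 1" "j < CARD('p)" using padic_res_range[of x 1] by (auto simp: j_def)
  have "padic_res (x - of_nat j) 1 = 0"
    using j by (simp add: minus_padic_int.rep_eq padic_res_of_nat)
  then have "pp ^ 1 dvd x - of_nat j" by (simp only: pp_power_dvd_iff)
  then obtain y where "x - of_nat j = pp * y" by (auto simp: dvd_def)
  then show ?thesis using that[of j y] j by (simp add: algebra_simps)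
qed

lemma pp_dvd_of_nat_iff: "(pp :: 'p :: prime_card padic_int) dvd of_nat j \<longleftrightarrow> CARD('p) dvd j"
  using pp_power_dvd_iff[of 1 "of_nat j :: 'p padic_int"]
  by (simp add: padic_res_of_nat dvd_eq_mod_eq_0 flip: of_nat_mod)

text \<open>Write x = j + p y with j prime to p. Multiplication by an inverse a of j modulo p turns
  x into some 1 - p z, which the geometric series inverts.\<close>

lemma padic_unit_iff: "(x :: 'p :: prime_card padic_int) dvd 1 \<longleftrightarrow> \<not> pp dvd x"
proof
  assume "x dvd 1"
  then show "\<not> pp dvd x" using pp_not_unit dvd_trans by blast
next
  assume *: "\<not> pp dvd x"
  obtain j y where j: "x = of_nat j + pp * y" using padic_int_mod_pp by blast
  then have "\<not> CARD('p) dvd j" using * pp_dvd_of_nat_iff[where 'p='p] by (metis dvd_add dvd_triv_left)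
  then have "coprime j CARD('p)"
    using prime_card[where 'a='p] by (metis coprime_commute prime_imp_coprime)
  then obtain a where a: "[j * a = 1] (mod CARD('p))" using cong_solve_coprime_nat[of j "CARD('p)"] by auto
  then have "[int (j * a) = int 1] (mod int CARD('p))" by (simp only: cong_int_iff)
  then obtain b where "int j * int a = 1 + int CARD('p) * b" by (metis cong_iff_lin cong_sym mult.commute of_nat_1 of_nat_mult)
  then have "(of_int (int j * int a) :: 'p padic_int) = of_int (1 + int CARD('p) * b)" by (simp only:)
  then have b: "of_nat j * of_nat a = 1 + pp * (of_int b :: 'p padic_int)" by simp
  define z where "z = - (of_int b + y * of_nat a)"
  have xa: "x * of_nat a = 1 - pp * z" unfolding z_def j using b by (simp add: algebra_simps)
  obtain L :: "'p padic_int" where L: "\<And>n. pp ^ n dvd L - (\<Sum>i<n. pp ^ i * z ^ i)"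
    using padic_series[of "\<lambda>i. z ^ i"] by blast
  have "pp ^ n dvd (1 - pp * z) * L - 1" for n
  proof -
    have "(1 - pp * z) * (\<Sum>i<n. (pp * z) ^ i) = 1 - (pp * z) ^ n"
      by (simp only: one_diff_power_eq)
    then have "(1 - pp * z) * L - 1 = (1 - pp * z) * (L - (\<Sum>i<n. pp ^ i * z ^ i)) - pp ^ n * z ^ n"
      by (simp add: right_diff_distrib power_mult_distrib)
    then show ?thesis using L[of n] by (simp only: dvd_diff dvd_mult dvd_triv_left)
  qed
  then have "(1 - pp * z) * L - 1 = 0" by (rule padic_int_eq_0I)
  then have "x * (of_nat a * L) = 1" using xa by (simp flip: mult.assoc)
  then show "x dvd 1" by (metis dvd_triv_left)
qed

lemma padic_int_decompose:
  fixes x :: "'p :: prime_card padic_int"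
  assumes "x \<noteq> 0"
  obtains k u where "u dvd 1" "x = pp ^ k * u"
proof -
  obtain k where k: "\<not> pp ^ Suc k dvd x" "pp ^ k dvd x"
  proof -
    obtain n where "\<not> pp ^ n dvd x" using assms padic_int_eq_0I by blast
    define n0 where "n0 = (LEAST n. \<not> pp ^ n dvd x)"
    have n0: "\<not> pp ^ n0 dvd x" unfolding n0_def by (rule LeastI) fact
    have "pp ^ m dvd x" if "m < n0" for m using not_less_Least[OF that[unfolded n0_def]] by blast
    moreover have "n0 \<noteq> 0" using n0 by (metis one_dvd power_0)
    ultimately show ?thesis using that[of "n0 - 1"] n0 by simp
  qed
  obtain u where u: "x = pp ^ k * u" using k(2) by (auto simp: dvd_def)
  then have "\<not> pp dvd u" using k(1) by (metis mult_dvd_mono dvd_refl power_Suc2)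
  then show ?thesis using that u padic_unit_iff by blast
qed

section \<open>Units and p-adic limits in \<Lambda>\<close>

lemma fps_unit_iff: "(f :: 'a :: comm_ring_1 fps) dvd 1 \<longleftrightarrow> fps_nth f 0 dvd 1"
  using fps_is_right_unit_iff_zeroth_is_right_unit[of f] fps_is_left_unit_iff_zeroth_is_left_unit[of f]
  unfolding dvd_def by blast

abbreviation PP :: "'p :: prime_card iwasawa" where
  "PP \<equiv> of_nat CARD('p)"

lemma PP_power_nth: "fps_nth (PP ^ k * f) n = pp ^ k * fps_nth (f :: 'p :: prime_card iwasawa) n"
proof -
  have "(PP :: 'p iwasawa) ^ k = fps_const (pp ^ k)"
    by (metis fps_const_power fps_of_nat)
  then show ?thesis by simp
qed

lemma PP_nth: "fps_nth (PP * f) n = pp * fps_nth (f :: 'p :: prime_card iwasawa) n"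
  using PP_power_nth[of 1 f n] by simp

lemma PP_nonzero: "(PP :: 'p :: prime_card iwasawa) \<noteq> 0"
proof
  assume "(PP :: 'p iwasawa) = 0"
  then have "fps_nth (PP * 1 :: 'p iwasawa) 0 = 0" by (simp only: mult_zero_left fps_zero_nth)
  then show False using pp_nonzero[where 'p='p] by (simp only: PP_nth fps_one_nth) simp
qed

lemma PP_power_dvd_iff: "PP ^ k dvd (f :: 'p :: prime_card iwasawa) \<longleftrightarrow> (\<forall>n. pp ^ k dvd fps_nth f n)"
proof
  assume "PP ^ k dvd f"
  then show "\<forall>n. pp ^ k dvd fps_nth f n" by (auto simp: PP_power_nth elim!: dvdE)
next
  assume "\<forall>n. pp ^ k dvd fps_nth f n"
  then have "\<forall>n. \<exists>y. fps_nth f n = pp ^ k * y" by (auto simp: dvd_def)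
  then obtain g where g: "fps_nth f n = pp ^ k * g n" for n by (auto dest!: choice)
  have "f = PP ^ k * Abs_fps g" by (rule fps_ext) (simp only: PP_power_nth g fps_nth_Abs_fps)
  then show "PP ^ k dvd f" by (rule dvdI)
qed

lemma iwasawa_eq_0I: "(\<And>k. PP ^ k dvd (f :: 'p :: prime_card iwasawa)) \<Longrightarrow> f = 0"
  by (rule fps_ext) (auto simp: PP_power_dvd_iff intro: padic_int_eq_0I)

lemma iwasawa_series:
  fixes s :: "nat \<Rightarrow> 'p :: prime_card iwasawa"
  obtains L where "\<And>n. PP ^ n dvd L - (\<Sum>i<n. PP ^ i * s i)"
proof -
  have "\<exists>L. \<forall>n. pp ^ n dvd L - (\<Sum>i<n. pp ^ i * fps_nth (s i) j)" for j
    by (rule padic_series[of "\<lambda>i. fps_nth (s i) j"]) blast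
  then obtain L where "\<And>j n. pp ^ n dvd L j - (\<Sum>i<n. pp ^ i * fps_nth (s i) j)" by metis
  then have "PP ^ n dvd Abs_fps L - (\<Sum>i<n. PP ^ i * s i)" for n
    by (auto simp: PP_power_dvd_iff fps_sum_nth PP_power_nth)
  then show ?thesis using that by blast
qed

text \<open>Weierstrass division: dividing by \<open>D = X\<^sup>d + p P\<close> amounts to dividing by \<open>X\<^sup>d\<close> up to a multiple
  of \<open>p\<close>, and the errors form a \<open>p\<close>-adically convergent series.\<close>

lemma weierstrass_division:
  fixes f P :: "'p :: prime_card iwasawa"
  obtains q r where "f = q * (fps_X ^ d + PP * P) + r" "\<And>i. i \<ge> d \<Longrightarrow> fps_nth r i = 0"
proof -
  let ?D = "fps_X ^ d + PP * P"
  have split: "g = fps_shift d g * fps_X ^ d + fps_cutoff d g" for g :: "'p iwasawa"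
    by (rule fps_ext) (simp add: fps_X_power_mult_right_nth)
  define F where "F n = ((\<lambda>g. - (P * fps_shift d g)) ^^ n) f" for n
  have F_Suc: "F n = fps_shift d (F n) * ?D + fps_cutoff d (F n) + PP * F (Suc n)" for n
    using split[of "F n"] by (simp add: F_def algebra_simps)
  obtain q where q: "\<And>n. PP ^ n dvd q - (\<Sum>i<n. PP ^ i * fps_shift d (F i))"
    using iwasawa_series[of "\<lambda>i. fps_shift d (F i)"] by blast
  obtain r where r: "\<And>n. PP ^ n dvd r - (\<Sum>i<n. PP ^ i * fps_cutoff d (F i))"
    using iwasawa_series[of "\<lambda>i. fps_cutoff d (F i)"] by blast
  have f: "f = (\<Sum>i<n. PP ^ i * fps_shift d (F i)) * ?D + (\<Sum>i<n. PP ^ i * fps_cutoff d (F i)) + PP ^ n * F n" for n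
  proof (induction n)
    case 0
    show ?case by (simp add: F_def)
  next
    case (Suc n)
    have "PP ^ n * F n = PP ^ n * fps_shift d (F n) * ?D + PP ^ n * fps_cutoff d (F n) + PP ^ Suc n * F (Suc n)"
      by (subst F_Suc) (simp add: algebra_simps)
    then show ?case by (subst Suc) (simp add: algebra_simps)
  qed
  have "PP ^ n dvd f - (q * ?D + r)" for n
  proof -
    have "f - (q * ?D + r) = PP ^ n * F n - (q - (\<Sum>i<n. PP ^ i * fps_shift d (F i))) * ?D
        - (r - (\<Sum>i<n. PP ^ i * fps_cutoff d (F i)))"
      using f[of n] by (simp add: algebra_simps)
    then show ?thesis using q[of n] r[of n] by (simp only: dvd_diff dvd_mult2 dvd_triv_left)
  qed
  then have "f - (q * ?D + r) = 0" by (rule iwasawa_eq_0I)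
  moreover have "fps_nth r i = 0" if "i \<ge> d" for i
  proof (rule padic_int_eq_0I)
    fix n
    have "pp ^ n dvd fps_nth (r - (\<Sum>j<n. PP ^ j * fps_cutoff d (F j))) i"
      using r[of n] by (simp only: PP_power_dvd_iff)
    then show "pp ^ n dvd fps_nth r i" using that by (simp add: fps_sum_nth PP_power_nth)
  qed
  ultimately show ?thesis using that[of q r] by simp
qed

text \<open>Modulo p the equation reads q X^d + r = 0, and the two summands have disjoint supports.
  So p divides q and r, and after division by p the same hypotheses hold again.\<close>

lemma weierstrass_unique:
  fixes q r P :: "'p :: prime_card iwasawa"
  assumes "q * (fps_X ^ d + PP * P) + r = 0" "\<And>i. i \<ge> d \<Longrightarrow> fps_nth r i = 0"
  shows "q = 0" "r = 0"
proof -
  have "PP ^ k dvd q \<and> PP ^ k dvd r" for k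
    using assms
  proof (induction k arbitrary: q r)
    case 0
    then show ?case by simp
  next
    case (Suc k)
    have "q * fps_X ^ d + r = (q * (fps_X ^ d + PP * P) + r) - PP * (P * q)"
      by (simp add: algebra_simps)
    then have eq: "q * fps_X ^ d + r = - (PP * (P * q))" unfolding Suc.prems(1) by simp
    have "pp dvd fps_nth (q * fps_X ^ d + r) i" for i
      unfolding eq by (simp add: PP_nth)
    then have *: "pp dvd (if i < d then 0 else fps_nth q (i - d)) + fps_nth r i" for i
      by (simp add: fps_X_power_mult_right_nth)
    have "pp dvd fps_nth q i" for i using *[of "i + d"] Suc.prems(2)[of "i + d"] by simp
    then have "PP dvd q" using PP_power_dvd_iff[of 1 q] by simp
    moreover have "pp dvd fps_nth r i" for i
      using *[of i] Suc.prems(2)[of i] by (cases "i < d") auto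
    then have "PP dvd r" using PP_power_dvd_iff[of 1 r] by simp
    ultimately obtain q' r' where qr: "q = PP * q'" "r = PP * r'" by (auto simp: dvd_def)
    have "PP * (q' * (fps_X ^ d + PP * P) + r') = 0" using Suc.prems(1) qr by (simp add: algebra_simps)
    then have "q' * (fps_X ^ d + PP * P) + r' = 0" using PP_nonzero by (metis mult_eq_0_iff)
    moreover have "fps_nth r' i = 0" if "i \<ge> d" for i
      using Suc.prems(2)[OF that] qr pp_nonzero[where 'p='p] by (simp add: PP_nth)
    ultimately have "PP ^ k dvd q' \<and> PP ^ k dvd r'" by (rule Suc.IH)
    then show ?case using qr by (auto intro: mult_dvd_mono)
  qed
  then show "q = 0" "r = 0" by (auto intro: iwasawa_eq_0I)
qed

section \<open>Eisenstein power series\<close>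

lemma dvd_diffE:
  fixes D :: "'a :: comm_ring_1"
  assumes "D dvd a - b"
  obtains t where "a = b + D * t"
proof -
  obtain t where "a - b = D * t" using assms by (rule dvdE)
  then show ?thesis using that by (simp add: diff_eq_eq add.commute)
qed

lemma diff_dvd_power_diff: "(x :: 'a :: comm_ring_1) - y dvd x ^ n - y ^ n"
  by (simp only: power_diff_sumr2 dvd_triv_left)

lemma PP_power_nth_0: "fps_nth (PP ^ k :: 'p :: prime_card iwasawa) 0 = pp ^ k"
  using PP_power_nth[of k 1 0] by simp

lemma fps_X_dvd_iff: "fps_X dvd (f :: 'a :: comm_ring_1 fps) \<longleftrightarrow> fps_nth f 0 = 0"
proof
  assume "fps_nth f 0 = 0"
  then have "f = fps_X * fps_shift 1 f" by (intro fps_ext) (simp add: fps_X_mult_nth)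
  then show "fps_X dvd f" by (rule dvdI)
qed auto

lemma prime_elem_fps_X: "prime_elem (fps_X :: 'a :: idom fps)"
  unfolding prime_elem_def by (auto simp: fps_X_dvd_iff fps_unit_iff)

text \<open>The power series analogue of an Eisenstein polynomial. Since d is positive, asking P to
  be a unit says that the constant term of D is p times a unit; P may have terms of every
  degree.\<close>

definition eisenstein :: "nat \<Rightarrow> 'p :: prime_card iwasawa \<Rightarrow> bool" where
  "eisenstein d D \<longleftrightarrow> d \<ge> 1 \<and> (\<exists>P. P dvd 1 \<and> D = fps_X ^ d + PP * P)"

text \<open>In the discrete valuation ring \<open>\<Lambda>/(D)\<close>, the class of \<open>f\<close> has valuation \<open>k\<close>.\<close>

definition x_ord :: "'p :: prime_card iwasawa \<Rightarrow> 'p iwasawa \<Rightarrow> nat \<Rightarrow> bool" where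
  "x_ord D f k \<longleftrightarrow> (\<exists>u g. u dvd 1 \<and> f = fps_X ^ k * u + D * g)"

lemma eisenstein_nth_0:
  assumes "eisenstein d (D :: 'p :: prime_card iwasawa)"
  shows "pp dvd fps_nth D 0" "fps_nth D 0 \<noteq> 0"
proof -
  obtain P where P: "P dvd 1" "D = fps_X ^ d + PP * P" and d: "d \<ge> 1"
    using assms by (auto simp: eisenstein_def)
  have e: "fps_nth D 0 = pp * fps_nth P 0"
    using d by (simp add: P(2) PP_nth fps_X_power_iff)
  show "pp dvd fps_nth D 0" by (simp add: e)
  have "fps_nth P 0 \<noteq> 0" using P(1) by (auto simp: fps_unit_iff)
  then show "fps_nth D 0 \<noteq> 0" using pp_nonzero[where 'p='p] by (simp add: e)
qed

text \<open>X is a prime element that does not divide D, so it can be cancelled from D | X^(k + 1);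
  and D itself is not a unit, its constant term being a multiple of p.\<close>

lemma eisenstein_not_dvd_X_power:
  assumes "eisenstein d (D :: 'p :: prime_card iwasawa)" "u dvd 1"
  shows "\<not> D dvd fps_X ^ k * u"
proof -
  have *: "\<not> D dvd fps_X ^ k"
  proof (induction k)
    case 0
    have "\<not> fps_nth D 0 dvd 1" using eisenstein_nth_0[OF assms(1)] pp_not_unit dvd_trans by blast
    then show ?case by (simp add: fps_unit_iff)
  next
    case (Suc k)
    show ?case
    proof
      assume "D dvd fps_X ^ Suc k"
      then obtain h where h: "fps_X * fps_X ^ k = D * h" by (auto simp: dvd_def)
      have "\<not> fps_X dvd D" using eisenstein_nth_0[OF assms(1)] by (simp add: fps_X_dvd_iff)
      moreover have "fps_X dvd D * h" unfolding h[symmetric] by simp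
      ultimately have "fps_X dvd h" using prime_elem_dvd_multD[OF prime_elem_fps_X] by blast
      then obtain h' where "h = fps_X * h'" by (auto simp: dvd_def)
      then have "fps_X * fps_X ^ k = fps_X * (D * h')" using h by (simp add: mult_ac)
      then have "fps_X ^ k = D * h'" by simp
      then show False using Suc by (metis dvd_triv_left)
    qed
  qed
  obtain v where "1 = u * v" using assms(2) by (auto simp: dvd_def)
  then have "fps_X ^ k = (fps_X ^ k * u) * v" by (simp add: mult.assoc flip: \<open>1 = u * v\<close>)
  then show ?thesis using * by (metis dvd_mult2)
qed

text \<open>Total ramification: as P is a unit, D = X^d + p P can be solved for p.\<close>

lemma eisenstein_p:
  assumes "eisenstein d (D :: 'p :: prime_card iwasawa)"
  obtains v w where "v dvd 1" "PP = fps_X ^ d * v + D * w"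
proof -
  obtain P where P: "P dvd 1" "D = fps_X ^ d + PP * P" using assms by (auto simp: eisenstein_def)
  then obtain Q where Q: "1 = P * Q" by (auto simp: dvd_def)
  have "PP = PP * (P * Q)" by (simp flip: Q)
  also have "\<dots> = fps_X ^ d * (- Q) + D * Q" by (simp add: P(2) algebra_simps)
  finally have "PP = fps_X ^ d * (- Q) + D * Q" .
  moreover have "- Q dvd 1" using Q by (metis dvd_triv_right minus_dvd_iff)
  ultimately show ?thesis using that by blast
qed

text \<open>The residue field of \<Lambda> is F_p. The part in the maximal ideal is given
  explicitly, so that modulo an Eisenstein D the multiple of p can be turned into a multiple of
  X.\<close>

lemma iwasawa_decompose:
  fixes h :: "'p :: prime_card iwasawa"
  obtains j c h' where "j < CARD('p)" "h = of_nat j + PP * fps_const c + fps_X * h'"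
proof -
  obtain j c where j: "j < CARD('p)" "fps_nth h 0 = of_nat j + pp * c" using padic_int_mod_pp by blast
  have "h - (of_nat j + PP * fps_const c) = fps_X * fps_shift 1 h"
  proof (rule fps_ext)
    fix n
    have "fps_nth (of_nat j :: 'p iwasawa) n = (if n = 0 then of_nat j else 0)"
      by (simp flip: fps_of_nat)
    then show "fps_nth (h - (of_nat j + PP * fps_const c)) n = fps_nth (fps_X * fps_shift 1 h) n"
      using j by (simp add: PP_nth fps_X_mult_nth)
  qed
  then show ?thesis using that[of j c "fps_shift 1 h"] j(1) by (simp add: algebra_simps)
qed

text \<open>A non-unit has constant term divisible by p, and p is a multiple of X modulo D; so an f
  without order could be divided by X indefinitely modulo D. Its Weierstrass remainder would then be
  divisible by every power of p, hence zero.\<close>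

lemma x_ord_exists:
  assumes D: "eisenstein d (D :: 'p :: prime_card iwasawa)" and "\<not> D dvd f"
  obtains k where "x_ord D f k"
proof (rule ccontr)
  assume "\<not> thesis"
  then have no: "\<not> x_ord D f k" for k using that by blast
  obtain v w where vw: "v dvd 1" "PP = fps_X ^ d * v + D * w" using eisenstein_p[OF D] by blast
  obtain d' where d': "d = Suc d'" using D by (cases d) (auto simp: eisenstein_def)
  have *: "\<exists>h g. f = fps_X ^ k * h + D * g" for k
  proof (induction k)
    case 0
    show ?case by (rule exI[of _ f], rule exI[of _ 0]) simp
  next
    case (Suc k)
    then obtain h g where hg: "f = fps_X ^ k * h + D * g" by blast
    then have "\<not> h dvd 1" using no by (auto simp: x_ord_def)
    then have "pp dvd fps_nth h 0" by (simp add: fps_unit_iff padic_unit_iff)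
    then obtain y where y: "fps_nth h 0 = pp * y" by (auto simp: dvd_def)
    have "h = PP * fps_const y + fps_X * fps_shift 1 h"
      by (rule fps_ext) (simp add: PP_nth y fps_X_mult_nth)
    also have "\<dots> = fps_X * (fps_X ^ d' * v * fps_const y + fps_shift 1 h) + D * (w * fps_const y)"
      by (subst vw(2)) (simp add: d' algebra_simps)
    finally obtain h1 h2 where "h = fps_X * h1 + D * h2" by blast
    then have "f = fps_X ^ Suc k * h1 + D * (g + fps_X ^ k * h2)"
      by (subst hg) (simp add: algebra_simps)
    then show ?case by blast
  qed
  obtain P where P: "D = fps_X ^ d + PP * P" using D by (auto simp: eisenstein_def)
  obtain q r where qr: "f = q * D + r" "\<And>i. i \<ge> d \<Longrightarrow> fps_nth r i = 0"
    using weierstrass_division[of f d P] P by metis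
  have "PP ^ k dvd r" for k
  proof -
    \<comment> \<open>Modulo D, X^d is - p P, so a multiple of X^(d k) is a multiple of p^k.
      Uniqueness of the remainder carries this over to r.\<close>
    have "fps_X ^ d - (- (PP * P)) = D" by (simp add: P)
    then have "D dvd (fps_X ^ d) ^ k - (- (PP * P)) ^ k" by (metis diff_dvd_power_diff)
    then have "D dvd fps_X ^ (d * k) - (- (PP * P)) ^ k" by (simp only: power_mult)
    then obtain t where t: "fps_X ^ (d * k) = (- (PP * P)) ^ k + D * t" by (rule dvd_diffE)
    have "(- (PP * P)) ^ k = PP ^ k * (- P) ^ k" by (simp only: mult_minus_right[symmetric] power_mult_distrib)
    then have t': "fps_X ^ (d * k) = PP ^ k * (- P) ^ k + D * t" using t by (simp only:)
    obtain h g where hg: "f = fps_X ^ (d * k) * h + D * g" using * by blast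
    obtain q' r' where qr': "(- P) ^ k * h = q' * D + r'" "\<And>i. i \<ge> d \<Longrightarrow> fps_nth r' i = 0"
      using weierstrass_division[of "(- P) ^ k * h" d P] P by metis
    have "f = PP ^ k * ((- P) ^ k * h) + D * (t * h + g)"
      by (subst hg, subst t') (simp add: algebra_simps)
    then have "q * D + r = PP ^ k * (q' * D + r') + D * (t * h + g)" using qr(1) qr'(1) by (simp only:)
    then have "(q - (PP ^ k * q' + t * h + g)) * D + (r - PP ^ k * r') = 0"
      by (simp add: algebra_simps)
    then have "r - PP ^ k * r' = 0"
      by (rule weierstrass_unique(2)[where P=P and d=d, folded P]) (simp add: qr(2) qr'(2) PP_power_nth)
    then show ?thesis by simp
  qed
  then have "r = 0" by (rule iwasawa_eq_0I)
  then show False using qr assms(2) by simp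
qed

lemma x_ord_not_dvd: "eisenstein d D \<Longrightarrow> x_ord D f k \<Longrightarrow> \<not> D dvd f"
  using eisenstein_not_dvd_X_power[of d D] unfolding x_ord_def by (metis dvd_add_left_iff dvd_triv_left)

lemma x_ord_mult:
  assumes "x_ord D f k" "x_ord D g l"
  shows "x_ord D (f * g) (k + l)"
proof -
  obtain u a where u: "u dvd 1" "f = fps_X ^ k * u + D * a" using assms(1) by (auto simp: x_ord_def)
  obtain v b where v: "v dvd 1" "g = fps_X ^ l * v + D * b" using assms(2) by (auto simp: x_ord_def)
  have "f * g = fps_X ^ (k + l) * (u * v) + D * (a * g + fps_X ^ k * u * b)"
    by (simp add: u(2) v(2) algebra_simps power_add)
  moreover have "u * v dvd 1" using mult_dvd_mono[OF u(1) v(1)] by simp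
  ultimately show ?thesis unfolding x_ord_def by blast
qed

lemma x_ord_cong: "x_ord D f k \<Longrightarrow> g = f + D * h \<Longrightarrow> x_ord D g k"
  unfolding x_ord_def by (auto simp: add.assoc simp flip: distrib_left)

lemma x_ord_uminus: "x_ord D f k \<Longrightarrow> x_ord D (- f) k"
  unfolding x_ord_def
proof (elim exE conjE)
  fix u g assume "u dvd 1" "f = fps_X ^ k * u + D * g"
  then show "\<exists>u g. u dvd 1 \<and> - f = fps_X ^ k * u + D * g"
    by (intro exI[of _ "- u"] exI[of _ "- g"]) simp
qed

lemma x_ord_X_power:
  assumes "x_ord D f k"
  obtains s t where "fps_X ^ k = f * s + D * t"
proof -
  obtain u g where u: "u dvd 1" "f = fps_X ^ k * u + D * g" using assms by (auto simp: x_ord_def)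
  obtain u' where u': "1 = u * u'" using u(1) by (rule dvdE)
  have "fps_X ^ k = fps_X ^ k * (u * u')" by (simp flip: u')
  also have "\<dots> = f * u' + D * (- (g * u'))" by (simp add: u(2) algebra_simps)
  finally show ?thesis by (rule that)
qed

lemma x_ord_unique:
  assumes "eisenstein d D" "x_ord D f k" "x_ord D f l"
  shows "k = l"
proof -
  have le: "\<not> k < l" if fk: "x_ord D f k" and fl: "x_ord D f l" for k l
  proof
    assume kl: "k < l"
    obtain u a where u: "u dvd 1" "f = fps_X ^ k * u + D * a" using fk by (auto simp: x_ord_def)
    obtain v b where v: "v dvd 1" "f = fps_X ^ l * v + D * b" using fl by (auto simp: x_ord_def)
    have "fps_X ^ l = fps_X ^ k * (fps_X ^ (l - k) :: 'a iwasawa)" using kl by (simp flip: power_add)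
    then have "fps_X ^ k * (u - fps_X ^ (l - k) * v) = fps_X ^ k * u - fps_X ^ l * v"
      by (simp only: right_diff_distrib mult.assoc)
    also have "\<dots> = (f - D * a) - (f - D * b)"
      using u(2) v(2) by (metis add_diff_cancel_right')
    finally have "fps_X ^ k * (u - fps_X ^ (l - k) * v) = D * (b - a)"
      by (simp add: algebra_simps)
    moreover have "u - fps_X ^ (l - k) * v dvd 1"
      using u(1) kl by (simp add: fps_unit_iff)
    ultimately show False using eisenstein_not_dvd_X_power[OF assms(1)] by (metis dvd_triv_left)
  qed
  then show ?thesis using assms by (meson linorder_less_linear)
qed

text \<open>\<open>\<Lambda>/(D)\<close> is a domain of rank \<open>d\<close> over \<open>\<int>\<^sub>p\<close> in which every nonzero ideal contains a power
  of \<open>p\<close>.\<close>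

definition good_prime :: "nat \<Rightarrow> 'p :: prime_card iwasawa \<Rightarrow> bool" where
  "good_prime d D \<longleftrightarrow> prime_elem D \<and> (\<exists>P. D = fps_X ^ d + PP * P) \<and>
     (\<forall>f. \<not> D dvd f \<longrightarrow> (\<exists>k s t. PP ^ k = f * s + D * t))"

text \<open>Orders add under multiplication, so a product of two series that have an order has one
  too and is not divisible by D. An f of order k has X^k in the ideal (f, D), and this ideal then
  contains p^k because p is a multiple of X modulo D.\<close>

lemma eisenstein_good_prime:
  assumes D: "eisenstein d D"
  shows "good_prime d D"
proof -
  have "prime_elem D"
  proof (rule prime_elemI)
    show "D \<noteq> 0" using eisenstein_nth_0[OF D] by auto
    show "\<not> D dvd 1" using eisenstein_not_dvd_X_power[OF D, of 1 0] by simp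
    fix a b assume ab: "D dvd a * b"
    show "D dvd a \<or> D dvd b"
    proof (rule ccontr)
      assume "\<not> (D dvd a \<or> D dvd b)"
      then obtain k l where "x_ord D a k" "x_ord D b l" using x_ord_exists[OF D] by metis
      then have "x_ord D (a * b) (k + l)" by (rule x_ord_mult)
      then show False using ab x_ord_not_dvd[OF D] by blast
    qed
  qed
  moreover have "\<exists>k s t. PP ^ k = f * s + D * t" if nd: "\<not> D dvd f" for f
  proof -
    obtain k where "x_ord D f k" using x_ord_exists[OF D nd] by blast
    then obtain s t' where Xk: "fps_X ^ k = f * s + D * t'" by (rule x_ord_X_power)
    obtain v w where vw: "PP = fps_X ^ d * v + D * w" using eisenstein_p[OF D] by metis
    have "PP - fps_X ^ d * v = D * w" by (subst vw) (rule add_diff_cancel_left')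
    then have "D * w dvd PP ^ k - (fps_X ^ d * v) ^ k" by (metis diff_dvd_power_diff)
    then have "D dvd PP ^ k - (fps_X ^ d * v) ^ k" by (rule dvd_mult_left)
    then obtain t where t: "PP ^ k = (fps_X ^ d * v) ^ k + D * t" by (rule dvd_diffE)
    obtain d' where d': "d = Suc d'" using D by (cases d) (auto simp: eisenstein_def)
    have "(fps_X ^ d * v) ^ k = fps_X ^ k * (fps_X ^ d' * v) ^ k"
      by (simp add: d' mult.assoc flip: power_mult_distrib)
    then have "PP ^ k = (f * s + D * t') * (fps_X ^ d' * v) ^ k + D * t" using t Xk by (simp only:)
    then have "PP ^ k = f * (s * (fps_X ^ d' * v) ^ k) + D * (t + t' * (fps_X ^ d' * v) ^ k)"
      by (simp add: algebra_simps)
    then show ?thesis by blast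
  qed
  ultimately show ?thesis using D unfolding good_prime_def eisenstein_def by blast
qed

text \<open>\<Phi>_0 = X is not Eisenstein, its constant term being 0; \<open>good_prime\<close> is
  the common ground of this case and the others. Here \<Lambda>/(X) is Z_p, and the power of p is
  the one that occurs in f(0).\<close>

lemma fps_X_good_prime: "good_prime 1 (fps_X :: 'p :: prime_card iwasawa)"
proof -
  have "\<exists>k s t. PP ^ k = f * s + fps_X * t" if "\<not> fps_X dvd f" for f :: "'p iwasawa"
  proof -
    have "fps_nth f 0 \<noteq> 0" using that by (simp add: fps_X_dvd_iff)
    then obtain u k where u: "u dvd 1" "fps_nth f 0 = pp ^ k * u" using padic_int_decompose by metis
    then obtain v where v: "1 = u * v" by (auto simp: dvd_def)
    have "fps_nth (PP ^ k - f * fps_const v) 0 = 0"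
      using v u(2) by (simp only: fps_sub_nth PP_power_nth_0 fps_mult_nth_0) (simp add: mult.assoc flip: v)
    then have "fps_X dvd PP ^ k - f * fps_const v" by (simp only: fps_X_dvd_iff)
    then obtain t where "PP ^ k = f * fps_const v + fps_X * t" by (rule dvd_diffE)
    then show ?thesis by blast
  qed
  moreover have "(fps_X :: 'p iwasawa) = fps_X ^ 1 + PP * 0" by simp
  ultimately show ?thesis unfolding good_prime_def using prime_elem_fps_X by blast
qed

text \<open>Modulo D the prime p has order d, more than e, so p Q only alters the unit that
  multiplies X^e.\<close>

lemma x_ord_X_power_plus:
  assumes D: "eisenstein d D" and "e < d"
  shows "x_ord D (fps_X ^ e + PP * Q) e"
proof -
  obtain v w where vw: "PP = fps_X ^ d * v + D * w" using eisenstein_p[OF D] by metis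
  have "fps_X ^ d = fps_X ^ e * (fps_X ^ (d - e) :: 'a iwasawa)" using assms(2) by (simp flip: power_add)
  then have "fps_X ^ e + PP * Q = fps_X ^ e * (1 + fps_X ^ (d - e) * v * Q) + D * (w * Q)"
    by (simp add: vw algebra_simps)
  moreover have "1 + fps_X ^ (d - e) * v * Q dvd 1" using assms(2) by (simp add: fps_unit_iff)
  ultimately show ?thesis unfolding x_ord_def by blast
qed

text \<open>Here p P is the dominant term instead: its order d modulo D is smaller than e, so the
  sum has order d.\<close>

lemma eisenstein_not_dvd_X_power_plus:
  assumes D: "eisenstein d D" and "d < e" "P dvd 1"
  shows "\<not> D dvd fps_X ^ e + PP * P"
proof -
  obtain v w where vw: "v dvd 1" "PP = fps_X ^ d * v + D * w" using eisenstein_p[OF D] by metis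
  have "fps_X ^ e = fps_X ^ d * (fps_X ^ (e - d) :: 'a iwasawa)" using assms(2) by (simp flip: power_add)
  then have "fps_X ^ e + PP * P = fps_X ^ d * (fps_X ^ (e - d) + v * P) + D * (w * P)"
    by (simp add: vw algebra_simps)
  moreover have "fps_X ^ (e - d) + v * P dvd 1"
    using assms(2) mult_dvd_mono[OF vw(1) assms(3)] by (simp add: fps_unit_iff)
  ultimately have "x_ord D (fps_X ^ e + PP * P) d" unfolding x_ord_def by blast
  then show ?thesis by (rule x_ord_not_dvd[OF D])
qed

section \<open>Divisibility by products of distinct primes\<close>

lemma prime_elem_dvd_prod:
  assumes "finite I" "prime_elem q" "q dvd prod F I"
  shows "\<exists>i\<in>I. q dvd (F i :: 'a :: idom)"
  using assms by (induction I) (auto simp: prime_elem_dvd_mult_iff prime_elem_not_unit)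

lemma prod_primes_dvd:
  assumes "finite I" "\<And>i. i \<in> I \<Longrightarrow> prime_elem (F i)" "\<And>i j. i \<in> I \<Longrightarrow> j \<in> I \<Longrightarrow> i \<noteq> j \<Longrightarrow> \<not> F i dvd F j"
    "\<And>i. i \<in> I \<Longrightarrow> F i dvd (f :: 'a :: idom)"
  shows "prod F I dvd f"
  using assms
proof (induction I)
  case empty
  then show ?case by simp
next
  case (insert i I)
  then obtain g where g: "f = prod F I * g" by (auto simp: dvd_def)
  have "\<not> F i dvd prod F I"
  proof
    assume "F i dvd prod F I"
    then obtain j where "j \<in> I" "F i dvd F j"
      using prime_elem_dvd_prod[OF insert.hyps(1)] insert.prems(1) by blast
    then show False using insert.prems(2)[of i j] insert.hyps(2) by blast
  qed
  moreover have "F i dvd prod F I * g" using insert.prems(3) g by blast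
  ultimately have "F i dvd g" using insert.prems(1) prime_elem_dvd_multD by blast
  then show ?case using insert.hyps g by (simp add: mult.commute mult_dvd_mono)
qed

section \<open>Submodules of the plane and their relative length\<close>

definition lsub :: "('p :: prime_card iwasawa ^ 2) set \<Rightarrow> bool" where
  "lsub N \<longleftrightarrow> 0 \<in> N \<and> (\<forall>x\<in>N. \<forall>y\<in>N. x + y \<in> N) \<and> (\<forall>x\<in>N. \<forall>f. f *s x \<in> N)"

text \<open>The submodule D \<Lambda>^2 + \<Lambda> a + \<Lambda> b. It is N_k when D = \<omega>_k
  and a, b are the columns of A; with D = \<Phi>_n it presents a quotient of the plane over
  \<Lambda>/(\<Phi>_n).\<close>

definition gen2 :: "'p :: prime_card iwasawa \<Rightarrow> 'p iwasawa ^ 2 \<Rightarrow> 'p iwasawa ^ 2 \<Rightarrow> ('p iwasawa ^ 2) set" where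
  "gen2 D a b = {D *s v + f *s a + g *s b | v f g. True}"

definition vdvd :: "'p :: prime_card iwasawa \<Rightarrow> 'p iwasawa ^ 2 \<Rightarrow> bool" where
  "vdvd D v \<longleftrightarrow> D dvd v $ 1 \<and> D dvd v $ 2"

definition det2 :: "'p :: prime_card iwasawa ^ 2 \<Rightarrow> 'p iwasawa ^ 2 \<Rightarrow> 'p iwasawa" where
  "det2 a b = a $ 1 * b $ 2 - a $ 2 * b $ 1"

lemmas vec2_eq = vec_eq_iff forall_2

lemma lsub_0: "lsub N \<Longrightarrow> 0 \<in> N" by (simp add: lsub_def)
lemma lsub_add: "lsub N \<Longrightarrow> x \<in> N \<Longrightarrow> y \<in> N \<Longrightarrow> x + y \<in> N" by (simp add: lsub_def)
lemma lsub_scale: "lsub N \<Longrightarrow> x \<in> N \<Longrightarrow> f *s x \<in> N" by (simp add: lsub_def)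
lemma lsub_uminus: "lsub N \<Longrightarrow> x \<in> N \<Longrightarrow> - x \<in> N"
  using lsub_scale[of N x "-1"] by (simp add: vector_sneg_minus1[symmetric])
lemma lsub_diff: "lsub N \<Longrightarrow> x \<in> N \<Longrightarrow> y \<in> N \<Longrightarrow> x - y \<in> N"
  using lsub_add[of N x "- y"] lsub_uminus[of N y] by simp
lemma lsub_sum: "lsub N \<Longrightarrow> (\<And>i. i \<in> I \<Longrightarrow> f i \<in> N) \<Longrightarrow> sum f I \<in> N"
  by (induction I rule: infinite_finite_induct) (auto simp: lsub_0 lsub_add)

lemma vdvd_iff: "vdvd D v \<longleftrightarrow> (\<exists>y. v = D *s y)"
proof
  assume "vdvd D v"
  then obtain a b where ab: "v $ 1 = D * a" "v $ 2 = D * b" by (auto simp: vdvd_def dvd_def)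
  then have "v = D *s vector [a, b]" by (simp add: vec2_eq)
  then show "\<exists>y. v = D *s y" by blast
qed (auto simp: vdvd_def)

lemma lsub_gen2: "lsub (gen2 D a b)"
  unfolding lsub_def
proof (intro conjI ballI allI)
  have "0 = D *s 0 + 0 *s a + 0 *s b" by simp
  then show "0 \<in> gen2 D a b" unfolding gen2_def by blast
next
  fix x y assume "x \<in> gen2 D a b" "y \<in> gen2 D a b"
  then obtain v f g v' f' g' where "x = D *s v + f *s a + g *s b" "y = D *s v' + f' *s a + g' *s b"
    unfolding gen2_def by blast
  then have "x + y = D *s (v + v') + (f + f') *s a + (g + g') *s b" by (simp add: vec2_eq algebra_simps)
  then show "x + y \<in> gen2 D a b" unfolding gen2_def by blast
next
  fix x h assume "x \<in> gen2 D a b"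
  then obtain v f g where "x = D *s v + f *s a + g *s b" unfolding gen2_def by blast
  then have "h *s x = D *s (h *s v) + (h * f) *s a + (h * g) *s b" by (simp add: vec2_eq algebra_simps)
  then show "h *s x \<in> gen2 D a b" unfolding gen2_def by blast
qed

lemma gen2_mem: "a \<in> gen2 D a b" "b \<in> gen2 D a b" "D *s v \<in> gen2 D a b"
proof -
  have "a = D *s 0 + 1 *s a + 0 *s b" "b = D *s 0 + 0 *s a + 1 *s b" "D *s v = D *s v + 0 *s a + 0 *s b" by auto
  then show "a \<in> gen2 D a b" "b \<in> gen2 D a b" "D *s v \<in> gen2 D a b" unfolding gen2_def by blast+
qed

lemma gen2_le:
  assumes "lsub S" "a \<in> S" "b \<in> S" "\<And>v. D *s v \<in> S"
  shows "gen2 D a b \<subseteq> S"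
proof
  fix x assume "x \<in> gen2 D a b"
  then obtain v f g where "x = D *s v + f *s a + g *s b" unfolding gen2_def by blast
  then show "x \<in> S" by (simp add: lsub_add[OF assms(1)] lsub_scale[OF assms(1)] assms)
qed

lemma gen2_eqI:
  assumes "a \<in> gen2 D a' b'" "b \<in> gen2 D a' b'" "a' \<in> gen2 D a b" "b' \<in> gen2 D a b"
  shows "gen2 D a b = gen2 D a' b'"
  using assms by (intro antisym gen2_le lsub_gen2 gen2_mem)

lemma gen2_memI: "x = D *s v + f *s a + g *s b \<Longrightarrow> x \<in> gen2 D a b"
  unfolding gen2_def by blast

lemma gen2_commute: "gen2 D a b = gen2 D b a"
  by (intro gen2_eqI gen2_mem)

text \<open>A step multiplies the order of the quotient by \<open>p\<close>; a chain of \<open>k\<close> steps from \<open>N\<close> to \<open>P\<close>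
  witnesses that \<open>P/N\<close> has length \<open>k\<close> over \<open>\<int>\<^sub>p\<close>.\<close>

abbreviation p_cosets :: "('p :: prime_card iwasawa ^ 2) set \<Rightarrow> 'p iwasawa ^ 2 \<Rightarrow> ('p iwasawa ^ 2) set" where
  "p_cosets N y \<equiv> {x + of_nat j *s y | x j. x \<in> N \<and> j < CARD('p)}"

definition pstep :: "('p :: prime_card iwasawa ^ 2) set \<Rightarrow> ('p iwasawa ^ 2) set \<Rightarrow> bool" where
  "pstep N P \<longleftrightarrow> lsub N \<and> lsub P \<and>
     (\<exists>y. y \<in> P \<and> y \<notin> N \<and> P = p_cosets N y)"

lemma pstep_mono: "pstep N P \<Longrightarrow> N \<subseteq> P"
proof
  fix x assume "pstep N P" "x \<in> N"
  then obtain y where P: "P = p_cosets N y" by (auto simp: pstep_def)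
  have "x = x + of_nat 0 *s y" by simp
  then show "x \<in> P" using \<open>x \<in> N\<close> unfolding P by (intro CollectI exI[of _ x] exI[of _ 0]) auto
qed

lemma relpowp_pstep_mono: "(pstep ^^ k) N P \<Longrightarrow> N \<subseteq> P"
proof (induction k arbitrary: P)
  case (Suc k)
  then show ?case using pstep_mono by (elim relpowp_Suc_E) blast
qed simp

text \<open>The hypothesis says that y has annihilator (D) modulo D \<Lambda>^2 + \<Lambda> a. The
  step is strict because D divides no power of X times a unit. It has index p because a coefficient
  of X^k y can be reduced to a digit j: modulo D, the rest is a multiple of X.\<close>

lemma pstep_gen2:
  assumes D: "eisenstein d (D :: 'p :: prime_card iwasawa)"
    and y: "\<And>f v g. f *s y = D *s v + g *s a \<Longrightarrow> D dvd f"
  shows "pstep (gen2 D a (fps_X ^ Suc k *s y)) (gen2 D a (fps_X ^ k *s y))"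
proof -
  let ?N = "gen2 D a (fps_X ^ Suc k *s y)" and ?P = "gen2 D a (fps_X ^ k *s y)"
  let ?y = "fps_X ^ k *s y"
  have yP: "?y \<in> ?P" by (rule gen2_mem)
  have yN: "?y \<notin> ?N"
  proof
    assume "?y \<in> ?N"
    then obtain v f g where "?y = D *s v + f *s a + g *s (fps_X ^ Suc k *s y)" unfolding gen2_def by blast
    then have "(fps_X ^ k * (1 - fps_X * g)) *s y = D *s v + f *s a" by (simp add: vec2_eq algebra_simps)
    then have "D dvd fps_X ^ k * (1 - fps_X * g)" by (rule y)
    moreover have "1 - fps_X * g dvd 1" by (simp add: fps_unit_iff)
    ultimately show False using eisenstein_not_dvd_X_power[OF D] by blast
  qed
  obtain v w where vw: "PP = fps_X ^ d * v + D * w" using eisenstein_p[OF D] by metis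
  obtain d' where d': "d = Suc d'" using D by (cases d) (auto simp: eisenstein_def)
  have "x \<in> p_cosets ?N ?y" if "x \<in> ?P" for x
  proof -
    obtain z f g where x: "x = D *s z + f *s a + g *s ?y" using \<open>x \<in> ?P\<close> unfolding gen2_def by blast
    obtain j c h where j: "j < CARD('p)" "g = of_nat j + PP * fps_const c + fps_X * h" using iwasawa_decompose by blast
    have "g = of_nat j + fps_X * (fps_X ^ d' * v * fps_const c + h) + D * (w * fps_const c)"
      by (simp add: j(2) vw d' algebra_simps)
    then obtain h1 h2 where g: "g = of_nat j + fps_X * h1 + D * h2" by blast
    have "x = (D *s (z + h2 *s ?y) + f *s a + h1 *s (fps_X ^ Suc k *s y)) + of_nat j *s ?y"
      by (simp add: x g vec2_eq algebra_simps)
    then show ?thesis using j(1) gen2_memI by blast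
  qed
  moreover have "?N \<subseteq> ?P"
  proof (intro gen2_le lsub_gen2 gen2_mem)
    have "fps_X ^ Suc k *s y = fps_X *s ?y" by (simp add: vec2_eq algebra_simps)
    then show "fps_X ^ Suc k *s y \<in> ?P" using lsub_scale[OF lsub_gen2 yP] by metis
  qed
  then have "p_cosets ?N ?y \<subseteq> ?P"
    using yP by (blast intro: lsub_add lsub_scale lsub_gen2)
  ultimately have "?P = p_cosets ?N ?y" by blast
  then show ?thesis unfolding pstep_def using yP yN lsub_gen2 by blast
qed

lemma relpowp_pstep_gen2:
  assumes D: "eisenstein d (D :: 'p :: prime_card iwasawa)"
    and y: "\<And>f v g. f *s y = D *s v + g *s a \<Longrightarrow> D dvd f"
  shows "(pstep ^^ k) (gen2 D a (fps_X ^ k *s y)) (gen2 D a y)"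
proof (induction k)
  case 0
  show ?case by simp
next
  case (Suc k)
  have "pstep (gen2 D a (fps_X ^ Suc k *s y)) (gen2 D a (fps_X ^ k *s y))"
    by (rule pstep_gen2[OF D]) (erule y)
  then show ?case using Suc by (rule relpowp_Suc_I2)
qed

text \<open>Up to units modulo D, c is X^l and the first entry of a is X^k. The chain first climbs
  in l steps from X^l e2 to e2; once e2 is present it clears the second entry of a, and k further
  steps lead from X^k e1 to e1.\<close>

lemma gen2_triangular_length:
  fixes a :: "'p :: prime_card iwasawa ^ 2"
  assumes D: "eisenstein d (D :: 'p :: prime_card iwasawa)"
    and k: "x_ord D (a $ 1) k" and l: "x_ord D c l"
  shows "(pstep ^^ (l + k)) (gen2 D a (vector [0, c])) UNIV"
proof -
  define e1 e2 where "e1 = (vector [1, 0] :: 'p iwasawa ^ 2)" and "e2 = (vector [0, 1] :: 'p iwasawa ^ 2)"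
  note e = e1_def e2_def
  have prime: "prime_elem D" using eisenstein_good_prime[OF D] by (simp add: good_prime_def)
  obtain u g where u: "u dvd 1" "a $ 1 = fps_X ^ k * u + D * g" using k by (auto simp: x_ord_def)
  obtain v h where v: "v dvd 1" "c = fps_X ^ l * v + D * h" using l by (auto simp: x_ord_def)
  obtain s t where Xk: "fps_X ^ k = a $ 1 * s + D * t" using k by (rule x_ord_X_power)
  obtain s' t' where Xl: "fps_X ^ l = c * s' + D * t'" using l by (rule x_ord_X_power)
  have 1: "gen2 D a (vector [0, c]) = gen2 D a (fps_X ^ l *s e2)"
  proof (rule gen2_eqI)
    show "vector [0, c] \<in> gen2 D a (fps_X ^ l *s e2)"
      by (rule gen2_memI[of _ _ "h *s e2" 0 _ v]) (simp add: e vec2_eq v(2) algebra_simps)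
    show "fps_X ^ l *s e2 \<in> gen2 D a (vector [0, c])"
      by (rule gen2_memI[of _ _ "t' *s e2" 0 _ s']) (simp add: e vec2_eq Xl algebra_simps)
  qed (rule gen2_mem)+
  have 2: "gen2 D a e2 = gen2 D e2 (fps_X ^ k *s e1)"
  proof (rule gen2_eqI)
    show "a \<in> gen2 D e2 (fps_X ^ k *s e1)"
      by (rule gen2_memI[of _ _ "g *s e1" "a $ 2" _ u]) (simp add: e vec2_eq u(2) algebra_simps)
    show "fps_X ^ k *s e1 \<in> gen2 D a e2"
      by (rule gen2_memI[of _ _ "t *s e1" s _ "- (s * a $ 2)"])
         (simp add: e vec2_eq Xk algebra_simps)
  qed (rule gen2_mem)+
  have 3: "gen2 D e2 e1 = UNIV"
  proof -
    have "x \<in> gen2 D e2 e1" for x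
      by (rule gen2_memI[of _ _ 0 "x $ 2" _ "x $ 1"]) (simp add: e vec2_eq)
    then show ?thesis by blast
  qed
  have "(pstep ^^ l) (gen2 D a (fps_X ^ l *s e2)) (gen2 D a e2)"
  proof (rule relpowp_pstep_gen2[OF D])
    fix f w t assume eq: "f *s e2 = D *s w + t *s a"
    then have "0 = D * w $ 1 + t * a $ 1" "f = D * w $ 2 + t * a $ 2" by (auto simp: e vec2_eq)
    then have "t * a $ 1 = D * (- w $ 1)" by (simp add: eq_neg_iff_add_eq_0 add.commute)
    then have "D dvd t * a $ 1" by (rule dvdI)
    then have "D dvd t" using prime x_ord_not_dvd[OF D k] prime_elem_dvd_multD by blast
    then show "D dvd f" by (simp add: \<open>f = _\<close>)
  qed
  moreover have "(pstep ^^ k) (gen2 D e2 (fps_X ^ k *s e1)) (gen2 D e2 e1)"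
  proof (rule relpowp_pstep_gen2[OF D])
    fix f w t assume eq: "f *s e1 = D *s w + t *s e2"
    then have "f = D * w $ 1" by (auto simp: e vec2_eq)
    then show "D dvd f" by simp
  qed
  ultimately show ?thesis unfolding 1 2 3 by (rule relpowp_trans)
qed

text \<open>Gaussian elimination over the discrete valuation ring \<Lambda>/(D): of the two first
  entries, the one of smaller order divides the other modulo D, so a column operation makes the
  matrix triangular and preserves the determinant modulo D.\<close>

lemma gen2_length:
  assumes D: "eisenstein d (D :: 'p :: prime_card iwasawa)" and L: "x_ord D (det2 a b) L"
  shows "(pstep ^^ L) (gen2 D a b) UNIV"
proof -
  have prime: "prime_elem D" using eisenstein_good_prime[OF D] by (simp add: good_prime_def)
  \<comment> \<open>Elimination: subtracting g times a from b leaves (0, c) modulo D, and the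
    determinant becomes the product of \<open>a $ 1\<close> and c modulo D.\<close>
  have main: "(pstep ^^ L) (gen2 D a b) UNIV"
    if L: "x_ord D (det2 a b) L" and b1: "b $ 1 = a $ 1 * g + D * h" for a b :: "'p iwasawa ^ 2" and g h
  proof -
    define c where "c = b $ 2 - g * a $ 2"
    have det: "a $ 1 * c = det2 a b + D * (a $ 2 * h)"
      by (simp add: det2_def c_def b1 algebra_simps)
    have ndvd: "\<not> D dvd a $ 1 * c"
      using x_ord_not_dvd[OF D x_ord_cong[OF L det]] .
    then obtain k l where kl: "x_ord D (a $ 1) k" "x_ord D c l"
      using x_ord_exists[OF D] by (metis dvd_mult dvd_mult2)
    have "k + l = L" using x_ord_unique[OF D x_ord_mult[OF kl] x_ord_cong[OF L det]] .
    moreover have "gen2 D a b = gen2 D a (vector [0, c])"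
    proof (rule gen2_eqI)
      show "b \<in> gen2 D a (vector [0, c])"
        by (rule gen2_memI[of _ _ "vector [h, 0]" g _ 1]) (simp add: vec2_eq c_def b1 algebra_simps)
      show "vector [0, c] \<in> gen2 D a b"
        by (rule gen2_memI[of _ _ "vector [- h, 0]" "- g" _ 1]) (simp add: vec2_eq c_def b1 algebra_simps)
    qed (rule gen2_mem)+
    ultimately show ?thesis using gen2_triangular_length[OF D kl] by (simp add: add.commute)
  qed
  have div: "\<exists>g h. y = x * g + D * h" if x: "x_ord D x k" and y: "x_ord D y l" and kl: "k \<le> l" for x y k l
  proof -
    obtain s t where Xk: "fps_X ^ k = x * s + D * t" using x by (rule x_ord_X_power)
    obtain v b where v: "y = fps_X ^ l * v + D * b" using y by (auto simp: x_ord_def)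
    have "fps_X ^ l = fps_X ^ k * (fps_X ^ (l - k) :: 'p iwasawa)" using kl by (simp flip: power_add)
    then have "y = (x * s + D * t) * fps_X ^ (l - k) * v + D * b"
      using v Xk by (simp only:)
    then have "y = x * (s * fps_X ^ (l - k) * v) + D * (b + t * fps_X ^ (l - k) * v)"
      by (simp add: algebra_simps)
    then show ?thesis by blast
  qed
  have L': "x_ord D (det2 b a) L"
    using x_ord_uminus[OF L] by (simp add: det2_def algebra_simps)
  \<comment> \<open>A first entry divisible by D has no order, but is trivially a multiple of the
    other one modulo D; these cases are separated before orders are compared.\<close>
  show ?thesis
  proof (cases "D dvd b $ 1")
    case True
    then obtain h where "b $ 1 = D * h" by (rule dvdE)
    then have "b $ 1 = a $ 1 * 0 + D * h" by simp
    then show ?thesis by (rule main[OF L])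
  next
    case b: False
    show ?thesis
    proof (cases "D dvd a $ 1")
      case True
      then obtain h where "a $ 1 = D * h" by (rule dvdE)
      then have "a $ 1 = b $ 1 * 0 + D * h" by simp
      then show ?thesis unfolding gen2_commute[of D a b] by (rule main[OF L'])
    next
      case False
      then obtain k where k: "x_ord D (a $ 1) k" by (rule x_ord_exists[OF D])
      obtain l where l: "x_ord D (b $ 1) l" by (rule x_ord_exists[OF D b])
      note kl = k l
      show ?thesis
      proof (cases "k \<le> l")
        case True
        then obtain g h where "b $ 1 = a $ 1 * g + D * h" using div[OF kl] by blast
        then show ?thesis by (rule main[OF L])
      next
        case False
        then have "l \<le> k" by simp
        then obtain g h where "a $ 1 = b $ 1 * g + D * h" using div[OF kl(2,1)] by blast
        then show ?thesis unfolding gen2_commute[of D a b] by (rule main[OF L'])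
      qed
    qed
  qed
qed

text \<open>Multiplication by w embeds the quotient of \<Lambda>^2 by the colon module (N : w) into
  \<Lambda>^2/N, so it carries a chain of strict steps to a chain of strict steps. Strictness uses
  that every member of the chain contains (N : w).\<close>

lemma relpowp_pstep_image:
  fixes N :: "('p :: prime_card iwasawa ^ 2) set"
  assumes N: "lsub N"
    and "(pstep ^^ k) {v. w *s v \<in> N} P"
  shows "(pstep ^^ k) N {w *s v + x | v x. v \<in> P \<and> x \<in> N}"
  using assms(2)
proof (induction k arbitrary: P)
  case 0
  then have "{w *s v + x | v x. v \<in> P \<and> x \<in> N} = N"
  proof (intro equalityI subsetI)
    fix y assume "y \<in> {w *s v + x | v x. v \<in> P \<and> x \<in> N}"
    then show "y \<in> N" using 0 N by (auto intro: lsub_add)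
  next
    fix y assume "y \<in> N"
    moreover have "0 \<in> P" using 0 lsub_0[OF N] by auto
    moreover have "y = w *s 0 + y" by simp
    ultimately show "y \<in> {w *s v + x | v x. v \<in> P \<and> x \<in> N}" by blast
  qed
  then show ?case by simp
next
  case (Suc k)
  let ?F = "\<lambda>P. {w *s v + x | v x. v \<in> P \<and> x \<in> N}"
  obtain Q where Q: "(pstep ^^ k) {v. w *s v \<in> N} Q" "pstep Q P" using Suc.prems by (rule relpowp_Suc_E)
  obtain y where y: "lsub Q" "lsub P" "y \<in> P" "y \<notin> Q" "P = p_cosets Q y"
    using Q(2) by (auto simp: pstep_def)
  have sub: "lsub (?F S)" if S: "lsub S" for S
    unfolding lsub_def
  proof (intro conjI ballI allI)
    have "0 = w *s 0 + 0" by simp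
    then show "0 \<in> ?F S" using lsub_0 S N by blast
  next
    fix a b assume "a \<in> ?F S" "b \<in> ?F S"
    then obtain v x v' x' where "a = w *s v + x" "b = w *s v' + x'" "v \<in> S" "v' \<in> S" "x \<in> N" "x' \<in> N" by blast
    moreover from this have "a + b = w *s (v + v') + (x + x')" by (simp add: vec2_eq algebra_simps)
    ultimately show "a + b \<in> ?F S" using lsub_add S N by blast
  next
    fix a f assume "a \<in> ?F S"
    then obtain v x where "a = w *s v + x" "v \<in> S" "x \<in> N" by blast
    moreover from this have "f *s a = w *s (f *s v) + f *s x" by (simp add: vec2_eq algebra_simps)
    ultimately show "f *s a \<in> ?F S" using lsub_scale S N by blast
  qed
  have "pstep (?F Q) (?F P)"
    unfolding pstep_def
  proof (intro conjI exI[of _ "w *s y"])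
    have "w *s y = w *s y + 0" by simp
    then show "w *s y \<in> ?F P" using y(3) lsub_0[OF N] by blast
    show "w *s y \<notin> ?F Q"
    proof
      assume "w *s y \<in> ?F Q"
      then obtain v x where vx: "w *s y = w *s v + x" "v \<in> Q" "x \<in> N" by blast
      then have "w *s (y - v) \<in> N" by (simp add: vector_ssub_ldistrib)
      then have "y - v \<in> Q" using relpowp_pstep_mono[OF Q(1)] by blast
      then have "y - v + v \<in> Q" using lsub_add[OF y(1)] vx(2) by blast
      then show False using y(4) by simp
    qed
    show "?F P = p_cosets (?F Q) (w *s y)"
    proof (intro equalityI subsetI)
      fix z assume "z \<in> ?F P"
      then obtain q j x where z: "z = w *s (q + of_nat j *s y) + x" "q \<in> Q" "j < CARD('p)" "x \<in> N"
        unfolding y(5) by blast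
      then have "z = (w *s q + x) + of_nat j *s (w *s y)" by (simp add: vec2_eq algebra_simps)
      then show "z \<in> p_cosets (?F Q) (w *s y)" using z by blast
    next
      fix z assume "z \<in> p_cosets (?F Q) (w *s y)"
      then obtain q x j where z: "z = (w *s q + x) + of_nat j *s (w *s y)" "q \<in> Q" "j < CARD('p)" "x \<in> N" by blast
      then have "z = w *s (q + of_nat j *s y) + x" by (simp add: vec2_eq algebra_simps)
      moreover have "q + of_nat j *s y \<in> P" using z y(5) by blast
      ultimately show "z \<in> ?F P" using z(4) by blast
    qed
  qed (fact sub[OF y(1)] sub[OF y(2)])+
  then show ?case using Suc.IH[OF Q(1)] by (rule relpowp_Suc_I[rotated])
qed

section \<open>Cyclotomic factors\<close>

lemma power_gcd_eq_1:
  fixes z :: "'a :: comm_ring_1"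
  assumes "z ^ a = 1" "z ^ b = 1"
  shows "z ^ gcd a b = 1"
  using assms
proof (induction a b rule: gcd_nat_induct)
  case (base m)
  then show ?case by simp
next
  case (step m n)
  have "z ^ m = (z ^ n) ^ (m div n) * z ^ (m mod n)"
    by (simp flip: power_mult power_add)
  then have "z ^ (m mod n) = 1" using step.prems by simp
  then show ?case using step by (simp add: gcd_red_nat[symmetric] gcd.commute)
qed

lemma primitive_unity_root_prime_power_iff:
  fixes z :: "'a :: comm_ring_1"
  assumes "Factorial_Ring.prime (p :: nat)"
  shows "primitive_unity_root (p ^ Suc m) z \<longleftrightarrow> z ^ (p ^ Suc m) = 1 \<and> z ^ (p ^ m) \<noteq> 1"
proof
  have "0 < p ^ m" "p ^ m < p ^ Suc m" using prime_gt_1_nat[OF assms] by auto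
  then show "primitive_unity_root (p ^ Suc m) z \<Longrightarrow> z ^ (p ^ Suc m) = 1 \<and> z ^ (p ^ m) \<noteq> 1"
    unfolding primitive_unity_root_def by blast
next
  assume *: "z ^ (p ^ Suc m) = 1 \<and> z ^ (p ^ m) \<noteq> 1"
  have "z ^ k \<noteq> 1" if k: "0 < k" "k < p ^ Suc m" for k
  proof
    assume "z ^ k = 1"
    then have g: "z ^ gcd k (p ^ Suc m) = 1" using * by (intro power_gcd_eq_1) auto
    obtain j where j: "j \<le> Suc m" "gcd k (p ^ Suc m) = p ^ j"
      using divides_primepow_nat[OF assms, of "gcd k (p ^ Suc m)" "Suc m"] by auto
    have "p ^ j \<le> k" using k j by (metis gcd_le1_nat neq0_conv)
    then have "j \<noteq> Suc m" using k(2) by auto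
    then have "p ^ m = p ^ j * p ^ (m - j)" using j(1) by (simp flip: power_add)
    then have "z ^ (p ^ m) = 1" using g j(2) by (simp add: power_mult)
    then show False using * by blast
  qed
  then show "primitive_unity_root (p ^ Suc m) z" using * by (simp add: primitive_unity_root_def)
qed

lemma prod_roots_of_unity:
  assumes "N \<ge> 1"
  shows "(\<Prod>z | z ^ N = 1. [:- z, 1 :: complex:]) = Polynomial.monom 1 N - 1"
proof (rule poly_eqI_degree_lead_coeff[where n = N and A = "{z. z ^ N = 1}"])
  let ?A = "{z :: complex. z ^ N = 1}"
  have fin: "finite ?A" using assms by (intro finite_roots_unity) auto
  have card: "card ?A = N" using assms by (intro card_roots_unity_eq) auto
  have deg: "Polynomial.degree (\<Prod>z\<in>?A. [:- z, 1 :: complex:]) = N"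
    by (subst degree_prod_eq_sum_degree) (auto simp: card)
  then show "Polynomial.degree (\<Prod>z\<in>?A. [:- z, 1 :: complex:]) \<le> N" by simp
  show "Polynomial.degree (Polynomial.monom 1 N - 1 :: complex poly) \<le> N" by (intro degree_diff_le) (auto simp: degree_monom_le)
  have "Polynomial.lead_coeff (\<Prod>z\<in>?A. [:- z, 1 :: complex:]) = 1" by (simp add: lead_coeff_prod)
  then show "poly.coeff (\<Prod>z\<in>?A. [:- z, 1 :: complex:]) N = poly.coeff (Polynomial.monom 1 N - 1) N"
    using assms by (simp add: deg)
  show "N \<le> card ?A" by (simp add: card)
  fix z assume "z \<in> ?A"
  then show "poly (\<Prod>z\<in>?A. [:- z, 1 :: complex:]) z = poly (Polynomial.monom 1 N - 1) z"
    using fin by (auto simp: poly_prod poly_monom)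
qed

lemma geometric_sum_mult: "((y :: 'a :: comm_ring_1) - 1) * (\<Sum>i<p. y ^ i) = y ^ p - 1"
  using one_diff_power_eq[of y p] by (simp add: algebra_simps)

text \<open>Both polynomials are the quotient of T^(p^(m + 1)) - 1 by T^(p^m) - 1: the roots of the
  former are those of the latter together with the primitive ones. The description by
  \<open>THE\<close> is then settled because integer polynomials embed into complex ones.\<close>

lemma cyclotomic_poly_prime_power:
  assumes p: "Factorial_Ring.prime (p :: nat)"
  shows "cyclotomic_poly (p ^ Suc m) = (\<Sum>i<p. Polynomial.monom 1 (p ^ m) ^ i)"
  unfolding cyclotomic_poly_def
proof (rule the_equality)
  let ?q = "\<Sum>i<p. Polynomial.monom 1 (p ^ m) ^ i :: int poly"
  let ?R = "\<lambda>N. \<Prod>z | z ^ N = 1. [:- z, 1 :: complex:]"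
  let ?C = "\<Prod>z | primitive_unity_root (p ^ Suc m) z. [:- z, 1 :: complex:]"
  have p0: "p ^ k \<ge> 1" for k using prime_gt_0_nat[OF p] by (simp add: Suc_leI)
  have fin: "finite {z :: complex. z ^ (p ^ k) = 1}" for k using p0 by (intro finite_roots_unity)
  have split: "{z :: complex. z ^ (p ^ Suc m) = 1} = {z. z ^ (p ^ m) = 1} \<union> {z. primitive_unity_root (p ^ Suc m) z}"
    unfolding primitive_unity_root_prime_power_iff[OF p] by (auto simp: power_mult mult.commute[of p])
  have finC: "finite {z :: complex. primitive_unity_root (p ^ Suc m) z}"
    by (rule finite_subset[OF _ fin[of "Suc m"]]) (auto simp: primitive_unity_root_def)
  have "?R (p ^ Suc m) = ?R (p ^ m) * ?C"
    unfolding split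
    by (rule prod.union_disjoint[OF fin[of m] finC])
       (use fin[of m] fin[of "Suc m"] in \<open>auto simp: primitive_unity_root_prime_power_iff[OF p] simp del: power_Suc\<close>)
  then have C: "Polynomial.monom 1 (p ^ Suc m) - 1 = (Polynomial.monom 1 (p ^ m) - 1) * ?C"
    using p0 by (simp only: prod_roots_of_unity)
  have "map_poly of_int ?q = (\<Sum>i<p. Polynomial.monom (1 :: complex) (p ^ m) ^ i)"
    by (simp add: of_int_poly_hom.hom_sum of_int_poly_hom.hom_power map_poly_monom)
  then have "(Polynomial.monom 1 (p ^ m) - 1) * map_poly of_int ?q = Polynomial.monom (1 :: complex) (p ^ m) ^ p - 1"
    by (simp only: geometric_sum_mult)
  also have "Polynomial.monom (1 :: complex) (p ^ m) ^ p = Polynomial.monom 1 (p ^ Suc m)"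
    by (simp add: monom_power mult.commute)
  finally have "(Polynomial.monom 1 (p ^ m) - 1) * map_poly of_int ?q = (Polynomial.monom 1 (p ^ m) - 1) * ?C" using C by simp
  moreover have "(Polynomial.monom 1 (p ^ m) - 1 :: complex poly) \<noteq> 0"
  proof
    assume "(Polynomial.monom 1 (p ^ m) - 1 :: complex poly) = 0"
    then have "poly (Polynomial.monom 1 (p ^ m) - 1 :: complex poly) 0 = 0" by simp
    then show False using prime_gt_0_nat[OF p] by (simp add: poly_monom power_0_left split: if_splits)
  qed
  ultimately show q: "map_poly of_int ?q = ?C" by simp
  fix r :: "int poly"
  assume "map_poly of_int r = ?C"
  then have "map_poly (of_int :: int \<Rightarrow> complex) r = map_poly of_int ?q" using q by simp
  then show "r = ?q" by simp
qed

lemma prime_CARD: "Factorial_Ring.prime CARD('p :: prime_card)"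
  by (rule prime_card)

lemma CARD_gt_1: "CARD('p :: prime_card) > 1"
  using prime_gt_1_nat[OF prime_CARD] .

text \<open>The p-th cyclotomic polynomial at (1 + X)^(p^m), which is \<Phi>_(m + 1): the index is
  shifted by one. Having it as a polynomial allows it to be evaluated as a finite sum.\<close>

definition Phi_poly :: "nat \<Rightarrow> 'a :: comm_ring_1 itself \<Rightarrow> nat \<Rightarrow> 'a poly" where
  "Phi_poly p _ m = (\<Sum>i<p. ([:1, 1:] ^ (p ^ m)) ^ i)"

lemma cyc_factor_eq_fps_of_poly:
  "(\<Phi> (Suc m) :: 'p :: prime_card iwasawa) = fps_of_poly (Phi_poly CARD('p) TYPE('p padic_int) m)"
proof -
  have X: "Polynomial.monom 1 (CARD('p) ^ m) = ([:0, 1:] :: 'p padic_int poly) ^ (CARD('p) ^ m)"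
    by (rule monom_altdef[of 1, simplified])
  have "map_poly of_int (cyclotomic_poly (CARD('p) ^ Suc m)) = (\<Sum>i<CARD('p). Polynomial.monom (1 :: 'p padic_int) (CARD('p) ^ m) ^ i)"
    unfolding cyclotomic_poly_prime_power[OF prime_CARD]
    by (simp add: of_int_poly_hom.hom_sum of_int_poly_hom.hom_power map_poly_monom)
  then have "pcompose (map_poly of_int (cyclotomic_poly (CARD('p) ^ Suc m))) [:1, 1:] = Phi_poly CARD('p) TYPE('p padic_int) m"
    by (simp only: X Phi_poly_def pcompose_sum pcompose_hom.hom_power pcompose_pCons) (simp add: pcompose_pCons)
  then show ?thesis by (simp add: cyc_factor_def)
qed

lemma cyc_factor_eq_sum:
  "(\<Phi> (Suc m) :: 'p :: prime_card iwasawa) = (\<Sum>i<CARD('p). ((1 + fps_X) ^ (CARD('p) ^ m)) ^ i)"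
proof -
  have "fps_of_poly [:1, 1 :: 'p padic_int:] = 1 + fps_X"
    by (simp add: fps_of_poly_pCons)
  then show ?thesis
    by (simp only: cyc_factor_eq_fps_of_poly Phi_poly_def fps_of_poly_sum fps_of_poly_power)
qed

lemma cyc_factor_mult_omega: "(\<omega> m :: 'p :: prime_card iwasawa) * \<Phi> (Suc m) = \<omega> (Suc m)"
  unfolding cyc_factor_eq_sum omega_def geometric_sum_mult
  by (simp add: mult.commute flip: power_mult)

lemma omega_0: "(\<omega> 0 :: 'p :: prime_card iwasawa) = fps_X"
  by (simp add: omega_def)

lemma omega_eq_prod: "(\<omega> n :: 'p :: prime_card iwasawa) = (\<Prod>m\<le>n. \<Phi> m)"
proof (induction n)
  case 0
  show ?case by (simp add: omega_0 cyc_factor_def)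
next
  case (Suc n)
  then show ?case by (simp flip: cyc_factor_mult_omega)
qed

section \<open>The shape of \<omega>_k and \<Phi>_m modulo p\<close>

lemma power_prime_add:
  fixes a b :: "'a :: comm_ring_1"
  assumes p: "Factorial_Ring.prime (p :: nat)"
  shows "\<exists>c. (a + b) ^ p = a ^ p + b ^ p + of_nat p * c"
proof -
  have p0: "p > 0" using p prime_gt_0_nat by blast
  have "(a + b) ^ p = (\<Sum>k\<le>p. of_nat (p choose k) * a ^ k * b ^ (p - k))" by (rule binomial_ring)
  also have "{..p} = insert 0 (insert p {0<..<p})" using p0 by auto
  also have "(\<Sum>k\<in>\<dots>. of_nat (p choose k) * a ^ k * b ^ (p - k)) = b ^ p + (a ^ p + (\<Sum>k\<in>{0<..<p}. of_nat (p choose k) * a ^ k * b ^ (p - k)))"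
    using p0 by simp
  finally have eq: "(a + b) ^ p = a ^ p + b ^ p + (\<Sum>k\<in>{0<..<p}. of_nat (p choose k) * a ^ k * b ^ (p - k))"
    by (simp add: ac_simps)
  have "of_nat p dvd (\<Sum>k\<in>{0<..<p}. of_nat (p choose k) * a ^ k * b ^ (p - k))"
  proof (rule dvd_sum)
    fix k assume "k \<in> {0<..<p}"
    then have "p dvd (p choose k)" using p p0 by (intro dvd_choose_prime) auto
    then obtain r where "p choose k = p * r" by (rule dvdE)
    then show "of_nat p dvd of_nat (p choose k) * a ^ k * b ^ (p - k)" by (simp add: mult.assoc)
  qed
  then obtain c where "(\<Sum>k\<in>{0<..<p}. of_nat (p choose k) * a ^ k * b ^ (p - k)) = of_nat p * c" by (rule dvdE)
  then show ?thesis using eq by auto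
qed

text \<open>Raising to the p-th power is additive modulo p, hence (1 + X)^(p^k) is 1 + X^(p^k)
  there.\<close>

lemma omega_shape: "\<exists>Q. (\<omega> k :: 'p :: prime_card iwasawa) = fps_X ^ (CARD('p) ^ k) + PP * Q"
proof -
  have "\<exists>Q. (1 + fps_X) ^ (CARD('p) ^ k) = 1 + fps_X ^ (CARD('p) ^ k) + (PP :: 'p iwasawa) * Q"
  proof (induction k)
    case 0
    show ?case by (intro exI[of _ 0]) simp
  next
    case (Suc k)
    let ?p = "CARD('p)" and ?q = "CARD('p) ^ k"
    obtain Q where Q: "(1 + fps_X) ^ ?q = 1 + fps_X ^ ?q + (PP :: 'p iwasawa) * Q" using Suc by blast
    obtain c where c: "(1 + fps_X ^ ?q + (PP :: 'p iwasawa) * Q) ^ ?p = (1 + fps_X ^ ?q) ^ ?p + (PP * Q) ^ ?p + PP * c"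
      using power_prime_add[OF prime_CARD] by blast
    obtain c' where c': "(1 + fps_X ^ ?q) ^ ?p = 1 ^ ?p + (fps_X ^ ?q) ^ ?p + (PP :: 'p iwasawa) * c'"
      using power_prime_add[OF prime_CARD] by blast
    have PQ: "(PP * Q) ^ ?p = PP * (Q * (PP * Q) ^ (?p - 1))"
      using CARD_gt_1[where 'p='p] by (metis mult.assoc power_eq_if not_one_less_zero)
    have "(1 + fps_X :: 'p iwasawa) ^ (?p ^ Suc k) = ((1 + fps_X) ^ ?q) ^ ?p"
      by (simp add: mult.commute flip: power_mult)
    also have "\<dots> = 1 ^ ?p + (fps_X ^ ?q) ^ ?p + PP * c' + PP * (Q * (PP * Q) ^ (?p - 1)) + PP * c"
      by (simp only: Q c c' PQ)
    also have "\<dots> = 1 + fps_X ^ (?p ^ Suc k) + PP * (c' + Q * (PP * Q) ^ (?p - 1) + c)"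
      by (simp add: distrib_left add.assoc mult.commute[of ?p] flip: power_mult)
    finally show ?case by blast
  qed
  then obtain Q where "(1 + fps_X) ^ (CARD('p) ^ k) = 1 + fps_X ^ (CARD('p) ^ k) + (PP :: 'p iwasawa) * Q" by blast
  then have "(\<omega> k :: 'p iwasawa) = fps_X ^ (CARD('p) ^ k) + PP * Q" unfolding omega_def by (simp only:) simp
  then show ?thesis by blast
qed

text \<open>Euler's totient of p^m, the degree of \<Phi>_m; at m = 0 this is the degree of
  X.\<close>

definition cyc_deg :: "nat \<Rightarrow> nat \<Rightarrow> nat" where
  "cyc_deg p m = (if m = 0 then 1 else p ^ m - p ^ (m - 1))"

text \<open>In \<omega>_m \<Phi>_(m + 1) = \<omega>_(m + 1), reduced modulo p, the power X^(p^m)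
  cancels and leaves the leading shape of \<Phi>_(m + 1). The constant term of the geometric sum is
  p ones, that is p, so the cofactor of p has constant term 1.\<close>

lemma cyc_factor_eisenstein:
  "eisenstein (cyc_deg CARD('p) (Suc m)) (\<Phi> (Suc m) :: 'p :: prime_card iwasawa)"
proof -
  let ?p = "CARD('p)" and ?N = "CARD('p) ^ m" and ?P = "\<Phi> (Suc m) :: 'p iwasawa"
  let ?d = "cyc_deg CARD('p) (Suc m)"
  have lt: "?N < ?p ^ Suc m" using CARD_gt_1[where 'p='p] by simp
  then have d: "?d \<ge> 1" "?N + ?d = ?p ^ Suc m" by (simp_all add: cyc_deg_def del: power_Suc)
  obtain Q where Q: "\<omega> m = fps_X ^ ?N + (PP :: 'p iwasawa) * Q" using omega_shape by blast
  obtain Q' where Q': "\<omega> (Suc m) = fps_X ^ (?p ^ Suc m) + (PP :: 'p iwasawa) * Q'" using omega_shape by blast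
  have "(fps_X ^ ?N + PP * Q) * ?P = fps_X ^ (?N + ?d) + PP * Q'"
    using cyc_factor_mult_omega[of m, where 'p='p] Q Q' d(2) by (simp only:)
  then have eq: "fps_X ^ ?N * (?P - fps_X ^ ?d) = PP * (Q' - Q * ?P)"
    by (simp add: algebra_simps power_add)
  have "pp dvd fps_nth (?P - fps_X ^ ?d) i" for i
  proof -
    have "fps_nth (?P - fps_X ^ ?d) i = fps_nth (fps_X ^ ?N * (?P - fps_X ^ ?d)) (?N + i)"
      by (subst fps_X_power_mult_nth) simp
    also have "\<dots> = pp * fps_nth (Q' - Q * ?P) (?N + i)" by (simp only: eq PP_nth)
    finally show ?thesis by simp
  qed
  then have "PP dvd ?P - fps_X ^ ?d" using PP_power_dvd_iff[of 1 "?P - fps_X ^ ?d"] by simp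
  then obtain R where R: "?P = fps_X ^ ?d + PP * R" by (rule dvd_diffE)
  have "fps_nth ?P 0 = pp"
    unfolding cyc_factor_eq_sum by (simp add: fps_sum_nth fps_nth_power_0)
  moreover have "fps_nth ?P 0 = pp * fps_nth R 0" using d(1) by (simp add: R PP_nth fps_X_power_iff)
  ultimately have "fps_nth R 0 = 1" using pp_nonzero[where 'p='p] by (metis mult_cancel_left2)
  then have "R dvd 1" by (simp add: fps_unit_iff)
  then show ?thesis using d(1) R unfolding eisenstein_def by blast
qed

lemma cyc_factor_shape: "\<exists>P. (\<Phi> m :: 'p :: prime_card iwasawa) = fps_X ^ cyc_deg CARD('p) m + PP * P"
proof (cases m)
  case 0
  then show ?thesis by (intro exI[of _ 0]) (simp add: cyc_deg_def cyc_factor_def)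
next
  case (Suc k)
  then show ?thesis using cyc_factor_eisenstein[of k, where 'p='p] unfolding eisenstein_def by blast
qed

lemma cyc_factor_good_prime: "good_prime (cyc_deg CARD('p) m) (\<Phi> m :: 'p :: prime_card iwasawa)"
proof (cases m)
  case 0
  then show ?thesis using fps_X_good_prime[where 'p='p] by (simp add: cyc_deg_def cyc_factor_def)
next
  case (Suc k)
  then show ?thesis using eisenstein_good_prime[OF cyc_factor_eisenstein[of k, where 'p='p]] by simp
qed

text \<open>Index 0 has to be kept apart, as for p = 2 both \<Phi>_0 and \<Phi>_1 have degree
  1.\<close>

lemma cyc_deg_strict:
  assumes "i < j" "i \<noteq> 0" "p > 1"
  shows "cyc_deg p i < cyc_deg p j"
proof -
  have deg: "cyc_deg p (Suc k) = p ^ k * (p - 1)" for k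
    by (simp add: cyc_deg_def diff_mult_distrib2 mult.commute)
  have "p ^ (i - 1) < p ^ (j - 1)" using assms by (intro power_strict_increasing) auto
  then have "p ^ (i - 1) * (p - 1) < p ^ (j - 1) * (p - 1)" using assms by simp
  then show ?thesis using deg[of "i - 1"] deg[of "j - 1"] assms by simp
qed

lemma cyc_factor_x_ord:
  assumes "m < n"
  shows "x_ord (\<Phi> n :: 'p :: prime_card iwasawa) (\<Phi> m) (cyc_deg CARD('p) m)"
proof (cases "m = 0")
  case True
  have "(\<Phi> m :: 'p iwasawa) = fps_X ^ cyc_deg CARD('p) m * 1 + \<Phi> n * 0"
    by (simp add: True cyc_deg_def cyc_factor_def)
  then show ?thesis unfolding x_ord_def by (metis dvd_refl)
next
  case False
  obtain k where n: "n = Suc k" using assms by (cases n) auto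
  obtain P where P: "(\<Phi> m :: 'p iwasawa) = fps_X ^ cyc_deg CARD('p) m + PP * P" using cyc_factor_shape by blast
  have "cyc_deg CARD('p) m < cyc_deg CARD('p) n" using cyc_deg_strict assms False CARD_gt_1 by blast
  then show ?thesis
    unfolding P n by (rule x_ord_X_power_plus[OF cyc_factor_eisenstein, folded n]) 
qed

text \<open>\<Phi>_j has an order modulo \<Phi>_i whenever i is positive: if j < i the power of X
  dominates, and if i < j the term p P does. Modulo \<Phi>_0 = X it is enough that \<Phi>_j has
  nonzero constant term.\<close>

lemma cyc_factor_not_dvd:
  assumes "i \<noteq> j"
  shows "\<not> \<Phi> i dvd (\<Phi> j :: 'p :: prime_card iwasawa)"
proof (cases "j < i")
  case True
  then obtain k where "i = Suc k" by (cases i) auto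
  then show ?thesis using x_ord_not_dvd[OF cyc_factor_eisenstein] cyc_factor_x_ord[OF True] by blast
next
  case False
  then have ij: "i < j" using assms by simp
  then obtain l where l: "j = Suc l" by (cases j) auto
  show ?thesis
  proof (cases i)
    case 0
    have "fps_nth (\<Phi> j :: 'p iwasawa) 0 \<noteq> 0" unfolding l by (rule eisenstein_nth_0[OF cyc_factor_eisenstein])
    then show ?thesis using 0 by (simp add: cyc_factor_def[of 0] fps_X_dvd_iff)
  next
    case (Suc k)
    obtain P where P: "P dvd 1" "(\<Phi> j :: 'p iwasawa) = fps_X ^ cyc_deg CARD('p) j + PP * P"
      using cyc_factor_eisenstein[of l, where 'p='p] unfolding l eisenstein_def by blast
    have "cyc_deg CARD('p) i < cyc_deg CARD('p) j" using cyc_deg_strict ij Suc CARD_gt_1 by blast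
    then show ?thesis
      unfolding P(2) Suc by (intro eisenstein_not_dvd_X_power_plus[OF cyc_factor_eisenstein] P(1))
  qed
qed

section \<open>Relative rank of submodules of the plane\<close>

lemma fps_nth_sum_const_X_power:
  "fps_nth (\<Sum>i<d. fps_const (c i) * fps_X ^ i) j = (if j < d then c j else (0 :: 'a :: comm_ring_1))"
proof -
  have "fps_nth (\<Sum>i<d. fps_const (c i) * fps_X ^ i) j = (\<Sum>i<d. if i = j then c i else 0)"
    unfolding fps_sum_nth by (intro sum.cong) auto
  then show ?thesis by (simp add: sum.delta)
qed

lemma fps_eq_sum_const_X_power:
  assumes "\<And>i. i \<ge> d \<Longrightarrow> fps_nth r i = (0 :: 'a :: comm_ring_1)"
  shows "r = (\<Sum>i<d. fps_const (fps_nth r i) * fps_X ^ i)"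
  by (rule fps_ext) (use assms in \<open>simp only: fps_nth_sum_const_X_power, simp\<close>)

abbreviation zcomb :: "nat \<Rightarrow> (nat \<Rightarrow> 'p :: prime_card padic_int) \<Rightarrow> (nat \<Rightarrow> 'p iwasawa ^ 2) \<Rightarrow> 'p iwasawa ^ 2" where
  "zcomb d c e \<equiv> \<Sum>i<d. fps_const (c i) *s e i"

text \<open>The dimension of P/N after p is inverted, with no quotient and no fractions: the e i
  form a basis of it, and PP ^ k clears the denominators of the coordinates.\<close>

definition has_rank :: "('p :: prime_card iwasawa ^ 2) set \<Rightarrow> ('p iwasawa ^ 2) set \<Rightarrow> nat \<Rightarrow> bool" where
  "has_rank N P d \<longleftrightarrow> (\<exists>e :: nat \<Rightarrow> 'p iwasawa ^ 2. (\<forall>i<d. e i \<in> P) \<and>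
     (\<forall>c. (zcomb d c e) \<in> N \<longrightarrow> (\<forall>i<d. c i = 0)) \<and>
     (\<forall>x\<in>P. \<exists>k c. PP ^ k *s x - (zcomb d c e) \<in> N))"

lemma has_rankE:
  assumes "has_rank N P d"
  obtains e where "\<And>i. i < d \<Longrightarrow> e i \<in> P"
    "\<And>c. (zcomb d c e) \<in> N \<Longrightarrow> (\<forall>i<d. c i = 0)"
    "\<And>x. x \<in> P \<Longrightarrow> \<exists>k c. PP ^ k *s x - (zcomb d c e) \<in> N"
proof -
  from assms obtain e where e: "(\<forall>i<d. e i \<in> P) \<and>
     (\<forall>c. (zcomb d c e) \<in> N \<longrightarrow> (\<forall>i<d. c i = 0)) \<and>
     (\<forall>x\<in>P. \<exists>k c. PP ^ k *s x - (zcomb d c e) \<in> N)"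
    unfolding has_rank_def by (rule exE)
  show ?thesis by (rule that[of e]) (use e in auto)
qed

lemma sum_lessThan_add: "(\<Sum>i<a + b. f i) = (\<Sum>i<a. f i) + (\<Sum>i<b. f (a + i) :: 'a :: comm_monoid_add)" for a b :: nat
  by (induction b) (auto simp: add_ac)

lemma PP_power_const: "(PP :: 'p :: prime_card iwasawa) ^ k = fps_const (pp ^ k)"
  by (metis fps_const_power fps_of_nat)

lemma scale_sum: "f *s sum g I = (\<Sum>i\<in>I. f *s (g i :: 'a :: comm_ring_1 ^ 'n))"
  by (simp add: vec_eq_iff sum_distrib_left)

text \<open>Additivity in the exact sequence of P/N, Q/N and Q/P: a basis for P/N is followed by
  lifts of a basis for Q/P.\<close>

lemma has_rank_trans:
  assumes N: "lsub N" and P: "lsub P" and NP: "N \<subseteq> P" and a: "has_rank N P a" and b: "has_rank P Q b"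
    and PQ: "P \<subseteq> Q"
  shows "has_rank N (Q :: ('p :: prime_card iwasawa ^ 2) set) (a + b)"
proof -
  obtain e where e: "\<And>i. i < a \<Longrightarrow> e i \<in> P"
    "\<And>c. (zcomb a c e) \<in> N \<Longrightarrow> (\<forall>i<a. c i = 0)"
    "\<And>x. x \<in> P \<Longrightarrow> \<exists>k c. PP ^ k *s x - (zcomb a c e) \<in> N"
    using a by (rule has_rankE) (rule that)
  obtain f where f: "\<And>i. i < b \<Longrightarrow> f i \<in> Q"
    "\<And>c. (zcomb b c f) \<in> P \<Longrightarrow> (\<forall>i<b. c i = 0)"
    "\<And>x. x \<in> Q \<Longrightarrow> \<exists>k c. PP ^ k *s x - (zcomb b c f) \<in> P"
    using b by (rule has_rankE) (rule that)
  define h where "h i = (if i < a then e i else f (i - a))" for i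
  have sum_h: "(zcomb (a + b) c h) =
      (zcomb a c e) + (\<Sum>i<b. fps_const (c (a + i)) *s f i)" for c :: "nat \<Rightarrow> 'p padic_int"
    by (simp add: sum_lessThan_add h_def)
  show ?thesis
    unfolding has_rank_def
  proof (intro exI[of _ h] conjI allI impI ballI)
    fix i assume "i < a + b"
    then show "h i \<in> Q" using e(1)[of i] f(1)[of "i - a"] PQ by (cases "i < a") (simp_all add: h_def subset_iff)
  next
    fix c i assume s: "(zcomb (a + b) c h) \<in> N" and i: "i < a + b"
    have "(zcomb a c e) \<in> P"
      by (rule lsub_sum[OF P], rule lsub_scale[OF P], rule e(1)) simp
    moreover have "(zcomb a c e) + (\<Sum>i<b. fps_const (c (a + i)) *s f i) \<in> P"
      using s NP by (auto simp: sum_h)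
    ultimately have "(\<Sum>i<b. fps_const (c (a + i)) *s f i) \<in> P"
      using lsub_diff[OF P] by fastforce
    then have c2: "\<forall>i<b. c (a + i) = 0" by (rule f(2))
    then have "(\<Sum>i<b. fps_const (c (a + i)) *s f i) = 0" by simp
    then have "\<forall>i<a. c i = 0" using s by (intro e(2)) (simp add: sum_h)
    then show "c i = 0" using c2 i by (metis add_diff_inverse_nat nat_add_left_cancel_less)
  next
    fix x assume "x \<in> Q"
    then obtain k c where kc: "PP ^ k *s x - (zcomb b c f) \<in> P" using f(3) by blast
    then obtain l c' where lc: "PP ^ l *s (PP ^ k *s x - (zcomb b c f)) - (zcomb a c' e) \<in> N"
      using e(3) by blast
    \<comment> \<open>The relation modulo P has been multiplied by p^l before its error term was
      expanded in the basis for P/N, so its coefficients carry the factor p^l.\<close>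
    define g where "g i = (if i < a then c' i else pp ^ l * c (i - a))" for i
    have "(zcomb (a + b) g h) = (zcomb a c' e) + PP ^ l *s (zcomb b c f)"
      by (simp add: sum_h g_def scale_sum PP_power_const vector_smult_assoc)
    then have "PP ^ (l + k) *s x - (zcomb (a + b) g h) \<in> N"
      using lc by (simp add: power_add vector_ssub_ldistrib vector_smult_assoc algebra_simps)
    then show "\<exists>k c. PP ^ k *s x - (zcomb (a + b) c h) \<in> N" by blast
  qed
qed

lemma lsub_colon: "lsub N \<Longrightarrow> lsub {v. w *s v \<in> N}"
  unfolding lsub_def
proof (intro conjI ballI allI)
  assume N: "0 \<in> N \<and> (\<forall>x\<in>N. \<forall>y\<in>N. x + y \<in> N) \<and> (\<forall>x\<in>N. \<forall>f. f *s x \<in> N)"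
  then show "0 \<in> {v. w *s v \<in> N}" by simp
  fix x assume x: "x \<in> {v. w *s v \<in> N}"
  show "x + y \<in> {v. w *s v \<in> N}" if "y \<in> {v. w *s v \<in> N}" for y
    using N x that by (simp add: vector_add_ldistrib)
  fix f
  have "w *s (f *s x) = f *s (w *s x)" by (simp add: vector_smult_assoc mult.commute)
  moreover have "f *s (w *s x) \<in> N" using N x by blast
  ultimately show "f *s x \<in> {v. w *s v \<in> N}" by simp
qed

text \<open>Multiplication by w identifies the quotient of \<Lambda>^2 by (N : w) with (w
  \<Lambda>^2 + N)/N. This does for ranks what \<open>relpowp_pstep_image\<close> does for
  lengths.\<close>

lemma has_rank_image:
  fixes N :: "('p :: prime_card iwasawa ^ 2) set"
  assumes N: "lsub N" and T: "has_rank {v. w *s v \<in> N} UNIV d"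
  shows "has_rank N {w *s v + x | v x. x \<in> N} d"
proof -
  let ?T = "{v. w *s v \<in> N}"
  obtain e where e0: "\<And>i. i < d \<Longrightarrow> e i \<in> UNIV" "\<And>c. (zcomb d c e) \<in> ?T \<Longrightarrow> (\<forall>i<d. c i = 0)"
    "\<And>x. x \<in> UNIV \<Longrightarrow> \<exists>k c. PP ^ k *s x - (zcomb d c e) \<in> ?T"
    using T by (rule has_rankE) (rule that)
  note e = e0(2) e0(3)[OF UNIV_I]
  have s: "(\<Sum>i<d. fps_const (c i) *s (w *s e i)) = w *s (zcomb d c e)" for c :: "nat \<Rightarrow> 'p padic_int"
    by (simp add: scale_sum vector_smult_assoc mult.commute)
  show ?thesis
    unfolding has_rank_def
  proof (intro exI[of _ "\<lambda>i. w *s e i"] conjI allI impI ballI)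
    fix i
    have "w *s e i = w *s e i + 0" by simp
    then show "w *s e i \<in> {w *s v + x | v x. x \<in> N}" using lsub_0[OF N] by blast
  next
    fix c i assume cN: "(\<Sum>i<d. fps_const (c i) *s (w *s e i)) \<in> N" and i: "i < d"
    show "c i = 0" using e(1)[of c] cN[unfolded s] i by blast
  next
    fix y assume "y \<in> {w *s v + x | v x. x \<in> N}"
    then obtain v x where y: "y = w *s v + x" "x \<in> N" by blast
    obtain k c where kc: "PP ^ k *s v - (zcomb d c e) \<in> ?T" using e(2)[of v] by blast
    have "PP ^ k *s y - (\<Sum>i<d. fps_const (c i) *s (w *s e i)) =
        w *s (PP ^ k *s v - (zcomb d c e)) + PP ^ k *s x"
      unfolding s y(1) by (simp add: vector_ssub_ldistrib vector_add_ldistrib vector_smult_assoc mult.commute)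
    also have "\<dots> \<in> N"
      by (rule lsub_add[OF N]) (use kc y(2) lsub_scale[OF N] in auto)
    finally show "\<exists>k c. PP ^ k *s y - (\<Sum>i<d. fps_const (c i) *s (w *s e i)) \<in> N" by blast
  qed
qed

lemma has_rank_0:
  assumes "\<And>v. \<exists>k. PP ^ k *s v \<in> N"
  shows "has_rank N UNIV 0"
  using assms unfolding has_rank_def by simp

text \<open>Once p is inverted, P/N is the cyclic module \<Lambda> e, isomorphic to \<Lambda>/(D).
  Weierstrass division by D makes 1, X, ..., X^(d - 1) a basis of that ring; its uniqueness part
  gives independence.\<close>

lemma has_rank_one:
  fixes D :: "'p :: prime_card iwasawa"
  assumes D: "good_prime d D" and N: "lsub N" and P: "lsub P" and e: "e \<in> P" "D *s e \<in> N"
    and indep: "\<And>f. f *s e \<in> N \<Longrightarrow> D dvd f"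
    and span: "\<And>v. v \<in> P \<Longrightarrow> \<exists>k f. PP ^ k *s v - f *s e \<in> N"
  shows "has_rank N P d"
proof -
  obtain Q where Q: "D = fps_X ^ d + PP * Q" using D by (auto simp: good_prime_def)
  have s: "(\<Sum>i<d. fps_const (c i) *s (fps_X ^ i *s e)) = (\<Sum>i<d. fps_const (c i) * fps_X ^ i) *s e" for c :: "nat \<Rightarrow> 'p padic_int"
    by (simp add: vec_eq_iff sum_distrib_right mult.assoc)
  show ?thesis
    unfolding has_rank_def
  proof (intro exI[of _ "\<lambda>i. fps_X ^ i *s e"] conjI allI impI ballI)
    fix i show "fps_X ^ i *s e \<in> P" using e(1) P by (rule lsub_scale[rotated])
  next
    fix c i assume cN: "(\<Sum>i<d. fps_const (c i) *s (fps_X ^ i *s e)) \<in> N" and i: "i < d"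
    let ?f = "\<Sum>i<d. fps_const (c i) * fps_X ^ i"
    have "D dvd ?f" using cN unfolding s by (rule indep)
    then obtain q where "?f = D * q" by (rule dvdE)
    then have "(- q) * D + ?f = 0" by simp
    then have "?f = 0" by (rule weierstrass_unique(2)[where d=d and P=Q, folded Q]) (simp only: fps_nth_sum_const_X_power, simp)
    then have "fps_nth ?f i = 0" by simp
    then show "c i = 0" using i by (simp only: fps_nth_sum_const_X_power) simp
  next
    fix v assume "v \<in> P"
    then obtain k f where kf: "PP ^ k *s v - f *s e \<in> N" using span by blast
    obtain q r where qr: "f = q * (fps_X ^ d + PP * Q) + r" "\<And>i. i \<ge> d \<Longrightarrow> fps_nth r i = 0"
      using weierstrass_division by blast
    have r: "r = (\<Sum>i<d. fps_const (fps_nth r i) * fps_X ^ i)"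
      by (rule fps_eq_sum_const_X_power[OF qr(2)])
    have "PP ^ k *s v - r *s e = (PP ^ k *s v - f *s e) + q *s (D *s e)"
      unfolding qr(1) Q by (simp add: vec2_eq algebra_simps)
    also have "\<dots> \<in> N"
      by (rule lsub_add[OF N kf lsub_scale[OF N e(2)]])
    finally have "PP ^ k *s v - r *s e \<in> N" .
    then have "PP ^ k *s v - (\<Sum>i<d. fps_const (fps_nth r i) *s (fps_X ^ i *s e)) \<in> N"
      unfolding s using r by simp
    then show "\<exists>k c. PP ^ k *s v - (\<Sum>i<d. fps_const (c i) *s (fps_X ^ i *s e)) \<in> N"
      by (intro exI[of _ k] exI[of _ "fps_nth r"])
  qed
qed

text \<open>The coordinates are treated one at a time: both factors of the filtration by the
  condition on the first coordinate are copies of \<Lambda>/(D).\<close>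

lemma has_rank_vdvd:
  fixes D :: "'p :: prime_card iwasawa"
  assumes D: "good_prime d D"
  shows "has_rank {v. vdvd D v} UNIV (d + d)"
proof (rule has_rank_trans[where P = "{v :: 'p iwasawa ^ 2. D dvd v $ 1}"])
  show N: "lsub {v. vdvd D v}" and P: "lsub {v :: 'p iwasawa ^ 2. D dvd v $ 1}" by (auto simp: lsub_def vdvd_def)
  show "has_rank {v. vdvd D v} {v :: 'p iwasawa ^ 2. D dvd v $ 1} d"
  proof (rule has_rank_one[OF D N P, of "vector [0, 1]"])
    fix v :: "'p iwasawa ^ 2" assume "v \<in> {v :: 'p iwasawa ^ 2. D dvd v $ 1}"
    then have "PP ^ 0 *s v - (v $ 2) *s vector [0, 1] \<in> {v. vdvd D v}" by (simp add: vdvd_def)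
    then show "\<exists>k f. PP ^ k *s v - f *s vector [0, 1] \<in> {v. vdvd D v}" by blast
  qed (auto simp: vdvd_def)
  show "has_rank {v :: 'p iwasawa ^ 2. D dvd v $ 1} UNIV d"
  proof (rule has_rank_one[OF D P, of _ "vector [1, 0]"])
    fix v :: "'p iwasawa ^ 2"
    have "PP ^ 0 *s v - (v $ 1) *s vector [1, 0] \<in> {v :: 'p iwasawa ^ 2. D dvd v $ 1}" by simp
    then show "\<exists>k f. PP ^ k *s v - f *s vector [1, 0] \<in> {v :: 'p iwasawa ^ 2. D dvd v $ 1}" by blast
  qed (auto simp: lsub_def)
qed (auto simp: vdvd_def)

text \<open>Modulo D, w is nonzero and the column a vanishes, so every element of the colon module
  is proportional to b there; \<open>det2 v b\<close> tests this. Over the fraction field of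
  \<Lambda>/(D) the quotient is the plane modulo the line of b.\<close>

lemma gen2_rank_one:
  fixes D w :: "'p :: prime_card iwasawa" and a b :: "'p iwasawa ^ 2"
  assumes D: "good_prime d D" and w: "\<not> D dvd w" and a: "vdvd D a" and b: "\<not> vdvd D b"
  shows "has_rank {v. w *s v \<in> gen2 (w * D) a b} UNIV d"
proof -
  let ?N = "gen2 (w * D) a b" let ?T = "{v. w *s v \<in> ?N}"
  have prime: "prime_elem D" using D by (simp add: good_prime_def)
  have T: "lsub ?T" by (rule lsub_colon[OF lsub_gen2])
  have bT: "b \<in> ?T" by (auto intro!: lsub_scale lsub_gen2 gen2_mem)
  have DT: "D *s v \<in> ?T" for v using gen2_mem(3)[of "w * D" v a b] by (simp add: vector_smult_assoc)
  have det: "D dvd det2 v b" if vT: "v \<in> ?T" for v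
  proof -
    obtain y f g where eq: "w *s v = (w * D) *s y + f *s a + g *s b" using vT unfolding gen2_def by blast
    obtain a' where a': "a = D *s a'" using a by (auto simp: vdvd_iff)
    have "w * det2 v b = det2 (w *s v) b" by (simp add: det2_def algebra_simps)
    also have "\<dots> = D * (w * det2 y b + f * det2 a' b)"
      unfolding eq a' by (simp add: det2_def algebra_simps)
    finally have "D dvd w * det2 v b" by simp
    then show ?thesis using prime_elem_dvd_multD[OF prime] w by blast
  qed
  \<comment> \<open>c is an entry of b that D does not divide, and e is the unit vector that
    completes b to a basis once c is inverted. Inverting p is enough for this, since some power of p
    is a multiple of c modulo D.\<close>
  have main: ?thesis if c: "\<not> D dvd c" and ec: "det2 e b = c \<or> det2 e b = - c"
    and span: "\<And>v. \<exists>f. c *s v - f *s e \<in> ?T" for c e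
  proof (rule has_rank_one[OF D T, of _ e])
    obtain k s t where k: "PP ^ k = c * s + D * t" using D c by (auto simp: good_prime_def)
    fix v
    obtain f where f: "c *s v - f *s e \<in> ?T" using span by blast
    have "PP ^ k *s v - (s * f) *s e = s *s (c *s v - f *s e) + D *s (t *s v)"
      by (simp add: vec2_eq k algebra_simps)
    also have "\<dots> \<in> ?T" by (rule lsub_add[OF T lsub_scale[OF T f] DT])
    finally show "\<exists>k f. PP ^ k *s v - f *s e \<in> ?T" by blast
  next
    fix f assume "f *s e \<in> ?T"
    then have "D dvd det2 (f *s e) b" by (rule det)
    also have "det2 (f *s e) b = f * det2 e b" by (simp add: det2_def algebra_simps)
    finally have "D dvd f * c" using ec by auto
    then show "D dvd f" using prime_elem_dvd_multD[OF prime] c by blast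
  qed (use DT in \<open>auto simp: lsub_def\<close>)
  show ?thesis
  proof (cases "D dvd b $ 2")
    case False
    show ?thesis
    proof (rule main[OF False, of "vector [1, 0]"])
      fix v
      have "b $ 2 *s v - (b $ 2 * v $ 1 - v $ 2 * b $ 1) *s vector [1, 0] = v $ 2 *s b"
        by (simp add: vec2_eq algebra_simps)
      then show "\<exists>f. b $ 2 *s v - f *s vector [1, 0] \<in> ?T" using lsub_scale[OF T bT] by metis
    qed (simp add: det2_def)
  next
    case True
    then have False: "\<not> D dvd b $ 1" using b by (simp add: vdvd_def)
    show ?thesis
    proof (rule main[OF False, of "vector [0, 1]"])
      fix v
      have "b $ 1 *s v - (b $ 1 * v $ 2 - v $ 1 * b $ 2) *s vector [0, 1] = v $ 1 *s b"
        by (simp add: vec2_eq algebra_simps)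
      then show "\<exists>f. b $ 1 *s v - f *s vector [0, 1] \<in> ?T" using lsub_scale[OF T bT] by metis
    qed (simp add: det2_def)
  qed
qed

text \<open>With w = \<omega>_m and D = \<Phi>_(m + 1) this reads N_m = \<omega>_m \<Lambda>^2 +
  N_(m + 1), so multiplication by \<omega>_m maps onto N_m/N_(m + 1).\<close>

lemma gen2_image: "gen2 w a b = {w *s v + x | v x. x \<in> gen2 (w * D) a b}"
proof (intro equalityI subsetI)
  fix y assume "y \<in> gen2 w a b"
  then obtain v f g where "y = w *s v + f *s a + g *s b" unfolding gen2_def by blast
  then have "y = w *s v + ((w * D) *s 0 + f *s a + g *s b)" by (simp add: add.assoc)
  then show "y \<in> {w *s v + x | v x. x \<in> gen2 (w * D) a b}" using gen2_memI by blast
next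
  fix y assume "y \<in> {w *s v + x | v x. x \<in> gen2 (w * D) a b}"
  then obtain v v' f g where "y = w *s v + ((w * D) *s v' + f *s a + g *s b)" unfolding gen2_def by blast
  then have "y = w *s (v + D *s v') + f *s a + g *s b" by (simp add: vec2_eq algebra_simps)
  then show "y \<in> gen2 w a b" by (rule gen2_memI)
qed

text \<open>Over the fraction field of \<Lambda>/(D), the colon module becomes the span of the two
  columns modulo D: zero, a line, or everything, according to the number of columns that vanish
  there. The hypothesis \<open>special\<close> excludes two nonzero proportional columns, whose span
  is a line although neither is counted.\<close>

lemma gen2_rank:
  fixes D w :: "'p :: prime_card iwasawa" and a b :: "'p iwasawa ^ 2"
  assumes D: "good_prime d D" and w: "\<not> D dvd w" and special: "D dvd det2 a b \<Longrightarrow> vdvd D a \<or> vdvd D b"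
  shows "has_rank (gen2 (w * D) a b) (gen2 w a b) (d * (of_bool (vdvd D a) + of_bool (vdvd D b)))"
proof -
  let ?T = "{v. w *s v \<in> gen2 (w * D) a b}"
  have prime: "prime_elem D" using D by (simp add: good_prime_def)
  have T: "lsub ?T" by (rule lsub_colon[OF lsub_gen2])
  have abT: "a \<in> ?T" "b \<in> ?T" by (auto intro!: lsub_scale lsub_gen2 gen2_mem)
  have DT: "D *s v \<in> ?T" for v using gen2_mem(3)[of "w * D" v a b] by (simp add: vector_smult_assoc)
  have "has_rank ?T UNIV (d * (of_bool (vdvd D a) + of_bool (vdvd D b)))"
  proof (cases "vdvd D a"; cases "vdvd D b")
    assume ab: "vdvd D a" "vdvd D b"
    have "?T = {v. vdvd D v}"
    proof (intro equalityI subsetI)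
      fix v assume "v \<in> ?T"
      then obtain y f g where eq: "w *s v = (w * D) *s y + f *s a + g *s b" unfolding gen2_def by blast
      obtain a' b' where ab': "a = D *s a'" "b = D *s b'" using ab by (auto simp: vdvd_iff)
      have "w *s v = D *s (w *s y + f *s a' + g *s b')" unfolding eq ab' by (simp add: vec2_eq algebra_simps)
      then have "w * v $ i = D * (w *s y + f *s a' + g *s b') $ i" for i by (metis vector_smult_component)
      then have "D dvd w * v $ i" for i by (metis dvd_triv_left)
      then show "v \<in> {v. vdvd D v}" using prime_elem_dvd_multD[OF prime] w by (auto simp: vdvd_def)
    next
      fix v assume "v \<in> {v. vdvd D v}"
      then show "v \<in> ?T" using DT by (auto simp: vdvd_iff)
    qed
    then show ?thesis using has_rank_vdvd[OF D] ab by (simp add: mult_2_right)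
  next
    assume ab: "vdvd D a" "\<not> vdvd D b"
    then show ?thesis using gen2_rank_one[OF D w ab] by simp
  next
    assume ab: "\<not> vdvd D a" "vdvd D b"
    then show ?thesis using gen2_rank_one[OF D w ab(2,1)] by (simp add: gen2_commute[of _ b a])
  next
    assume ab: "\<not> vdvd D a" "\<not> vdvd D b"
    then have "\<not> D dvd det2 a b" using special by blast
    then obtain k s t where k: "PP ^ k = det2 a b * s + D * t" using D by (auto simp: good_prime_def)
    have "has_rank ?T UNIV 0"
    proof (rule has_rank_0)
      fix v
      \<comment> \<open>Cramer's rule writes the determinant times v as a combination of a and
        b.\<close>
      have "PP ^ k *s v = (s * det2 v b) *s a + (s * det2 a v) *s b + D *s (t *s v)"
        unfolding k by (simp add: vec2_eq det2_def algebra_simps)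
      also have "\<dots> \<in> ?T" by (intro lsub_add[OF T] lsub_scale[OF T] abT DT)
      finally show "\<exists>k. PP ^ k *s v \<in> ?T" by blast
    qed
    then show ?thesis using ab by simp
  qed
  then have "has_rank (gen2 (w * D) a b) {w *s v + x | v x. x \<in> gen2 (w * D) a b}
      (d * (of_bool (vdvd D a) + of_bool (vdvd D b)))"
    by (rule has_rank_image[OF lsub_gen2])
  then show ?thesis by (simp only: gen2_image[symmetric])
qed

section \<open>Removing the common factors of the columns\<close>

lemma prod_primes_vdvd:
  fixes F :: "'i \<Rightarrow> 'p :: prime_card iwasawa"
  assumes "finite I" "\<And>i. i \<in> I \<Longrightarrow> prime_elem (F i)" "\<And>i j. i \<in> I \<Longrightarrow> j \<in> I \<Longrightarrow> i \<noteq> j \<Longrightarrow> \<not> F i dvd F j"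
    "\<And>i. i \<in> I \<Longrightarrow> vdvd (F i) a"
  obtains a' where "a = prod F I *s a'"
proof -
  have "vdvd (prod F I) a"
    unfolding vdvd_def using assms(4) by (intro conjI prod_primes_dvd[OF assms(1-3)]) (auto simp: vdvd_def)
  then show ?thesis using that by (auto simp: vdvd_iff)
qed

text \<open>In a relation w x = w D y + f a + g b, take a prime factor q of w that does not divide
  a. Either q divides the determinant, hence b, so it divides f a and therefore f; or Cramer's rule
  shows that it divides f. Thus f a and g b are separately multiples of w, which can be
  cancelled.\<close>

lemma gen2_colon:
  fixes F :: "'i \<Rightarrow> 'p :: prime_card iwasawa"
  assumes I: "finite I" and prime: "\<And>i. i \<in> I \<Longrightarrow> prime_elem (F i)"
    and dist: "\<And>i j. i \<in> I \<Longrightarrow> j \<in> I \<Longrightarrow> i \<noteq> j \<Longrightarrow> \<not> F i dvd F j"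
    and special: "\<And>i. i \<in> I \<Longrightarrow> F i dvd det2 a b \<Longrightarrow> vdvd (F i) a \<or> vdvd (F i) b"
    and a: "a = prod F {i \<in> I. vdvd (F i) a} *s a'" and b: "b = prod F {i \<in> I. vdvd (F i) b} *s b'"
  shows "{v. prod F I *s v \<in> gen2 (prod F I * D) a b} = gen2 D a' b'"
proof (intro equalityI subsetI)
  let ?w = "prod F I"
  let ?u = "\<lambda>c. prod F {i \<in> I. vdvd (F i) c}" and ?v = "\<lambda>c. prod F {i \<in> I. \<not> vdvd (F i) c}"
  have w: "?w = ?v c * ?u c" for c
  proof -
    have "?w = prod F ({i \<in> I. \<not> vdvd (F i) c} \<union> {i \<in> I. vdvd (F i) c})" by (rule prod.cong) auto
    then show ?thesis using I by (subst (asm) prod.union_disjoint) auto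
  qed
  have w0: "?w \<noteq> 0" using I prime by (auto simp: prime_elem_def)
  {
    fix x assume "x \<in> {v. ?w *s v \<in> gen2 (?w * D) a b}"
    then obtain y f g where eq: "?w *s x = (?w * D) *s y + f *s a + g *s b" unfolding gen2_def by blast
    \<comment> \<open>The columns are bound anew here, so that the same argument serves g and b with
      the roles exchanged.\<close>
    have key: "F i dvd f" if eq: "?w *s x = (?w * D) *s y + f *s a + g *s b" and i: "i \<in> I" "\<not> vdvd (F i) a"
      and special: "F i dvd det2 a b \<Longrightarrow> vdvd (F i) b" for i f g a b y
    proof -
      have p: "prime_elem (F i)" using prime i by blast
      have "F i dvd ?w" using I i by (simp add: dvd_prodI)
      then obtain w' where w': "?w = F i * w'" by (rule dvdE)
      have e: "f *s a + g *s b = F i *s (w' *s x - (w' * D) *s y)"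
      proof -
        have "f *s a + g *s b = ?w *s x - (?w * D) *s y" using eq by (simp add: algebra_simps)
        then show ?thesis unfolding w' by (simp add: vec2_eq algebra_simps)
      qed
      show ?thesis
      proof (cases "F i dvd det2 a b")
        case True
        then obtain b' where b': "b = F i *s b'" using special by (auto simp: vdvd_iff)
        have "f *s a = F i *s (w' *s x - (w' * D) *s y - g *s b')"
        proof -
          have "f *s a = (f *s a + g *s b) - g *s b" by simp
          also have "\<dots> = F i *s (w' *s x - (w' * D) *s y) - g *s (F i *s b')" unfolding e by (simp only: b')
          finally show ?thesis by (simp add: vec2_eq algebra_simps)
        qed
        then have "f * a $ j = F i * (w' *s x - (w' * D) *s y - g *s b') $ j" for j by (metis vector_smult_component)
        then have "F i dvd f * a $ j" for j by (metis dvd_triv_left)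
        then show ?thesis using prime_elem_dvd_multD[OF p] i(2) unfolding vdvd_def by blast
      next
        case False
        have "f * det2 a b = det2 (f *s a + g *s b) b" by (simp add: det2_def algebra_simps)
        also have "\<dots> = F i * det2 (w' *s x - (w' * D) *s y) b" unfolding e by (simp add: det2_def algebra_simps)
        finally have "F i dvd f * det2 a b" by simp
        then show ?thesis using prime_elem_dvd_multD[OF p] False by blast
      qed
    qed
    have "?v a dvd f"
      proof (rule prod_primes_dvd)
      fix i assume "i \<in> {i \<in> I. \<not> vdvd (F i) a}"
      then have i: "i \<in> I" "\<not> vdvd (F i) a" by auto
      show "F i dvd f" by (rule key[OF eq i]) (use special i in blast)
    qed (use I prime dist in auto)
    then obtain f' where f': "f = ?v a * f'" by (rule dvdE)
    have det: "det2 b a = - det2 a b" by (simp add: det2_def algebra_simps)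
    have eq': "?w *s x = (?w * D) *s y + g *s b + f *s a" using eq by (simp add: add_ac)
    have "?v b dvd g"
      proof (rule prod_primes_dvd)
      fix i assume "i \<in> {i \<in> I. \<not> vdvd (F i) b}"
      then have i: "i \<in> I" "\<not> vdvd (F i) b" by auto
      show "F i dvd g" by (rule key[OF eq' i]) (use special i det in auto)
    qed (use I prime dist in auto)
    then obtain g' where g': "g = ?v b * g'" by (rule dvdE)
    have fa: "f *s a = ?w *s (f' *s a')"
    proof -
      \<comment> \<open>The column a also occurs on the right of its factorization, inside the index
        set, so the equation is applied exactly once by congruence.\<close>
      have "f *s a = f *s (?u a *s a')" by (rule arg_cong[OF a, of "\<lambda>z. f *s z"])
      then show ?thesis unfolding f' w[of a] by (simp add: vector_smult_assoc mult_ac)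
    qed
    have gb: "g *s b = ?w *s (g' *s b')"
    proof -
      have "g *s b = g *s (?u b *s b')" by (rule arg_cong[OF b, of "\<lambda>z. g *s z"])
      then show ?thesis unfolding g' w[of b] by (simp add: vector_smult_assoc mult_ac)
    qed
    have "?w *s x = ?w *s (D *s y + f' *s a' + g' *s b')"
      unfolding eq fa gb by (simp add: vector_add_ldistrib vector_smult_assoc)
    then have "?w * x $ i = ?w * (D *s y + f' *s a' + g' *s b') $ i" for i by (metis vector_smult_component)
    then have "x = D *s y + f' *s a' + g' *s b'" using mult_left_cancel[OF w0] by (auto simp only: vec_eq_iff)
    then show "x \<in> gen2 D a' b'" by (rule gen2_memI)
  }
  {
    fix x assume x: "x \<in> gen2 D a' b'"
    have "?v a *s a = ?v a *s (?u a *s a')" by (rule arg_cong[OF a, of "\<lambda>z. ?v a *s z"])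
    then have "?w *s a' = ?v a *s a" by (simp only: w[of a] vector_smult_assoc)
    then have a'T: "?w *s a' \<in> gen2 (?w * D) a b" by (simp add: lsub_scale lsub_gen2 gen2_mem)
    have "?v b *s b = ?v b *s (?u b *s b')" by (rule arg_cong[OF b, of "\<lambda>z. ?v b *s z"])
    then have "?w *s b' = ?v b *s b" by (simp only: w[of b] vector_smult_assoc)
    then have b'T: "?w *s b' \<in> gen2 (?w * D) a b" by (simp add: lsub_scale lsub_gen2 gen2_mem)
    have "gen2 D a' b' \<subseteq> {v. ?w *s v \<in> gen2 (?w * D) a b}"
      using gen2_mem(3)[of "?w * D" _ a b] a'T b'T
      by (intro gen2_le lsub_colon lsub_gen2) (auto simp: vector_smult_assoc)
    then show "x \<in> {v. ?w *s v \<in> gen2 (?w * D) a b}" using x by blast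
  }
qed

section \<open>Quotient modules and extension of scalars\<close>

definition coset_of :: "'m :: ab_group_add set \<Rightarrow> 'm \<Rightarrow> 'm set" where
  "coset_of N x = (\<lambda>n. n + x) ` N"

text \<open>The scalar multiplication on \<open>M\<close> need only satisfy the module axioms modulo \<open>N\<close>, as is the
  case for \<^const>\<open>tensor_free\<close>.\<close>

locale pre_quotient =
  fixes R :: "'r ring" and M :: "('r, 'm :: ab_group_add) module" and N :: "'m set"
  assumes R: "cring R"
    and add: "add M = (+)" and zero: "ring.zero M = 0"
    and C_0: "0 \<in> carrier M" and C_diff: "\<And>x y. x \<in> carrier M \<Longrightarrow> y \<in> carrier M \<Longrightarrow> x - y \<in> carrier M"
    and N_sub: "N \<subseteq> carrier M" and N_0: "0 \<in> N" and N_diff: "\<And>x y. x \<in> N \<Longrightarrow> y \<in> N \<Longrightarrow> x - y \<in> N"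
    and smult_C: "\<And>r x. r \<in> carrier R \<Longrightarrow> x \<in> carrier M \<Longrightarrow> r \<odot>\<^bsub>M\<^esub> x \<in> carrier M"
    and smult_N: "\<And>r x. r \<in> carrier R \<Longrightarrow> x \<in> N \<Longrightarrow> r \<odot>\<^bsub>M\<^esub> x \<in> N"
    and smult_add: "\<And>r x y. r \<in> carrier R \<Longrightarrow> x \<in> carrier M \<Longrightarrow> y \<in> carrier M \<Longrightarrow> r \<odot>\<^bsub>M\<^esub> (x + y) = r \<odot>\<^bsub>M\<^esub> x + r \<odot>\<^bsub>M\<^esub> y"
    and smult_distr: "\<And>r s x. r \<in> carrier R \<Longrightarrow> s \<in> carrier R \<Longrightarrow> x \<in> carrier M \<Longrightarrow>
          (r \<oplus>\<^bsub>R\<^esub> s) \<odot>\<^bsub>M\<^esub> x - (r \<odot>\<^bsub>M\<^esub> x + s \<odot>\<^bsub>M\<^esub> x) \<in> N"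
    and smult_assoc: "\<And>r s x. r \<in> carrier R \<Longrightarrow> s \<in> carrier R \<Longrightarrow> x \<in> carrier M \<Longrightarrow>
          (r \<otimes>\<^bsub>R\<^esub> s) \<odot>\<^bsub>M\<^esub> x - r \<odot>\<^bsub>M\<^esub> (s \<odot>\<^bsub>M\<^esub> x) \<in> N"
    and smult_1: "\<And>x. x \<in> carrier M \<Longrightarrow> \<one>\<^bsub>R\<^esub> \<odot>\<^bsub>M\<^esub> x - x \<in> N"
begin

abbreviation "Q \<equiv> quotient_module M N"

lemma N_uminus: "x \<in> N \<Longrightarrow> - x \<in> N" using N_diff[OF N_0] by simp
lemma N_add: "x \<in> N \<Longrightarrow> y \<in> N \<Longrightarrow> x + y \<in> N" using N_diff[of x "- y"] N_uminus by simp
lemma C_uminus: "x \<in> carrier M \<Longrightarrow> - x \<in> carrier M" using C_diff[OF C_0] by simp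
lemma C_add: "x \<in> carrier M \<Longrightarrow> y \<in> carrier M \<Longrightarrow> x + y \<in> carrier M" using C_diff[of x "- y"] C_uminus by simp

lemma r_coset: "N +>\<^bsub>M\<^esub> x = coset_of N x"
  unfolding a_r_coset_def' coset_of_def add by auto

lemma carrier_Q: "carrier Q = coset_of N ` carrier M"
  unfolding quotient_module_def A_RCOSETS_def' by (auto simp: r_coset)

lemma coset_of_mem_iff: "y \<in> coset_of N x \<longleftrightarrow> y - x \<in> N"
proof -
  have "y = (y - x) + x" by simp
  then show ?thesis unfolding coset_of_def by (metis (no_types, lifting) add_diff_cancel_right' image_iff)
qed

lemma coset_of_eq_iff: "coset_of N x = coset_of N y \<longleftrightarrow> x - y \<in> N"
proof
  assume "coset_of N x = coset_of N y"
  moreover have "x \<in> coset_of N x" using N_0 by (simp add: coset_of_mem_iff)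
  ultimately show "x - y \<in> N" by (simp add: coset_of_mem_iff)
next
  assume xy: "x - y \<in> N"
  have "z - x \<in> N \<longleftrightarrow> z - y \<in> N" for z
    using N_add[OF _ xy, of "z - x"] N_diff[OF _ xy, of "z - y"] by auto
  then show "coset_of N x = coset_of N y" by (auto simp: coset_of_mem_iff)
qed

lemma Q_add: "coset_of N x \<oplus>\<^bsub>Q\<^esub> coset_of N y = coset_of N (x + y)"
proof -
  have "z \<in> coset_of N x <+>\<^bsub>M\<^esub> coset_of N y \<longleftrightarrow> z \<in> coset_of N (x + y)" for z
  proof
    assume "z \<in> coset_of N x <+>\<^bsub>M\<^esub> coset_of N y"
    then obtain a b where ab: "z = a + b" "a - x \<in> N" "b - y \<in> N"
      by (auto simp: set_add_def' add coset_of_mem_iff)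
    have "z - (x + y) = (a - x) + (b - y)" by (simp add: ab(1))
    then have "z - (x + y) \<in> N" using N_add[OF ab(2,3)] by (simp only:)
    then show "z \<in> coset_of N (x + y)" by (simp only: coset_of_mem_iff)
  next
    assume "z \<in> coset_of N (x + y)"
    then have "z - y \<in> coset_of N x" by (simp add: coset_of_mem_iff diff_diff_eq add.commute)
    moreover have "y \<in> coset_of N y" using N_0 by (simp add: coset_of_mem_iff)
    ultimately show "z \<in> coset_of N x <+>\<^bsub>M\<^esub> coset_of N y"
      unfolding set_add_def' add by (intro UN_I[of "z - y"] UN_I[of y]) auto
  qed
  then have "coset_of N x <+>\<^bsub>M\<^esub> coset_of N y = coset_of N (x + y)" by blast
  then show ?thesis by (simp add: quotient_module_def)
qed

lemma Q_zero: "\<zero>\<^bsub>Q\<^esub> = coset_of N 0"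
  by (simp add: quotient_module_def coset_of_def)

lemma smult_diff:
  assumes "r \<in> carrier R" "x \<in> carrier M" "y \<in> carrier M"
  shows "r \<odot>\<^bsub>M\<^esub> (x - y) = r \<odot>\<^bsub>M\<^esub> x - r \<odot>\<^bsub>M\<^esub> y"
  using smult_add[OF assms(1) C_diff[OF assms(2,3)] assms(3)] by simp

text \<open>The defining union runs over all representatives of the coset. They all yield the same
  coset, because r acts additively and maps N into itself.\<close>

lemma Q_smult:
  assumes r: "r \<in> carrier R" and x: "x \<in> carrier M"
  shows "r \<odot>\<^bsub>Q\<^esub> coset_of N x = coset_of N (r \<odot>\<^bsub>M\<^esub> x)"
proof -
  have "coset_of N (r \<odot>\<^bsub>M\<^esub> y) = coset_of N (r \<odot>\<^bsub>M\<^esub> x)" if "y \<in> coset_of N x" for y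
  proof -
    have n: "y - x \<in> N" using that by (simp add: coset_of_mem_iff)
    then have "(y - x) + x \<in> carrier M" using N_sub x by (intro C_add) auto
    then have "y \<in> carrier M" by simp
    then have "r \<odot>\<^bsub>M\<^esub> y - r \<odot>\<^bsub>M\<^esub> x = r \<odot>\<^bsub>M\<^esub> (y - x)" using smult_diff r x by simp
    then show ?thesis using smult_N[OF r n] by (simp add: coset_of_eq_iff)
  qed
  then have "(\<Union>y\<in>coset_of N x. coset_of N (r \<odot>\<^bsub>M\<^esub> y)) = (\<Union>y\<in>coset_of N x. coset_of N (r \<odot>\<^bsub>M\<^esub> x))"
    by (rule SUP_cong[OF refl])
  moreover have "coset_of N x \<noteq> {}" using N_0 by (auto simp: coset_of_def)
  ultimately show ?thesis by (simp add: quotient_module_def r_coset)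
qed

lemma module_Q: "Module.module R Q"
proof (rule module_criteria[OF R])
  show "\<zero>\<^bsub>Q\<^esub> \<in> carrier Q" using C_0 by (auto simp: Q_zero carrier_Q)
  show "\<forall>v w. v \<in> carrier Q \<and> w \<in> carrier Q \<longrightarrow> v \<oplus>\<^bsub>Q\<^esub> w \<in> carrier Q"
    by (auto simp: carrier_Q Q_add intro!: imageI C_add)
  show "\<forall>v\<in>carrier Q. \<exists>neg_v\<in>carrier Q. v \<oplus>\<^bsub>Q\<^esub> neg_v = \<zero>\<^bsub>Q\<^esub>"
  proof
    fix v assume "v \<in> carrier Q"
    then obtain x where x: "x \<in> carrier M" "v = coset_of N x" by (auto simp: carrier_Q)
    have "coset_of N (- x) \<in> carrier Q" using x(1) by (auto simp: carrier_Q intro!: imageI C_uminus)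
    moreover have "v \<oplus>\<^bsub>Q\<^esub> coset_of N (- x) = \<zero>\<^bsub>Q\<^esub>" by (simp add: x(2) Q_add Q_zero)
    ultimately show "\<exists>neg_v\<in>carrier Q. v \<oplus>\<^bsub>Q\<^esub> neg_v = \<zero>\<^bsub>Q\<^esub>" by blast
  qed
  show "\<forall>c v. c \<in> carrier R \<and> v \<in> carrier Q \<longrightarrow> c \<odot>\<^bsub>Q\<^esub> v \<in> carrier Q"
    by (auto simp: carrier_Q Q_smult intro!: imageI smult_C)
  show "\<forall>v w. v \<in> carrier Q \<and> w \<in> carrier Q \<longrightarrow> v \<oplus>\<^bsub>Q\<^esub> w = w \<oplus>\<^bsub>Q\<^esub> v"
    by (auto simp: carrier_Q Q_add add.commute)
  show "\<forall>v w x. v \<in> carrier Q \<and> w \<in> carrier Q \<and> x \<in> carrier Q \<longrightarrow> v \<oplus>\<^bsub>Q\<^esub> w \<oplus>\<^bsub>Q\<^esub> x = v \<oplus>\<^bsub>Q\<^esub> (w \<oplus>\<^bsub>Q\<^esub> x)"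
    by (auto simp: carrier_Q Q_add add.assoc)
  show "\<forall>v\<in>carrier Q. v \<oplus>\<^bsub>Q\<^esub> \<zero>\<^bsub>Q\<^esub> = v" by (auto simp: carrier_Q Q_add Q_zero)
  show "\<forall>a b v. a \<in> carrier R \<and> b \<in> carrier R \<and> v \<in> carrier Q \<longrightarrow>
      (a \<otimes>\<^bsub>R\<^esub> b) \<odot>\<^bsub>Q\<^esub> v = a \<odot>\<^bsub>Q\<^esub> (b \<odot>\<^bsub>Q\<^esub> v)"
    using R by (clarsimp simp: carrier_Q Q_smult smult_C cring.cring_simprules coset_of_eq_iff smult_assoc)
  show "\<forall>v\<in>carrier Q. \<one>\<^bsub>R\<^esub> \<odot>\<^bsub>Q\<^esub> v = v"
    using R by (clarsimp simp: carrier_Q Q_smult cring.cring_simprules coset_of_eq_iff smult_1)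
  show "\<forall>a b v. a \<in> carrier R \<and> b \<in> carrier R \<and> v \<in> carrier Q \<longrightarrow>
      (a \<oplus>\<^bsub>R\<^esub> b) \<odot>\<^bsub>Q\<^esub> v = a \<odot>\<^bsub>Q\<^esub> v \<oplus>\<^bsub>Q\<^esub> b \<odot>\<^bsub>Q\<^esub> v"
    using R by (clarsimp simp: carrier_Q Q_smult Q_add cring.cring_simprules coset_of_eq_iff smult_distr)
  show "\<forall>a v w. a \<in> carrier R \<and> v \<in> carrier Q \<and> w \<in> carrier Q \<longrightarrow>
      a \<odot>\<^bsub>Q\<^esub> (v \<oplus>\<^bsub>Q\<^esub> w) = a \<odot>\<^bsub>Q\<^esub> v \<oplus>\<^bsub>Q\<^esub> a \<odot>\<^bsub>Q\<^esub> w"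
    by (auto simp: carrier_Q Q_smult Q_add smult_add C_add)
qed

end

section \<open>Extension of scalars from Z_p to Q_p\<close>

lemma ring_of_type_algebra_sel [simp]:
  "carrier ring_of_type_algebra = UNIV" "x \<otimes>\<^bsub>ring_of_type_algebra\<^esub> y = x * y" "\<one>\<^bsub>ring_of_type_algebra\<^esub> = 1"
  "\<zero>\<^bsub>ring_of_type_algebra\<^esub> = 0" "x \<oplus>\<^bsub>ring_of_type_algebra\<^esub> y = x + y"
  by (simp_all add: ring_of_type_algebra_def)

lemma free_abelian_induct [consumes 1, case_names 1 2 3]:
  assumes "Poly_Mapping.keys x \<subseteq> S" "P 0"
    "\<And>x y. Poly_Mapping.keys x \<subseteq> S \<Longrightarrow> Poly_Mapping.keys y \<subseteq> S \<Longrightarrow> P x \<Longrightarrow> P y \<Longrightarrow> P (x - y)"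
    "\<And>a. a \<in> S \<Longrightarrow> P (frag_of a)"
  shows "P x"
  using assms by (rule free_Abelian_group_induct)

context
  fixes M :: "('p :: prime_card padic_int, 'm) module"
  assumes M: "Module.module Zp M"
begin

interpretation M: Module.module Zp M by (rule M)

abbreviation (input) "tF \<equiv> tensor_free (Qp :: 'p padic_int fract ring) M"
abbreviation (input) "tS \<equiv> carrier M \<times> (UNIV :: 'p padic_int fract set)"
abbreviation (input) "fsupp c \<equiv> Poly_Mapping.keys c \<subseteq> tS"
abbreviation (input) "tR \<equiv> tensor_relations Zp Qp (\<lambda>x. Fract x (1 :: 'p padic_int)) M"
abbreviation (input) "tH \<equiv> generate (free_Abelian_group tS) tR"

lemma tF_sel: "carrier tF = {c. fsupp c}" "add tF = (+)" "ring.zero tF = 0"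
  "t \<odot>\<^bsub>tF\<^esub> c = frag_extend (\<lambda>(x, s). frag_of (x, t * s)) c"
  by (simp_all add: tensor_free_def free_Abelian_group_def)

lemma tensor_relations_sub: "tR \<subseteq> carrier (free_Abelian_group tS)"
proof
  have *: "a - b - c \<in> carrier (free_Abelian_group tS)" "a - b \<in> carrier (free_Abelian_group tS)"
    if "fsupp a" "fsupp b" "fsupp c" for a b c
  proof -
    have ab: "fsupp (a - b)" using that(1,2) keys_diff[of a b] by (meson Un_least order_trans)
    then show "a - b \<in> carrier (free_Abelian_group tS)" by simp
    have "fsupp (a - b - c)" using ab that(3) keys_diff[of "a - b" c] by (meson Un_least order_trans)
    then show "a - b - c \<in> carrier (free_Abelian_group tS)" by simp
  qed
  fix r assume "r \<in> tR"
  then show "r \<in> carrier (free_Abelian_group tS)"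
    unfolding tensor_relations_def by (elim UnE CollectE exE conjE; hypsubst; intro *) auto
qed

lemma tH_subgroup: "subgroup tH (free_Abelian_group tS)"
  by (rule group.generate_is_subgroup[OF group_free_Abelian_group tensor_relations_sub])

lemma tH_closed: "x \<in> tH \<Longrightarrow> fsupp x" "0 \<in> tH" "x \<in> tH \<Longrightarrow> y \<in> tH \<Longrightarrow> x - y \<in> tH" "x \<in> tH \<Longrightarrow> y \<in> tH \<Longrightarrow> x + y \<in> tH"
proof -
  show k: "fsupp x" if "x \<in> tH" for x
    using subgroup.mem_carrier[OF tH_subgroup that] by simp
  show "0 \<in> tH" using subgroup.one_closed[OF tH_subgroup] by simp
  show a: "x + y \<in> tH" if "x \<in> tH" "y \<in> tH" for x y
    using subgroup.m_closed[OF tH_subgroup that] by simp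
  show "x - y \<in> tH" if "x \<in> tH" "y \<in> tH"
    using a[OF that(1), of "- y"] subgroup.m_inv_closed[OF tH_subgroup that(2)] k[OF that(2)] by simp
qed

lemma tensor_add_left: "x \<in> carrier M \<Longrightarrow> y \<in> carrier M \<Longrightarrow> frag_of (x \<oplus>\<^bsub>M\<^esub> y, s) - frag_of (x, s) - frag_of (y, s) \<in> tH"
  by (rule generate.incl) (auto simp: tensor_relations_def)

lemma tensor_add_right: "x \<in> carrier M \<Longrightarrow> frag_of (x, s + t) - frag_of (x, s) - frag_of (x, t) \<in> tH"
  by (rule generate.incl) (auto simp: tensor_relations_def)

lemma tensor_smult: "x \<in> carrier M \<Longrightarrow> frag_of (r \<odot>\<^bsub>M\<^esub> x, s) - frag_of (x, Fract r 1 * s) \<in> tH"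
  by (rule generate.incl) (auto simp: tensor_relations_def)

lemma tensor_relations_smult:
  "h \<in> tR \<Longrightarrow> t \<odot>\<^bsub>tF\<^esub> h \<in> tR"
  unfolding tensor_relations_def
  by (auto simp: tF_sel frag_extend_diff distrib_left mult.left_commute[of t]) blast+

lemma tH_smult:
  assumes "c \<in> tH" shows "t \<odot>\<^bsub>tF\<^esub> c \<in> tH"
  using assms
proof (induction c rule: generate.induct)
  case one
  then show ?case using tH_closed(2) by (simp add: tF_sel)
next
  case (incl h)
  then show ?case by (intro generate.incl tensor_relations_smult)
next
  case (inv h)
  have "t \<odot>\<^bsub>tF\<^esub> h \<in> tH" by (rule generate.incl[OF tensor_relations_smult[OF inv]])
  then have "0 - t \<odot>\<^bsub>tF\<^esub> h \<in> tH" by (rule tH_closed(3)[OF tH_closed(2)])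
  moreover have "inv\<^bsub>free_Abelian_group tS\<^esub> h = - h"
    using subsetD[OF tensor_relations_sub inv] by simp
  ultimately show ?case by (simp add: tF_sel frag_extend_minus)
next
  case (eng a b)
  then show ?case using tH_closed(4) by (simp add: tF_sel frag_extend_add)
qed

text \<open>On a generator, the failure of distributivity in the scalar is a relation of the second
  kind; induction over the free abelian group does the rest. The other laws hold before the quotient
  is taken.\<close>

lemma tensor_pre_quotient: "pre_quotient Qp tF tH"
proof (rule pre_quotient.intro)
  show "cring (Qp :: 'p padic_int fract ring)" by (rule cring_from_type_algebra)
  show "add tF = (+)" "\<zero>\<^bsub>tF\<^esub> = 0" "0 \<in> carrier tF" by (simp_all add: tF_sel)
  show "\<And>x y. x \<in> carrier tF \<Longrightarrow> y \<in> carrier tF \<Longrightarrow> x - y \<in> carrier tF"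
    using keys_diff by (fastforce simp: tF_sel)
  show "tH \<subseteq> carrier tF" using tH_closed(1) by (auto simp: tF_sel)
  show "0 \<in> tH" "\<And>x y. x \<in> tH \<Longrightarrow> y \<in> tH \<Longrightarrow> x - y \<in> tH" by (fact tH_closed)+
  show "r \<odot>\<^bsub>tF\<^esub> x \<in> carrier tF" if "x \<in> carrier tF" for r x
  proof -
    have "(\<Union>z\<in>Poly_Mapping.keys x. Poly_Mapping.keys (case z of (x, s) \<Rightarrow> frag_of (x, r * s))) \<subseteq> tS"
    proof (rule UN_least)
      fix z assume "z \<in> Poly_Mapping.keys x"
      then have "z \<in> tS" using that by (auto simp: tF_sel)
      then show "fsupp (case z of (x, s) \<Rightarrow> frag_of (x, r * s))" by (cases z) auto
    qed
    then show ?thesis using keys_frag_extend[of "\<lambda>(x, s). frag_of (x, r * s)" x]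
      unfolding tF_sel mem_Collect_eq by (rule order_trans[rotated])
  qed
  show "r \<odot>\<^bsub>tF\<^esub> x \<in> tH" if "x \<in> tH" for r x using tH_smult[OF that] .
  show "r \<odot>\<^bsub>tF\<^esub> (x + y) = r \<odot>\<^bsub>tF\<^esub> x + r \<odot>\<^bsub>tF\<^esub> y" for r x y by (simp add: tF_sel frag_extend_add)
  show "(r \<oplus>\<^bsub>Qp\<^esub> s) \<odot>\<^bsub>tF\<^esub> x - (r \<odot>\<^bsub>tF\<^esub> x + s \<odot>\<^bsub>tF\<^esub> x) \<in> tH" if "x \<in> carrier tF" for r s x
  proof -
    have "fsupp x" using that by (simp add: tF_sel)
    then show ?thesis
    proof (induction x rule: free_abelian_induct)
      case 1
      then show ?case using tH_closed(2) by (simp add: tF_sel)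
    next
      case (2 x y)
      then show ?case using tH_closed(3)[OF 2(3,4)] by (simp add: tF_sel frag_extend_diff algebra_simps)
    next
      case (3 a)
      then obtain m u where a: "a = (m, u)" "m \<in> carrier M" by auto
      show ?case using tensor_add_right[OF a(2), of "r * u" "s * u"]
        by (simp add: tF_sel a(1) distrib_right diff_diff_eq)
    qed
  qed
  have assoc: "(r * s) \<odot>\<^bsub>tF\<^esub> x = r \<odot>\<^bsub>tF\<^esub> (s \<odot>\<^bsub>tF\<^esub> x)" for r s x
    unfolding tF_sel by (induction x rule: frag_induction[OF subset_UNIV]) (auto simp: frag_extend_diff mult.assoc)
  then show "(r \<otimes>\<^bsub>Qp\<^esub> s) \<odot>\<^bsub>tF\<^esub> x - r \<odot>\<^bsub>tF\<^esub> (s \<odot>\<^bsub>tF\<^esub> x) \<in> tH" for r s x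
    using tH_closed(2) by simp
  have one: "1 \<odot>\<^bsub>tF\<^esub> x = x" for x
    unfolding tF_sel by (induction x rule: frag_induction[OF subset_UNIV]) (auto simp: frag_extend_diff)
  then show "\<one>\<^bsub>Qp\<^esub> \<odot>\<^bsub>tF\<^esub> x - x \<in> tH" for x using tH_closed(2) by simp
qed

interpretation T: pre_quotient Qp tF tH by (rule tensor_pre_quotient)

lemma extend_scalars_vectorspace: "vectorspace Qp T.Q"
  using T.module_Q field_from_type_algebra by (auto simp: vectorspace_def)

interpretation V: vectorspace Qp T.Q by (rule extend_scalars_vectorspace)

text \<open>The forms \<phi> i extend to Q_p-linear forms on the tensor product that are dual to the
  elements m j \<otimes> 1, which proves independence with no description of the torsion of M. For
  generation it is enough that M is torsion modulo any submodule containing the m i.\<close>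

lemma Qp_dim_eqI:
  fixes m :: "nat \<Rightarrow> 'm" and \<phi> :: "nat \<Rightarrow> 'm \<Rightarrow> 'p padic_int fract"
  assumes m: "\<And>i. i < d \<Longrightarrow> m i \<in> carrier M"
    and \<phi>_add: "\<And>i x y. i < d \<Longrightarrow> x \<in> carrier M \<Longrightarrow> y \<in> carrier M \<Longrightarrow> \<phi> i (x \<oplus>\<^bsub>M\<^esub> y) = \<phi> i x + \<phi> i y"
    and \<phi>_smult: "\<And>i r x. i < d \<Longrightarrow> x \<in> carrier M \<Longrightarrow> \<phi> i (r \<odot>\<^bsub>M\<^esub> x) = Fract r 1 * \<phi> i x"
    and \<phi>_m: "\<And>i j. i < d \<Longrightarrow> j < d \<Longrightarrow> \<phi> i (m j) = of_bool (i = j)"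
    and span: "\<And>W x. LinearCombinations.submodule Zp W M \<Longrightarrow> (\<And>i. i < d \<Longrightarrow> m i \<in> W) \<Longrightarrow> x \<in> carrier M \<Longrightarrow>
       \<exists>r. r \<noteq> 0 \<and> r \<odot>\<^bsub>M\<^esub> x \<in> W"
  shows "Qp_dim M = d"
proof -
  define E where "E i = coset_of tH (frag_of (m i, 1))" for i
  have E: "E i \<in> carrier T.Q" if "i < d" for i
    unfolding E_def T.carrier_Q by (rule imageI) (use m[OF that] in \<open>simp add: tF_sel\<close>)
  define lin where "lin i \<theta> \<longleftrightarrow> (\<forall>x\<in>carrier T.Q. \<forall>y\<in>carrier T.Q.
       \<theta> (x \<oplus>\<^bsub>T.Q\<^esub> y) = \<theta> x + \<theta> y) \<and>
     (\<forall>t. \<forall>x\<in>carrier T.Q. \<theta> (t \<odot>\<^bsub>T.Q\<^esub> x) = t * \<theta> x) \<and>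
     (\<forall>j<d. \<theta> (E j) = of_bool (i = j))" for i and \<theta> :: "_ \<Rightarrow> 'p padic_int fract"
  have lin: "\<exists>\<theta>. lin i \<theta>" if i: "i < d" for i
  proof -
    \<comment> \<open>The additive group of Q_p as a multiplicative record, the form in which the
      universal property takes it. The map h sends (x, s) to \<phi> i x times s and vanishes on the
      relations.\<close>
    define G :: "'p padic_int fract monoid" where "G = \<lparr>carrier = UNIV, monoid.mult = (+), one = 0\<rparr>"
    have G: "comm_group G"
      by (rule comm_groupI) (auto simp: G_def add_ac intro: exI[of _ "- _"] ab_left_minus)
    interpret G: comm_group G by (rule G)
    obtain h where h: "h \<in> hom (free_Abelian_group tS) G" "\<And>x. x \<in> tS \<Longrightarrow> h (frag_of x) = \<phi> i (fst x) * snd x"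
      using G.free_Abelian_group_universal[of "\<lambda>x. \<phi> i (fst x) * snd x" tS] by (auto simp: G_def)
    have h_add: "h (x + y) = h x + h y" if "fsupp x" "fsupp y" for x y
      using hom_mult[OF h(1), of x y] that by (simp add: G_def)
    have "h (0 + 0) = h 0 + h 0" by (rule h_add) auto
    then have h_0: "h 0 = 0" by (simp only: add_0_left add_cancel_right_right)
    have h_diff: "h (x - y) = h x - h y" if "fsupp x" "fsupp y" for x y
    proof -
      have "fsupp (x - y)" using that keys_diff[of x y] by (meson Un_least order_trans)
      then show ?thesis using h_add[of "x - y" y] that(2) by simp
    qed
    have h_of: "h (frag_of (x, s)) = \<phi> i x * s" if "x \<in> carrier M" for x s
      using h(2)[of "(x, s)"] that by simp
    have h_smult: "h (t \<odot>\<^bsub>tF\<^esub> x) = t * h x" if "fsupp x" for t x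
      using that
    proof (induction x rule: free_abelian_induct)
      case 1
      then show ?case by (simp add: h_0 tF_sel)
    next
      case (2 x y)
      have "fsupp (t \<odot>\<^bsub>tF\<^esub> x)" "fsupp (t \<odot>\<^bsub>tF\<^esub> y)"
        using T.smult_C[of t x] T.smult_C[of t y] 2(1,2) by (simp_all add: tF_sel(1))
      then show ?case using 2 by (simp add: h_diff right_diff_distrib tF_sel(4) frag_extend_diff)
    next
      case (3 a)
      then show ?case by (auto simp: tF_sel h_of)
    qed
    have h_rel: "h r = 0" if "r \<in> tR" for r
    proof -
      have k: "fsupp (frag_of (x, s) - frag_of (y, t))" if "x \<in> carrier M" "y \<in> carrier M" for x y :: 'm and s t :: "'p padic_int fract"
        using keys_diff[of "frag_of (x, s)" "frag_of (y, t)"] that by auto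
      have h3: "h (frag_of (x, s) - frag_of (y, t) - frag_of (z, u)) = \<phi> i x * s - \<phi> i y * t - \<phi> i z * u"
        if "x \<in> carrier M" "y \<in> carrier M" "z \<in> carrier M" for x y z :: 'm and s t u :: "'p padic_int fract"
        using that h_diff[OF k[OF that(1,2), of s t], of "frag_of (z, u)"] h_diff[of "frag_of (x, s)" "frag_of (y, t)"]
        by (simp add: h_of)
      show ?thesis using that unfolding tensor_relations_def
        by (elim UnE CollectE exE conjE; hypsubst)
           (simp_all add: h3 h_diff h_of \<phi>_add[OF i] \<phi>_smult[OF i] distrib_left distrib_right mult_ac)
    qed
    have h_H: "h c = 0" if "c \<in> tH" for c
      using that
    proof (induction c rule: generate.induct)
      case (inv r)
      have "fsupp r" using subsetD[OF tensor_relations_sub inv] by simp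
      then show ?case using h_rel[OF inv] h_diff[of 0 r] by (simp add: h_0)
    next
      case (eng a b)
      then show ?case using h_add[OF tH_closed(1) tH_closed(1)] by simp
    qed (auto simp: h_0 h_rel)
    define \<theta> where "\<theta> C = h (SOME c. c \<in> C)" for C
    have \<theta>: "\<theta> (coset_of tH c) = h c" if "fsupp c" for c
    proof -
      have "c \<in> coset_of tH c" using tH_closed(2) by (simp add: T.coset_of_mem_iff)
      then have "(SOME c'. c' \<in> coset_of tH c) \<in> coset_of tH c" by (rule someI)
      then obtain n where n: "n \<in> tH" "(SOME c'. c' \<in> coset_of tH c) = n + c" by (auto simp: coset_of_def)
      show ?thesis unfolding \<theta>_def n(2) using h_add[OF tH_closed(1)[OF n(1)] that] h_H[OF n(1)] by simp
    qed
    show ?thesis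
      unfolding lin_def
    proof (intro exI[of _ \<theta>] conjI ballI allI impI)
      fix x y assume "x \<in> carrier T.Q" "y \<in> carrier T.Q"
      then obtain a b where ab: "x = coset_of tH a" "y = coset_of tH b" "fsupp a" "fsupp b"
        by (auto simp: T.carrier_Q tF_sel)
      have "fsupp (a + b)" using ab(3,4) keys_add[of a b] by blast
      then show "\<theta> (x \<oplus>\<^bsub>T.Q\<^esub> y) = \<theta> x + \<theta> y"
        unfolding ab(1,2) T.Q_add by (simp only: \<theta> ab(3,4) h_add)
    next
      fix t x assume "x \<in> carrier T.Q"
      then obtain a where a: "x = coset_of tH a" "a \<in> carrier tF" "fsupp a" by (auto simp: T.carrier_Q tF_sel)
      have ta: "fsupp (t \<odot>\<^bsub>tF\<^esub> a)" using T.smult_C[of t a] a(2) by (simp add: tF_sel(1))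
      have "t \<odot>\<^bsub>T.Q\<^esub> x = coset_of tH (t \<odot>\<^bsub>tF\<^esub> a)" unfolding a(1) by (rule T.Q_smult) (use a(2) in auto)
      then show "\<theta> (t \<odot>\<^bsub>T.Q\<^esub> x) = t * \<theta> x" by (simp only: a(1) \<theta> a(3) ta h_smult)
    next
      fix j assume "j < d"
      then show "\<theta> (E j) = of_bool (i = j)"
        unfolding E_def using m[of j] by (subst \<theta>) (auto simp: h_of \<phi>_m i)
    qed
  qed
  then obtain \<theta> where \<theta>: "lin i (\<theta> i)" if "i < d" for i
    using choice[of "\<lambda>i \<theta>. i < d \<longrightarrow> lin i \<theta>"] by blast
  have \<theta>_add: "\<theta> i (x \<oplus>\<^bsub>T.Q\<^esub> y) = \<theta> i x + \<theta> i y"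
    if "i < d" "x \<in> carrier T.Q" "y \<in> carrier T.Q" for i x y
    using \<theta>[OF that(1)] that unfolding lin_def by (elim conjE) (simp only:)
  have \<theta>_smult: "\<theta> i (t \<odot>\<^bsub>T.Q\<^esub> x) = t * \<theta> i x"
    if "i < d" "x \<in> carrier T.Q" for i t x
    using \<theta>[OF that(1)] that unfolding lin_def by (elim conjE) (simp only:)
  have \<theta>_E: "\<theta> i (E j) = of_bool (i = j)" if "i < d" "j < d" for i j
    using \<theta>[OF that(1)] that unfolding lin_def by (elim conjE) (simp only:)
  have inj: "inj_on E {..<d}"
  proof (rule inj_onI)
    fix i j assume "i \<in> {..<d}" "j \<in> {..<d}" "E i = E j"
    then show "i = j" using \<theta>_E[of i i] \<theta>_E[of i j] by (auto split: if_splits)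
  qed
  have EC: "E ` {..<d} \<subseteq> carrier T.Q" using E by auto
  have \<theta>_0: "\<theta> i \<zero>\<^bsub>T.Q\<^esub> = 0" if "i < d" for i
    using \<theta>_add[OF that V.M.zero_closed V.M.zero_closed]
    by (simp only: V.M.l_zero[OF V.M.zero_closed] add_cancel_right_right)
  have \<theta>_lincomb: "\<theta> i (V.lincomb a A) = (\<Sum>v\<in>A. a v * \<theta> i v)"
    if "i < d" "finite A" "A \<subseteq> carrier T.Q" for i a A
    using that(2,3)
  proof (induction A)
    case empty
    then show ?case using \<theta>_0[OF that(1)] by (simp add: V.lincomb_def)
  next
    case (insert v A)
    have "V.lincomb a (A \<union> {v}) = a v \<odot>\<^bsub>T.Q\<^esub> v \<oplus>\<^bsub>T.Q\<^esub> V.lincomb a A"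
      using insert by (intro V.lincomb_insert) auto
    moreover have "V.lincomb a A \<in> carrier T.Q" using insert by (intro V.lincomb_closed) auto
    moreover have "a v \<odot>\<^bsub>T.Q\<^esub> v \<in> carrier T.Q" using insert by (intro V.smult_closed) auto
    ultimately show ?case using insert by (simp add: \<theta>_add[OF that(1)] \<theta>_smult[OF that(1)])
  qed
  have indpt: "V.lin_indpt (E ` {..<d})"
  proof (rule V.finite_lin_indpt2)
    fix a assume a: "V.lincomb a (E ` {..<d}) = \<zero>\<^bsub>T.Q\<^esub>"
    show "\<forall>v\<in>E ` {..<d}. a v = \<zero>\<^bsub>Qp\<^esub>"
    proof
      fix v assume "v \<in> E ` {..<d}"
      then obtain i where i: "i < d" "v = E i" by auto
      have "0 = (\<Sum>v\<in>E ` {..<d}. a v * \<theta> i v)"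
        using \<theta>_lincomb[OF i(1) _ EC, of a] a \<theta>_0[OF i(1)] by simp
      also have "\<dots> = (\<Sum>j<d. a (E j) * \<theta> i (E j))" by (subst sum.reindex[OF inj]) simp
      also have "\<dots> = (\<Sum>j<d. if i = j then a (E j) else 0)" by (intro sum.cong) (auto simp: \<theta>_E i(1))
      also have "\<dots> = a (E i)" using i(1) by (simp add: sum.delta)
      finally show "a v = \<zero>\<^bsub>Qp\<^esub>" using i(2) by simp
    qed
  qed (use EC in auto)
  let ?W = "V.span (E ` {..<d})"
  have W: "LinearCombinations.submodule Qp ?W T.Q" by (rule V.span_is_submodule[OF EC])
  interpret W: LinearCombinations.submodule Qp ?W T.Q by (rule W)
  \<comment> \<open>U collects the x all of whose tensors lie in the span. Since some nonzero
    multiple r x lies in U, the identity x \<otimes> s = r x \<otimes> s/r puts x itself in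
    U.\<close>
  define U where "U = {x \<in> carrier M. \<forall>s. coset_of tH (frag_of (x, s)) \<in> ?W}"
  have U: "LinearCombinations.submodule Zp U M"
  proof (rule LinearCombinations.submodule.intro[OF M])
    show "U \<subseteq> carrier M" by (auto simp: U_def)
    show "v \<oplus>\<^bsub>M\<^esub> w \<in> U" if "v \<in> U" "w \<in> U" for v w
    proof -
      have vw: "v \<in> carrier M" "w \<in> carrier M" using that by (auto simp: U_def)
      have "coset_of tH (frag_of (v \<oplus>\<^bsub>M\<^esub> w, s)) = coset_of tH (frag_of (v, s)) \<oplus>\<^bsub>T.Q\<^esub> coset_of tH (frag_of (w, s))" for s
        using tensor_add_left[OF vw, of s] by (simp add: T.Q_add T.coset_of_eq_iff diff_diff_eq)
      then show ?thesis using that vw W.m_closed by (auto simp: U_def)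
    qed
    have "coset_of tH (frag_of (\<zero>\<^bsub>M\<^esub>, s)) = \<zero>\<^bsub>T.Q\<^esub>" for s
    proof -
      have "0 - (frag_of (\<zero>\<^bsub>M\<^esub> \<oplus>\<^bsub>M\<^esub> \<zero>\<^bsub>M\<^esub>, s) - frag_of (\<zero>\<^bsub>M\<^esub>, s) - frag_of (\<zero>\<^bsub>M\<^esub>, s)) \<in> tH"
        by (rule tH_closed(3)[OF tH_closed(2) tensor_add_left]) auto
      then show ?thesis by (simp add: T.Q_zero T.coset_of_eq_iff)
    qed
    then show "\<zero>\<^bsub>M\<^esub> \<in> U" by (simp add: U_def W.zero_closed)
    show "c \<odot>\<^bsub>M\<^esub> v \<in> U" if "v \<in> U" for c v
    proof -
      have v: "v \<in> carrier M" using that by (auto simp: U_def)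
      have "coset_of tH (frag_of (c \<odot>\<^bsub>M\<^esub> v, s)) = coset_of tH (frag_of (v, Fract c 1 * s))" for s
        using tensor_smult[OF v, of c s] by (simp add: T.coset_of_eq_iff)
      then show ?thesis using that v by (auto simp: U_def)
    qed
  qed
  have mU: "m i \<in> U" if "i < d" for i
  proof -
    have "coset_of tH (frag_of (m i, s)) = s \<odot>\<^bsub>T.Q\<^esub> E i" for s
      unfolding E_def by (subst T.Q_smult) (use m[OF that] in \<open>auto simp: tF_sel\<close>)
    moreover have "E i \<in> ?W" using V.in_own_span[OF EC] that by auto
    ultimately show ?thesis using m[OF that] W.smult_closed by (auto simp: U_def)
  qed
  have all: "coset_of tH (frag_of (x, s)) \<in> ?W" if x: "x \<in> carrier M" for x s
  proof -
    obtain r where r: "r \<noteq> 0" "r \<odot>\<^bsub>M\<^esub> x \<in> U" using span[OF U mU x] by blast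
    have "Fract r 1 * (s / Fract r 1) = s" using r(1) by (simp add: Zero_fract_def eq_fract)
    then have "coset_of tH (frag_of (x, s)) = coset_of tH (frag_of (r \<odot>\<^bsub>M\<^esub> x, s / Fract r 1))"
      using tensor_smult[OF x, of r "s / Fract r 1"] T.coset_of_eq_iff by metis
    then show ?thesis using r(2) by (auto simp: U_def)
  qed
  have gen: "?W = carrier T.Q"
  proof
    show "?W \<subseteq> carrier T.Q" by (rule W.subset)
    have "coset_of tH c \<in> ?W" if "fsupp c" for c
      using that
    proof (induction c rule: free_abelian_induct)
      case 1
      then show ?case using W.zero_closed by (simp add: T.Q_zero)
    next
      case (2 x y)
      have y: "coset_of tH y \<in> carrier T.Q" using 2(2) by (auto simp: T.carrier_Q tF_sel)
      have y': "coset_of tH (- y) \<in> carrier T.Q"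
        unfolding T.carrier_Q by (rule imageI) (use 2(2) in \<open>simp add: tF_sel\<close>)
      have "\<ominus>\<^bsub>T.Q\<^esub> coset_of tH y = coset_of tH (- y)"
        by (rule V.M.minus_equality[OF _ y y']) (simp add: T.Q_add T.Q_zero)
      then have "coset_of tH (- y) = (\<ominus>\<^bsub>Qp\<^esub> \<one>\<^bsub>Qp\<^esub>) \<odot>\<^bsub>T.Q\<^esub> coset_of tH y"
        by (simp only: V.smult_minus_1[OF y])
      then have "coset_of tH (- y) \<in> ?W" using W.smult_closed 2(4) by simp
      moreover have "coset_of tH (x - y) = coset_of tH x \<oplus>\<^bsub>T.Q\<^esub> coset_of tH (- y)" by (simp add: T.Q_add)
      ultimately show ?case using W.m_closed[OF 2(3)] by simp
    next
      case (3 a)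
      then show ?case using all by auto
    qed
    then show "carrier T.Q \<subseteq> ?W" by (auto simp: T.carrier_Q tF_sel)
  qed
  have "V.basis (E ` {..<d})" unfolding V.basis_def using indpt gen EC by blast
  then have "V.dim = card (E ` {..<d})" by (intro V.dim_basis) auto
  also have "\<dots> = d" by (simp add: card_image[OF inj])
  finally show ?thesis by (simp add: Qp_dim_def extend_scalars_def)
qed

end

section \<open>The level modules over the $p$-adic integers\<close>

abbreviation plane :: "('p :: prime_card padic_int, 'p iwasawa ^ 2) module" where
  "plane \<equiv> restrict_scalars fps_const Lambda2"

abbreviation plane_mod :: "('p :: prime_card iwasawa ^ 2) set \<Rightarrow> ('p padic_int, ('p iwasawa ^ 2) set) module" where
  "plane_mod N \<equiv> quotient_module plane N"

lemma level_module_eq: "level_module A n = plane_mod (level_submodule A n)"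
  by (simp add: level_module_def restrict_scalars_def quotient_module_def A_RCOSETS_def' a_r_coset_def'
      set_add_def' Lambda2_def fun_eq_iff)

abbreviation Zp_submodule :: "'m set \<Rightarrow> ('p :: prime_card padic_int, 'm) module \<Rightarrow> bool" where
  "Zp_submodule H M \<equiv> LinearCombinations.submodule Zp H M"

text \<open>The chains in \<open>module_length\<close> consist of Z_p-submodules, which need not be
  stable under X; \<open>lsub\<close> would be too narrow for them.\<close>

definition zsub :: "('p :: prime_card iwasawa ^ 2) set \<Rightarrow> bool" where
  "zsub N \<longleftrightarrow> 0 \<in> N \<and> (\<forall>x\<in>N. \<forall>y\<in>N. x + y \<in> N) \<and> (\<forall>x\<in>N. \<forall>c. fps_const c *s x \<in> N)"

lemma lsub_zsub: "lsub N \<Longrightarrow> zsub N"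
  by (simp add: lsub_def zsub_def)

lemma zsub_0: "zsub N \<Longrightarrow> 0 \<in> N" by (simp add: zsub_def)
lemma zsub_add: "zsub N \<Longrightarrow> x \<in> N \<Longrightarrow> y \<in> N \<Longrightarrow> x + y \<in> N" by (simp add: zsub_def)
lemma zsub_scale: "zsub N \<Longrightarrow> x \<in> N \<Longrightarrow> fps_const c *s x \<in> N" by (simp add: zsub_def)
lemma zsub_scale_nat: "zsub N \<Longrightarrow> x \<in> N \<Longrightarrow> of_nat j *s x \<in> N"
  using zsub_scale[of N x "of_nat j"] by (simp only: fps_of_nat)
lemma zsub_scale_PP: "zsub N \<Longrightarrow> x \<in> N \<Longrightarrow> PP ^ k *s x \<in> N"
  unfolding PP_power_const by (rule zsub_scale)
lemma zsub_uminus: "zsub N \<Longrightarrow> x \<in> N \<Longrightarrow> - x \<in> N"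
  using zsub_scale[of N x "-1"] by (simp add: vec_eq_iff vector_sneg_minus1[of x] fps_const_neg[symmetric] del: fps_const_neg)
lemma zsub_diff: "zsub N \<Longrightarrow> x \<in> N \<Longrightarrow> y \<in> N \<Longrightarrow> x - y \<in> N"
  using zsub_add[of N x "- y"] zsub_uminus[of N y] by simp
lemma zsub_sum: "zsub N \<Longrightarrow> (\<And>i. i \<in> I \<Longrightarrow> f i \<in> N) \<Longrightarrow> sum f I \<in> N"
  by (induction I rule: infinite_finite_induct) (auto simp: zsub_0 zsub_add)

lemma plane_sel: "carrier plane = UNIV" "add plane = (+)" "ring.zero plane = 0"
  "r \<odot>\<^bsub>plane\<^esub> x = fps_const r *s x"
  by (simp_all add: restrict_scalars_def Lambda2_def)

lemma plane_pre_quotient: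
  assumes "zsub N"
  shows "pre_quotient Zp plane N"
proof (rule pre_quotient.intro)
  show "cring (Zp :: 'a padic_int ring)" by (rule cring_from_type_algebra)
qed (use assms in \<open>auto simp: plane_sel zsub_0 zsub_diff zsub_scale vector_add_ldistrib vector_smult_assoc
       vector_sadd_rdistrib[symmetric]\<close>)

context
  fixes N :: "('p :: prime_card iwasawa ^ 2) set"
  assumes N: "zsub N"
begin

interpretation L: pre_quotient Zp plane N by (rule plane_pre_quotient[OF N])

lemma plane_mod_module: "Module.module Zp (plane_mod N)" by (rule L.module_Q)

lemma plane_mod_carrier: "carrier (plane_mod N) = range (coset_of N)"
  by (simp add: L.carrier_Q plane_sel)

lemma plane_mod_add: "coset_of N x \<oplus>\<^bsub>plane_mod N\<^esub> coset_of N y = coset_of N (x + y)"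
  by (rule L.Q_add)

lemma plane_mod_zero: "\<zero>\<^bsub>plane_mod N\<^esub> = coset_of N 0"
  by (rule L.Q_zero)

lemma plane_mod_smult: "c \<odot>\<^bsub>plane_mod N\<^esub> coset_of N x = coset_of N (fps_const c *s x)"
  using L.Q_smult[of c x] by (simp add: plane_sel)

lemma plane_coset_eq_iff: "coset_of N x = coset_of N y \<longleftrightarrow> x - y \<in> N"
  by (rule L.coset_of_eq_iff)

lemma plane_coset_mem_iff: "y \<in> coset_of N x \<longleftrightarrow> y - x \<in> N"
  by (rule L.coset_of_mem_iff)

lemma submodule_coset_image:
  assumes P: "zsub P"
  shows "Zp_submodule (coset_of N ` P) (plane_mod N)"
  using P by (intro LinearCombinations.submodule.intro plane_mod_module)
    (auto simp: plane_mod_carrier plane_mod_add plane_mod_zero plane_mod_smult intro!: imageI zsub_add zsub_scale zsub_0)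

lemma submodule_preimage:
  assumes H: "Zp_submodule H (plane_mod N)"
  shows "zsub {x. coset_of N x \<in> H}" "N \<subseteq> {x. coset_of N x \<in> H}" "H = coset_of N ` {x. coset_of N x \<in> H}"
proof -
  interpret H: LinearCombinations.submodule Zp H "plane_mod N" by (rule H)
  show "zsub {x. coset_of N x \<in> H}"
    unfolding zsub_def
  proof (intro conjI ballI allI)
    show "0 \<in> {x. coset_of N x \<in> H}" using H.zero_closed by (simp add: plane_mod_zero)
    show "x + y \<in> {x. coset_of N x \<in> H}" if "x \<in> {x. coset_of N x \<in> H}" "y \<in> {x. coset_of N x \<in> H}" for x y
      using H.m_closed[of "coset_of N x" "coset_of N y"] that by (simp add: plane_mod_add)
    show "fps_const c *s x \<in> {x. coset_of N x \<in> H}" if "x \<in> {x. coset_of N x \<in> H}" for x c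
      using H.smult_closed[of c "coset_of N x"] that by (simp add: plane_mod_smult)
  qed
  show "N \<subseteq> {x. coset_of N x \<in> H}"
  proof
    fix x assume "x \<in> N"
    then have "coset_of N x = coset_of N 0" by (simp add: plane_coset_eq_iff)
    then show "x \<in> {x. coset_of N x \<in> H}" using H.zero_closed by (simp add: plane_mod_zero)
  qed
  show "H = coset_of N ` {x. coset_of N x \<in> H}"
    using H.subset by (auto simp: plane_mod_carrier)
qed

section \<open>Counting cosets and the length of P/N\<close>

lemma of_nat_smult_mem:
  fixes P :: "('p iwasawa ^ 2) set"
  assumes P: "zsub P" and j: "0 < j" "j < CARD('p)" and y: "of_nat j *s y \<in> P"
  shows "y \<in> P"
proof -
  have "\<not> CARD('p) dvd j" using j by (auto dest: dvd_imp_le)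
  then have "(of_nat j :: 'p padic_int) dvd 1" using padic_unit_iff pp_dvd_of_nat_iff by blast
  then obtain u where u: "1 = of_nat j * (u :: 'p padic_int)" by (rule dvdE)
  have "fps_const u *s (of_nat j *s y) = fps_const (of_nat j * u) *s y"
    by (simp add: vector_smult_assoc mult.commute flip: fps_of_nat fps_const_mult)
  also have "\<dots> = y" by (simp flip: u)
  finally show ?thesis using zsub_scale[OF P y, of u] by simp
qed

text \<open>The translates of P by 0, y, ..., (p - 1) y are disjoint: otherwise P would contain j y
  for some 0 < j < p, and j is a unit of Z_p. Only the count matters, and the union of the
  translates need not be a submodule.\<close>

lemma card_coset_step:
  assumes P: "zsub P" and NP: "N \<subseteq> P" and y: "y \<notin> P"
  shows "card (coset_of N ` p_cosets P y) = CARD('p) * card (coset_of N ` P)"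
    and "finite (coset_of N ` P) \<Longrightarrow> finite (coset_of N ` p_cosets P y)"
proof -
  define f where "f = (\<lambda>(C, j :: nat). (\<lambda>z. z + of_nat j *s y) ` C)"
  have f: "f (coset_of N x, j) = coset_of N (x + of_nat j *s y)" for x j
    by (simp add: f_def coset_of_def image_image add.assoc)
  have img: "coset_of N ` p_cosets P y = f ` (coset_of N ` P \<times> {..<CARD('p)})"
  proof (intro equalityI subsetI)
    fix C assume "C \<in> coset_of N ` p_cosets P y"
    then obtain x j where "C = coset_of N (x + of_nat j *s y)" "x \<in> P" "j < CARD('p)" by blast
    then have "C = f (coset_of N x, j)" "(coset_of N x, j) \<in> coset_of N ` P \<times> {..<CARD('p)}" by (simp_all add: f)
    then show "C \<in> f ` (coset_of N ` P \<times> {..<CARD('p)})" by (rule image_eqI)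
  next
    fix C assume "C \<in> f ` (coset_of N ` P \<times> {..<CARD('p)})"
    then obtain x j where "C = f (coset_of N x, j)" "x \<in> P" "j < CARD('p)" by blast
    then show "C \<in> coset_of N ` p_cosets P y"
      unfolding f by blast
  qed
  have key: "\<not> j < j'" if "x \<in> P" "x' \<in> P" "j' < CARD('p)" "(x + of_nat j *s y) - (x' + of_nat j' *s y) \<in> N" for x x' j j'
  proof
    assume jj: "j < j'"
    have "(of_nat j' :: 'p iwasawa) = of_nat (j' - j) + of_nat j" using jj by (simp flip: of_nat_add)
    then have "of_nat (j' - j) *s y = (x - x') - ((x + of_nat j *s y) - (x' + of_nat j' *s y))"
      by (simp add: vec2_eq algebra_simps)
    also have "\<dots> \<in> P" by (rule zsub_diff[OF P zsub_diff[OF P that(1,2)]]) (use that(4) NP in blast)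
    finally have "y \<in> P" using of_nat_smult_mem[OF P, of "j' - j" y] jj that(3) by simp
    then show False using y by blast
  qed
  have inj: "inj_on f (coset_of N ` P \<times> {..<CARD('p)})"
  proof (rule inj_onI)
    fix a b assume "a \<in> coset_of N ` P \<times> {..<CARD('p)}" "b \<in> coset_of N ` P \<times> {..<CARD('p)}" and fab: "f a = f b"
    then obtain x x' j j' where ab: "a = (coset_of N x, j)" "b = (coset_of N x', j')"
      and x: "x \<in> P" "x' \<in> P" "j < CARD('p)" "j' < CARD('p)" by blast
    from fab have d: "(x + of_nat j *s y) - (x' + of_nat j' *s y) \<in> N" by (simp only: ab f plane_coset_eq_iff)
    then have d': "(x' + of_nat j' *s y) - (x + of_nat j *s y) \<in> N" using zsub_uminus[OF N d] by simp
    have "j = j'" using key[OF x(1,2,4) d] key[OF x(2,1,3) d'] by simp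
    then show "a = b" using d by (simp add: ab plane_coset_eq_iff)
  qed
  show "card (coset_of N ` p_cosets P y) = CARD('p) * card (coset_of N ` P)"
    unfolding img by (simp add: card_image[OF inj] card_cartesian_product mult.commute)
  show "finite (coset_of N ` P) \<Longrightarrow> finite (coset_of N ` p_cosets P y)"
    unfolding img by simp
qed

lemma card_coset_strict:
  assumes P: "zsub P" and P': "zsub P'" and NP: "N \<subseteq> P" and PP': "P \<subset> P'" and fin: "finite (coset_of N ` P')"
  shows "CARD('p) * card (coset_of N ` P) \<le> card (coset_of N ` P')"
proof -
  obtain y where y: "y \<in> P'" "y \<notin> P" using PP' by blast
  have "p_cosets P y \<subseteq> P'"
    using PP' y(1) P' by (blast intro: zsub_add zsub_scale_nat)
  then have "card (coset_of N ` p_cosets P y) \<le> card (coset_of N ` P')"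
    by (intro card_mono fin image_mono)
  then show ?thesis using card_coset_step(1)[OF P NP y(2)] by simp
qed

lemma card_coset_relpowp:
  assumes "(pstep ^^ k) N P"
  shows "finite (coset_of N ` P) \<and> card (coset_of N ` P) = CARD('p) ^ k"
  using assms
proof (induction k arbitrary: P)
  case 0
  have "coset_of N ` N = (\<lambda>_. coset_of N 0) ` N"
    by (rule image_cong[OF refl]) (simp add: plane_coset_eq_iff)
  also have "\<dots> = {coset_of N 0}" using zsub_0[OF N] by (rule image_constant)
  finally show ?case using 0 by auto
next
  case (Suc k)
  obtain Q where Q: "(pstep ^^ k) N Q" "pstep Q P" using Suc.prems by (rule relpowp_Suc_E)
  obtain y where y: "lsub Q" "y \<notin> Q" "P = p_cosets Q y"
    using Q(2) by (auto simp: pstep_def)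
  show ?case
    using card_coset_step[OF lsub_zsub[OF y(1)] relpowp_pstep_mono[OF Q(1)] y(2)] Suc.IH[OF Q(1)]
    unfolding y(3) by simp
qed

lemma submodule_plane_mod_restrict:
  assumes P: "zsub P" and QP: "Q \<subseteq> P"
  shows "Zp_submodule (coset_of N ` Q) (plane_mod N\<lparr>carrier := coset_of N ` P\<rparr>) \<longleftrightarrow>
    Zp_submodule (coset_of N ` Q) (plane_mod N)"
proof -
  have "Module.module Zp (plane_mod N\<lparr>carrier := coset_of N ` P\<rparr>)"
    using Module.module.axioms(1) LinearCombinations.module.submodule_is_module[OF plane_mod_module submodule_coset_image[OF P]]
    by blast
  then show ?thesis
    using QP plane_mod_module unfolding LinearCombinations.submodule_def by (auto simp: plane_mod_carrier)
qed

text \<open>The given chain bounds the length from below. For the upper bound, P/N has p^k elements,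
  while every strict inclusion in a chain of submodules multiplies the order by at least p.\<close>

lemma module_length_plane_mod:
  assumes k: "(pstep ^^ k) N P" and P: "lsub P" and NP: "lsub N"
  shows "module_length Zp (plane_mod N\<lparr>carrier := coset_of N ` P\<rparr>) = enat k"
proof -
  let ?K = "plane_mod N\<lparr>carrier := coset_of N ` P\<rparr>"
  let ?S = "{k. \<exists>H. (\<forall>i\<le>k. Zp_submodule (H i) ?K) \<and> (\<forall>i<k. H i \<subset> H (Suc i))}"
  have fin: "finite (coset_of N ` P)" and card: "card (coset_of N ` P) = CARD('p) ^ k"
    using card_coset_relpowp[OF k] by auto
  have "l \<le> k" if l: "l \<in> ?S" for l
  proof -
    obtain H where H: "\<And>i. i \<le> l \<Longrightarrow> Zp_submodule (H i) ?K" "\<And>i. i < l \<Longrightarrow> H i \<subset> H (Suc i)"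
      using l by blast
    have HP: "H i \<subseteq> coset_of N ` P" if "i \<le> l" for i
      using LinearCombinations.submodule.subset[OF H(1)[OF that]] by simp
    have Hsub: "Zp_submodule (H i) (plane_mod N)" if "i \<le> l" for i
      using H(1)[OF that] HP[OF that] plane_mod_module unfolding LinearCombinations.submodule_def by (auto simp: plane_mod_carrier)
    define R where "R i = {x. coset_of N x \<in> H i}" for i
    have R: "zsub (R i)" "N \<subseteq> R i" "H i = coset_of N ` R i" if "i \<le> l" for i
      using submodule_preimage[OF Hsub[OF that]] by (auto simp only: R_def)
    have "CARD('p) ^ i \<le> card (H i)" if "i \<le> l" for i
      using that
    proof (induction i)
      case 0
      have "finite (H 0)" using HP[of 0] fin finite_subset by blast
      moreover have "H 0 \<noteq> {}" using R[of 0] zsub_0 by blast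
      ultimately show ?case by (simp add: Suc_le_eq card_gt_0_iff)
    next
      case (Suc i)
      have i: "i \<le> l" "i < l" using Suc.prems by auto
      have "R i \<subset> R (Suc i)"
      proof
        show "R i \<subseteq> R (Suc i)" using H(2)[OF i(2)] by (auto simp: R_def)
        show "R i \<noteq> R (Suc i)" using H(2)[OF i(2)] R(3)[OF i(1)] R(3)[OF Suc.prems] by auto
      qed
      moreover have "finite (coset_of N ` R (Suc i))"
        using HP[OF Suc.prems] fin R(3)[OF Suc.prems] finite_subset by metis
      ultimately have "CARD('p) * card (H i) \<le> card (H (Suc i))"
        using card_coset_strict[OF R(1)[OF i(1)] R(1)[OF Suc.prems] R(2)[OF i(1)]]
          R(3)[OF i(1)] R(3)[OF Suc.prems] by simp
      moreover have "CARD('p) ^ Suc i \<le> CARD('p) * card (H i)" using Suc.IH i by simp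
      ultimately show ?case by (rule order_trans[rotated])
    qed
    then have "CARD('p) ^ l \<le> card (H l)" by simp
    also have "\<dots> \<le> CARD('p) ^ k" using card_mono[OF fin HP[of l]] card by simp
    finally show ?thesis using prime_gt_1_nat[OF prime_card[where 'a='p]] by simp
  qed
  moreover have "k \<in> ?S"
  proof -
    obtain F where F: "F 0 = N" "F k = P" "\<And>i. i < k \<Longrightarrow> pstep (F i) (F (Suc i))"
      using k by (auto simp: relpowp_fun_conv)
    have lF: "lsub (F i)" if "i \<le> k" for i
    proof (cases "i = k")
      case True
      then show ?thesis using F(2) P by simp
    next
      case False
      then show ?thesis using F(3)[of i] that by (simp add: pstep_def)
    qed
    have mono: "F i \<subseteq> F j" if "i \<le> j" "j \<le> k" for i j
      using that
    proof (induction j rule: dec_induct)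
      case (step j)
      then have "F j \<subseteq> F (Suc j)" by (intro pstep_mono F(3)) simp
      then show ?case using step by auto
    qed simp
    have "Zp_submodule (coset_of N ` F i) ?K" if "i \<le> k" for i
      using submodule_plane_mod_restrict[OF lsub_zsub[OF P] mono[OF that order_refl, unfolded F(2)]]
        submodule_coset_image[OF lsub_zsub[OF lF[OF that]]] by blast
    moreover have "coset_of N ` F i \<subset> coset_of N ` F (Suc i)" if ik: "i < k" for i
    proof
      show "coset_of N ` F i \<subseteq> coset_of N ` F (Suc i)" using mono[of i "Suc i"] ik by (intro image_mono) simp
      obtain y where y: "y \<in> F (Suc i)" "y \<notin> F i" using F(3)[OF ik] by (auto simp: pstep_def)
      have "coset_of N y \<notin> coset_of N ` F i"
      proof
        assume "coset_of N y \<in> coset_of N ` F i"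
        then obtain x where x: "x \<in> F i" "y - x \<in> N" by (auto simp: plane_coset_eq_iff)
        have "y - x \<in> F i" using x(2) mono[of 0 i] F(1) ik by auto
        then have "y - x + x \<in> F i" by (rule lsub_add[OF lF[OF less_imp_le[OF ik]] _ x(1)])
        then show False using y(2) by simp
      qed
      then show "coset_of N ` F i \<noteq> coset_of N ` F (Suc i)" using y(1) by blast
    qed
    ultimately show ?thesis by (intro CollectI exI[of _ "\<lambda>i. coset_of N ` F i"]) blast
  qed
  ultimately show ?thesis
    unfolding module_length_def by (intro antisym SUP_least SUP_upper) (auto simp del: mem_Collect_eq)
qed

text \<open>If p^k v agrees with the combination of the e i with coefficients c i modulo N, the i-th
  coordinate of v is c i / p^k. Independence of the e i makes this fraction independent of k, of c
  and of the representative v.\<close>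

lemma Qp_dim_plane_mod:
  assumes "has_rank N UNIV d"
  shows "Qp_dim (plane_mod N) = d"
proof -
  obtain e :: "nat \<Rightarrow> 'p iwasawa ^ 2" where e0: "\<And>i. i < d \<Longrightarrow> e i \<in> UNIV"
    "\<And>c. (zcomb d c e) \<in> N \<Longrightarrow> (\<forall>i<d. c i = 0)"
    "\<And>x. x \<in> UNIV \<Longrightarrow> \<exists>k c. PP ^ k *s x - (zcomb d c e) \<in> N"
    using assms by (rule has_rankE) (rule that)
  note indep = e0(2) and span = e0(3)[OF UNIV_I]
  define wit where "wit v k c \<longleftrightarrow> PP ^ k *s v - (zcomb d c e) \<in> N" for v k and c :: "nat \<Rightarrow> 'p padic_int"
  have ppk: "(pp :: 'p padic_int) ^ k \<noteq> 0" for k using pp_nonzero[where 'p='p] by simp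
  have uniq: "Fract (c i) (pp ^ k) = Fract (c' i) (pp ^ l)" if "wit v k c" "wit v' l c'" "v - v' \<in> N" "i < d" for v v' k l c c' i
  proof -
    have eq: "(\<Sum>i<d. fps_const (pp ^ k * c' i - pp ^ l * c i) *s e i) =
        PP ^ l *s (PP ^ k *s v - (zcomb d c e)) - PP ^ k *s (PP ^ l *s v' - (zcomb d c' e))
        - PP ^ (k + l) *s (v - v')"
    proof -
      have "(\<Sum>i<d. fps_const (pp ^ k * c' i - pp ^ l * c i) *s e i) =
          PP ^ k *s (zcomb d c' e) - PP ^ l *s (zcomb d c e)"
        unfolding scale_sum PP_power_const sum_subtractf[symmetric]
        by (intro sum.cong refl) (simp add: vec2_eq algebra_simps flip: fps_const_sub fps_const_mult)
      then show ?thesis by (simp add: vec2_eq algebra_simps power_add)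
    qed
    have "(\<Sum>i<d. fps_const (pp ^ k * c' i - pp ^ l * c i) *s e i) \<in> N"
      unfolding eq using that(1-3) unfolding wit_def
      by (rule_tac zsub_diff[OF N zsub_diff[OF N zsub_scale_PP[OF N] zsub_scale_PP[OF N]] zsub_scale_PP[OF N]])
    then have "pp ^ k * c' i - pp ^ l * c i = 0" using indep[of "\<lambda>i. pp ^ k * c' i - pp ^ l * c i"] that(4) by blast
    then show ?thesis using ppk by (simp add: eq_fract algebra_simps)
  qed
  define \<phi> where "\<phi> i C = (THE q. \<exists>v k c. v \<in> C \<and> wit v k c \<and> q = Fract (c i) (pp ^ k))" for i C
  have \<phi>: "\<phi> i (coset_of N v) = Fract (c i) (pp ^ k)" if w: "wit v k c" and i: "i < d" for i v k c
    unfolding \<phi>_def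
  proof (rule the_equality)
    have "v \<in> coset_of N v" using zsub_0[OF N] by (simp add: plane_coset_mem_iff)
    then show "\<exists>v' k' c'. v' \<in> coset_of N v \<and> wit v' k' c' \<and> Fract (c i) (pp ^ k) = Fract (c' i) (pp ^ k')"
      using w by blast
    fix q assume "\<exists>v' k' c'. v' \<in> coset_of N v \<and> wit v' k' c' \<and> q = Fract (c' i) (pp ^ k')"
    then obtain v' k' c' where w': "v' - v \<in> N" "wit v' k' c'" "q = Fract (c' i) (pp ^ k')"
      by (auto simp: plane_coset_mem_iff)
    then show "q = Fract (c i) (pp ^ k)" using uniq[OF w'(2) w w'(1) i] by simp
  qed
  show ?thesis
  proof (rule Qp_dim_eqI[OF plane_mod_module, where m = "\<lambda>i. coset_of N (e i)" and \<phi> = \<phi>])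
    show "coset_of N (e i) \<in> carrier (plane_mod N)" for i by (simp add: plane_mod_carrier)
  next
    fix i V W assume i: "i < d" and "V \<in> carrier (plane_mod N)" "W \<in> carrier (plane_mod N)"
    then obtain v w where vw: "V = coset_of N v" "W = coset_of N w" by (auto simp: plane_mod_carrier)
    obtain k c l c' where kl: "wit v k c" "wit w l c'" using span[of v] span[of w] unfolding wit_def by blast
    have "PP ^ (k + l) *s (v + w) - (\<Sum>i<d. fps_const (c i * pp ^ l + c' i * pp ^ k) *s e i) =
        PP ^ l *s (PP ^ k *s v - (zcomb d c e)) + PP ^ k *s (PP ^ l *s w - (zcomb d c' e))"
    proof -
      have "(\<Sum>i<d. fps_const (c i * pp ^ l + c' i * pp ^ k) *s e i) =
          PP ^ l *s (zcomb d c e) + PP ^ k *s (zcomb d c' e)"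
        unfolding scale_sum PP_power_const sum.distrib[symmetric]
        by (intro sum.cong refl) (simp add: vec2_eq algebra_simps flip: fps_const_add fps_const_mult)
      then show ?thesis by (simp add: vec2_eq algebra_simps power_add)
    qed
    also have "\<dots> \<in> N" using kl unfolding wit_def PP_power_const by (intro zsub_add[OF N] zsub_scale[OF N])
    finally have "wit (v + w) (k + l) (\<lambda>i. c i * pp ^ l + c' i * pp ^ k)" by (simp add: wit_def)
    from \<phi>[OF this i] show "\<phi> i (V \<oplus>\<^bsub>plane_mod N\<^esub> W) = \<phi> i V + \<phi> i W"
      using ppk by (simp add: vw plane_mod_add \<phi>[OF kl(1) i] \<phi>[OF kl(2) i] power_add)
  next
    fix i r V assume i: "i < d" and "V \<in> carrier (plane_mod N)"
    then obtain v where v: "V = coset_of N v" by (auto simp: plane_mod_carrier)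
    obtain k c where kc: "wit v k c" using span[of v] unfolding wit_def by blast
    have "PP ^ k *s (fps_const r *s v) - (\<Sum>i<d. fps_const (r * c i) *s e i) =
        fps_const r *s (PP ^ k *s v - (zcomb d c e))"
    proof -
      have "(\<Sum>i<d. fps_const (r * c i) *s e i) = fps_const r *s (zcomb d c e)"
        by (simp add: scale_sum vector_smult_assoc flip: fps_const_mult)
      then show ?thesis by (simp add: vec2_eq algebra_simps)
    qed
    also have "\<dots> \<in> N" using kc unfolding wit_def by (intro zsub_scale[OF N])
    finally have "wit (fps_const r *s v) k (\<lambda>i. r * c i)" by (simp add: wit_def)
    from \<phi>[OF this i] show "\<phi> i (r \<odot>\<^bsub>plane_mod N\<^esub> V) = Fract r 1 * \<phi> i V"
      by (simp add: v plane_mod_smult \<phi>[OF kc i])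
  next
    fix i j assume ij: "i < d" "j < d"
    have "(\<Sum>i<d. fps_const (of_bool (i = j)) *s e i) = (\<Sum>i<d. if j = i then e i else 0)"
      by (intro sum.cong) auto
    then have "wit (e j) 0 (\<lambda>i. of_bool (i = j))" using ij zsub_0[OF N] by (simp add: wit_def sum.delta)
    from \<phi>[OF this ij(1)] show "\<phi> i (coset_of N (e j)) = of_bool (i = j)"
      by (simp add: Zero_fract_def One_fract_def)
  next
    fix W V assume W: "Zp_submodule W (plane_mod N)" and eW: "\<And>i. i < d \<Longrightarrow> coset_of N (e i) \<in> W"
      and "V \<in> carrier (plane_mod N)"
    then obtain v where v: "V = coset_of N v" by (auto simp: plane_mod_carrier)
    obtain k c where kc: "wit v k c" using span[of v] unfolding wit_def by blast
    have Z: "zsub {x. coset_of N x \<in> W}" by (rule submodule_preimage[OF W])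
    have "(zcomb d c e) \<in> {x. coset_of N x \<in> W}"
      by (rule zsub_sum[OF Z], rule zsub_scale[OF Z]) (simp add: eW)
    moreover have "coset_of N (PP ^ k *s v) = coset_of N (zcomb d c e)"
      using kc by (simp add: plane_coset_eq_iff wit_def)
    ultimately have "pp ^ k \<odot>\<^bsub>plane_mod N\<^esub> V \<in> W" by (simp add: v plane_mod_smult PP_power_const)
    then show "\<exists>r. r \<noteq> 0 \<and> r \<odot>\<^bsub>plane_mod N\<^esub> V \<in> W" using ppk by blast
  qed
qed

text \<open>Weierstrass division by w reduces each coordinate to degree below q, so the classes of
  X^i times the unit vectors, i < q, generate.\<close>

lemma finitely_generated_plane_mod:
  assumes w: "w = fps_X ^ q + PP * Q" "\<And>v. w *s v \<in> N"
  shows "finitely_generated_module Zp (plane_mod N)"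
proof -
  interpret V: Module.module Zp "plane_mod N" by (rule plane_mod_module)
  define S where "S = (\<lambda>(i, j :: 2). coset_of N (fps_X ^ i *s axis j 1)) ` ({..<q} \<times> UNIV)"
  have S: "finite S" "S \<subseteq> carrier (plane_mod N)" by (auto simp: S_def plane_mod_carrier)
  have sp: "Zp_submodule (V.span S) (plane_mod N)" by (rule V.span_is_submodule[OF S(2)])
  have Z: "zsub {x. coset_of N x \<in> V.span S}" and NZ: "N \<subseteq> {x. coset_of N x \<in> V.span S}"
    by (fact submodule_preimage[OF sp])+
  have ax: "f *s axis j 1 \<in> {x. coset_of N x \<in> V.span S}" for f and j :: 2
  proof -
    obtain g r where gr: "f = g * (fps_X ^ q + PP * Q) + r" "\<And>i. i \<ge> q \<Longrightarrow> fps_nth r i = 0"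
      using weierstrass_division by blast
    have r: "r = (\<Sum>i<q. fps_const (fps_nth r i) * fps_X ^ i)"
      by (rule fps_eq_sum_const_X_power[OF gr(2)])
    have "f *s axis j 1 = w *s (g *s axis j 1) + r *s axis j 1"
      by (simp add: gr(1) w(1) vec_eq_iff algebra_simps)
    also have "r *s axis j 1 = (\<Sum>i<q. fps_const (fps_nth r i) *s (fps_X ^ i *s axis j 1))"
    proof -
      have "(\<Sum>i<q. fps_const (fps_nth r i) * fps_X ^ i) *s axis j 1 = (\<Sum>i<q. fps_const (fps_nth r i) *s (fps_X ^ i *s (axis j 1 :: 'p iwasawa ^ 2)))"
        by (simp add: vec_eq_iff sum_distrib_right mult.assoc)
      then show ?thesis using r by simp
    qed
    finally have eq: "f *s axis j 1 = w *s (g *s axis j 1) + (\<Sum>i<q. fps_const (fps_nth r i) *s (fps_X ^ i *s axis j 1))" .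
    have "fps_X ^ i *s axis j 1 \<in> {x. coset_of N x \<in> V.span S}" if "i < q" for i
      using V.in_own_span[OF S(2)] that by (auto simp: S_def)
    then have "(\<Sum>i<q. fps_const (fps_nth r i) *s (fps_X ^ i *s axis j 1)) \<in> {x. coset_of N x \<in> V.span S}"
      by (intro zsub_sum[OF Z] zsub_scale[OF Z]) auto
    then show ?thesis unfolding eq by (rule zsub_add[OF Z subsetD[OF NZ w(2)]])
  qed
  have "v \<in> {x. coset_of N x \<in> V.span S}" for v
  proof -
    have "v = v $ 1 *s axis 1 1 + v $ 2 *s axis 2 1" by (simp add: vec2_eq axis_def)
    then show ?thesis using zsub_add[OF Z ax ax] by metis
  qed
  then have "V.span S = carrier (plane_mod N)"
    using LinearCombinations.submodule.subset[OF sp] by (auto simp: plane_mod_carrier)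
  then show ?thesis using S unfolding finitely_generated_module_def by blast
qed

end

section \<open>Kernel and cokernel of the projection\<close>

lemma mod_hom_plane_mod:
  assumes N: "zsub N" and N': "zsub N'" and f: "\<And>v. f (coset_of N v) = coset_of N' v"
  shows "mod_hom Zp (plane_mod N) (plane_mod N') f"
proof (rule mod_hom.intro[OF plane_mod_module[OF N] plane_mod_module[OF N']])
  show "mod_hom_axioms Zp (plane_mod N) (plane_mod N') f"
    by (rule mod_hom_axioms.intro)
       (auto simp: module_hom_def plane_mod_carrier N N' plane_mod_add plane_mod_smult f)
qed

lemma ker_plane_mod:
  assumes N: "zsub N" and N': "zsub N'" and f: "\<And>v. f (coset_of N v) = coset_of N' v"
  shows "ker_module (plane_mod N) (plane_mod N') f = plane_mod N\<lparr>carrier := coset_of N ` N'\<rparr>"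
proof -
  have "a_kernel (plane_mod N) (plane_mod N') f = coset_of N ` N'"
  proof -
    have "f (coset_of N v) = \<zero>\<^bsub>plane_mod N'\<^esub> \<longleftrightarrow> v \<in> N'" for v
      by (simp add: f plane_mod_zero[OF N'] plane_coset_eq_iff[OF N'])
    then show ?thesis unfolding a_kernel_def' plane_mod_carrier[OF N] by blast
  qed
  then show ?thesis by (simp add: ker_module_def)
qed

lemma carrier_quotient_module: "carrier (quotient_module M N) = (\<Union>a\<in>carrier M. {N +>\<^bsub>M\<^esub> a})"
  by (simp add: quotient_module_def A_RCOSETS_def')

lemma coker_plane_mod:
  assumes N: "zsub N" and N': "zsub N'" and f: "\<And>v. f (coset_of N v) = coset_of N' v"
  shows "finite (carrier (coker_module (plane_mod N) (plane_mod N') f))"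
    "module_length Zp (coker_module (plane_mod N) (plane_mod N') f) = 0"
proof -
  interpret V: Module.module Zp "plane_mod N'" by (rule plane_mod_module[OF N'])
  let ?C = "coker_module (plane_mod N) (plane_mod N') f"
  have img: "f ` carrier (plane_mod N) = carrier (plane_mod N')"
    by (simp add: plane_mod_carrier N N' image_image f)
  have "carrier (plane_mod N') +>\<^bsub>plane_mod N'\<^esub> a = carrier (plane_mod N')" if a: "a \<in> carrier (plane_mod N')" for a
  proof (intro equalityI subsetI)
    fix x assume "x \<in> carrier (plane_mod N') +>\<^bsub>plane_mod N'\<^esub> a"
    then show "x \<in> carrier (plane_mod N')" using a by (auto simp: a_r_coset_def')
  next
    fix x assume x: "x \<in> carrier (plane_mod N')"
    obtain v w where vw: "x = coset_of N' v" "a = coset_of N' w" using x a by (auto simp: plane_mod_carrier N')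
    have "x = coset_of N' (v - w) \<oplus>\<^bsub>plane_mod N'\<^esub> a" by (simp add: vw plane_mod_add N')
    then show "x \<in> carrier (plane_mod N') +>\<^bsub>plane_mod N'\<^esub> a" by (auto simp: a_r_coset_def' plane_mod_carrier N')
  qed
  then have car: "carrier ?C \<subseteq> {carrier (plane_mod N')}"
    unfolding coker_module_def img carrier_quotient_module[of "plane_mod N'" "carrier (plane_mod N')"] by blast
  then show "finite (carrier ?C)" using finite_subset by blast
  have "k = 0" if "\<forall>i\<le>k. Zp_submodule (H i) ?C" "\<forall>i<k. H i \<subset> H (Suc i)" for k H
  proof (rule ccontr)
    assume "k \<noteq> 0"
    then have H: "Zp_submodule (H 0) ?C" "Zp_submodule (H 1) ?C" "H 0 \<subset> H 1"
      using that by (auto simp: Suc_le_eq)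
    have "H 0 \<noteq> {}" using LinearCombinations.submodule.zero_closed[OF H(1)] by blast
    moreover have "H 1 \<subseteq> {carrier (plane_mod N')}" using LinearCombinations.submodule.subset[OF H(2)] car by blast
    ultimately show False using H(3) by blast
  qed
  then have "enat k = 0" if "k \<in> {k. \<exists>H. (\<forall>i\<le>k. Zp_submodule (H i) ?C) \<and> (\<forall>i<k. H i \<subset> H (Suc i))}" for k
    using that unfolding zero_enat_def by blast
  then have "module_length Zp ?C \<le> 0"
    unfolding module_length_def by (intro SUP_least) simp
  then show "module_length Zp ?C = 0" by simp
qed

lemma level_proj_coset_of:
  assumes N': "zsub (level_submodule A (n - 1))" and sub: "N \<subseteq> level_submodule A (n - 1)" and N: "zsub N"
  shows "level_proj A n (coset_of N v) = coset_of (level_submodule A (n - 1)) v"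
proof -
  let ?N' = "level_submodule A (n - 1)"
  have "level_proj A n (coset_of N v) = {c + x | c x. c \<in> coset_of N v \<and> x \<in> ?N'}"
    unfolding level_proj_def set_add_def' by (auto simp: Lambda2_def)
  also have "\<dots> = coset_of ?N' v"
  proof (intro equalityI subsetI)
    fix y assume "y \<in> {c + x | c x. c \<in> coset_of N v \<and> x \<in> ?N'}"
    then obtain c x where y: "y = c + x" "c - v \<in> N" "x \<in> ?N'" by (auto simp: plane_coset_mem_iff[OF N])
    have "y - v = (c - v) + x" by (simp add: y(1))
    moreover have "(c - v) + x \<in> ?N'" by (rule zsub_add[OF N' _ y(3)]) (use y(2) sub in blast)
    ultimately have "y - v \<in> ?N'" by (simp only:)
    then show "y \<in> coset_of ?N' v" by (simp only: plane_coset_mem_iff[OF N'])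
  next
    fix y assume "y \<in> coset_of ?N' v"
    then have "y - v \<in> ?N'" by (simp only: plane_coset_mem_iff[OF N'])
    moreover have "v \<in> coset_of N v" using zsub_0[OF N] by (simp add: plane_coset_mem_iff[OF N])
    moreover have "y = v + (y - v)" by simp
    ultimately show "y \<in> {c + x | c x. c \<in> coset_of N v \<and> x \<in> ?N'}" by blast
  qed
  finally show ?thesis .
qed

section \<open>Evaluation at a root of unity\<close>

lemma of_padic_int_hom [simp]:
  "of_padic_int 0 = 0" "of_padic_int 1 = 1"
  "of_padic_int (x + y) = of_padic_int x + of_padic_int y"
  "of_padic_int (x * y) = of_padic_int x * of_padic_int y"
  "of_padic_int (- x) = - of_padic_int x"
proof -
  show "of_padic_int 0 = 0" by (simp add: of_padic_int_def flip: Zero_fract_def)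
  show "of_padic_int 1 = 1" by (simp add: of_padic_int_def flip: One_fract_def)
  have "Fract (x + y) 1 = Fract x 1 + Fract y 1" by simp
  then show "of_padic_int (x + y) = of_padic_int x + of_padic_int y" by (simp only: of_padic_int_def to_ac_add)
  have "Fract (x * y) 1 = Fract x 1 * Fract y 1" by simp
  then show "of_padic_int (x * y) = of_padic_int x * of_padic_int y" by (simp only: of_padic_int_def to_ac_mult)
  have "Fract (- x) 1 = - Fract x 1" by simp
  then show "of_padic_int (- x) = - of_padic_int x" by (simp only: of_padic_int_def to_ac_minus)
qed

lemma Qp_adjoin_closed:
  shows "\<zeta> \<in> Qp_adjoin \<zeta>" "of_padic_int x \<in> Qp_adjoin \<zeta>"
    "a \<in> Qp_adjoin \<zeta> \<Longrightarrow> b \<in> Qp_adjoin \<zeta> \<Longrightarrow> a + b \<in> Qp_adjoin \<zeta>"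
    "a \<in> Qp_adjoin \<zeta> \<Longrightarrow> b \<in> Qp_adjoin \<zeta> \<Longrightarrow> a * b \<in> Qp_adjoin \<zeta>"
proof -
  show "\<zeta> \<in> Qp_adjoin \<zeta>" "of_padic_int x \<in> Qp_adjoin \<zeta>"
    unfolding Qp_adjoin_def of_padic_int_def by (rule generate_field.incl, simp)+
  show "a + b \<in> Qp_adjoin \<zeta>" if "a \<in> Qp_adjoin \<zeta>" "b \<in> Qp_adjoin \<zeta>" for a b
    using generate_field.eng_add[OF that[unfolded Qp_adjoin_def]]
    by (simp add: Qp_adjoin_def ring_of_type_algebra_def)
  show "a * b \<in> Qp_adjoin \<zeta>" if "a \<in> Qp_adjoin \<zeta>" "b \<in> Qp_adjoin \<zeta>" for a b
    using generate_field.eng_mult[OF that[unfolded Qp_adjoin_def]]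
    by (simp add: Qp_adjoin_def ring_of_type_algebra_def)
qed

lemma ereal_add_eq_0_D: "0 \<le> a \<Longrightarrow> 0 \<le> b \<Longrightarrow> a + b = 0 \<Longrightarrow> a = (0 :: ereal)"
  by (cases a; cases b) auto

context
  fixes \<zeta> :: "'p :: prime_card Qp_closure" and v :: "'p Qp_closure \<Rightarrow> ereal"
  assumes v: "normalized_valuation (Qp_adjoin \<zeta>) (\<zeta> - 1) v"
begin

abbreviation (input) "K \<equiv> Qp_adjoin \<zeta>"
abbreviation (input) "\<epsilon> \<equiv> \<zeta> - 1"

section \<open>The field Q_p(\<zeta>) and its valuation\<close>

lemma K_of: "of_padic_int x \<in> K" by (rule Qp_adjoin_closed)
lemma K_add: "a \<in> K \<Longrightarrow> b \<in> K \<Longrightarrow> a + b \<in> K" by (rule Qp_adjoin_closed)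
lemma K_mult: "a \<in> K \<Longrightarrow> b \<in> K \<Longrightarrow> a * b \<in> K" by (rule Qp_adjoin_closed)
lemma K_0: "0 \<in> K" using K_of[of 0] by simp
lemma K_1: "1 \<in> K" using K_of[of 1] by simp
lemma K_uminus: "a \<in> K \<Longrightarrow> - a \<in> K" using K_mult[OF K_of[of "- 1"]] by simp
lemma K_diff: "a \<in> K \<Longrightarrow> b \<in> K \<Longrightarrow> a - b \<in> K" using K_add[OF _ K_uminus, of a b] by simp
lemma K_eps: "\<epsilon> \<in> K" by (rule K_diff[OF Qp_adjoin_closed(1) K_1])
lemma K_power: "a \<in> K \<Longrightarrow> a ^ k \<in> K" by (induction k) (auto intro: K_1 K_mult)
lemma K_sum: "(\<And>i. i \<in> I \<Longrightarrow> f i \<in> K) \<Longrightarrow> sum f I \<in> K"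
  by (induction I rule: infinite_finite_induct) (auto intro: K_0 K_add)

lemma v_infinite: "x \<in> K \<Longrightarrow> v x = \<infinity> \<longleftrightarrow> x = 0" "x \<in> K \<Longrightarrow> v x \<noteq> -\<infinity>"
  using v unfolding normalized_valuation_def by simp_all
lemma v_mult: "x \<in> K \<Longrightarrow> y \<in> K \<Longrightarrow> v (x * y) = v x + v y"
  using v unfolding normalized_valuation_def by simp
lemma v_add: "x \<in> K \<Longrightarrow> y \<in> K \<Longrightarrow> min (v x) (v y) \<le> v (x + y)"
  using v unfolding normalized_valuation_def by simp
lemma v_of: "0 \<le> v (of_padic_int x)"
  using v unfolding normalized_valuation_def by simp
lemma v_eps: "v \<epsilon> = 1"
  using v unfolding normalized_valuation_def by simp

lemma v_add_ge: "x \<in> K \<Longrightarrow> y \<in> K \<Longrightarrow> c \<le> v x \<Longrightarrow> c \<le> v y \<Longrightarrow> c \<le> v (x + y)"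
  by (rule order_trans[OF min.boundedI v_add])

text \<open>As - 1 lies in Z_p, its valuation is at least 0, which already gives the
  inequality.\<close>

lemma v_uminus_ge: "x \<in> K \<Longrightarrow> v x \<le> v (- x)"
  using v_mult[OF K_of[of "- 1"], of x] v_of[of "- 1"] by (simp add: ereal_le_add_self2)

lemma v_diff_ge: "x \<in> K \<Longrightarrow> y \<in> K \<Longrightarrow> c \<le> v x \<Longrightarrow> c \<le> v y \<Longrightarrow> c \<le> v (x - y)"
  using v_add_ge[OF _ K_uminus, of x y c] order_trans[OF _ v_uminus_ge, of c y] by simp

lemma v_sum_ge: "(\<And>i. i \<in> I \<Longrightarrow> f i \<in> K) \<Longrightarrow> (\<And>i. i \<in> I \<Longrightarrow> c \<le> v (f i)) \<Longrightarrow> c \<le> v (sum f I)"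
proof (induction I rule: infinite_finite_induct)
  case (insert i I)
  have "c \<le> v (f i + sum f I)" by (rule v_add_ge) (use insert K_sum[of I f] in auto)
  then show ?case using insert.hyps by simp
qed (use v_infinite(1)[OF K_0] in auto)

lemma v_mult_ge: "x \<in> K \<Longrightarrow> y \<in> K \<Longrightarrow> c \<le> v x \<Longrightarrow> 0 \<le> v y \<Longrightarrow> c \<le> v (x * y)"
  using v_mult[of x y] add_mono[of c "v x" 0 "v y"] by simp

lemma v_1: "v 1 = 0"
proof -
  have "v 1 = v 1 + v 1" using v_mult[OF K_1 K_1] by simp
  moreover have "v 1 \<noteq> \<infinity>" "v 1 \<noteq> -\<infinity>" using v_infinite[OF K_1] by auto
  ultimately show ?thesis by (cases "v 1") auto
qed

lemma v_eps_power: "v (\<epsilon> ^ k) = ereal (real k)"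
proof (induction k)
  case 0
  show ?case by (simp add: v_1 zero_ereal_def)
next
  case (Suc k)
  have "v (\<epsilon> ^ Suc k) = 1 + ereal (real k)"
    using v_mult[OF K_eps K_power[OF K_eps, of k]] Suc by (simp only: power_Suc v_eps)
  then show ?case by (simp add: one_ereal_def add.commute)
qed

section \<open>Power series at the point \<epsilon>\<close>

definition psum :: "'p iwasawa \<Rightarrow> nat \<Rightarrow> 'p Qp_closure" where
  "psum f N = (\<Sum>k<N. of_padic_int (fps_nth f k) * \<epsilon> ^ k)"

text \<open>Convergence with the optimal rate; it holds for every \<open>f\<close>, by Weierstrass division, so no
  completeness of \<open>K\<close> is involved.\<close>

definition conv :: "'p iwasawa \<Rightarrow> 'p Qp_closure \<Rightarrow> bool" where
  "conv f y \<longleftrightarrow> y \<in> K \<and> (\<forall>N. ereal (real N) \<le> v (y - psum f N))"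

lemma psum_K: "psum f N \<in> K"
  unfolding psum_def by (intro K_sum K_mult K_of K_power K_eps)

lemma v_term: "ereal (real k) \<le> v (of_padic_int c * \<epsilon> ^ k)"
  using v_mult_ge[OF K_power[OF K_eps, of k] K_of[of c] _ v_of, of "ereal (real k)"] v_eps_power[of k]
  by (simp add: mult.commute)

lemma v_psum_ge_0: "0 \<le> v (psum f N)"
  unfolding psum_def
proof (rule v_sum_ge)
  fix k
  show "of_padic_int (fps_nth f k) * \<epsilon> ^ k \<in> K" by (intro K_mult K_of K_power K_eps)
  have "(0 :: ereal) \<le> ereal (real k)" by simp
  then show "0 \<le> v (of_padic_int (fps_nth f k) * \<epsilon> ^ k)" by (rule order_trans[OF _ v_term])
qed

lemma conv_v_ge_0: "conv f y \<Longrightarrow> 0 \<le> v y"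
  unfolding conv_def by (auto simp: psum_def zero_ereal_def dest!: spec[of _ 0])

lemma conv_add: "conv f x \<Longrightarrow> conv g y \<Longrightarrow> conv (f + g) (x + y)"
  unfolding conv_def
proof (intro conjI allI)
  assume *: "x \<in> K \<and> (\<forall>N. ereal (real N) \<le> v (x - psum f N))" "y \<in> K \<and> (\<forall>N. ereal (real N) \<le> v (y - psum g N))"
  then show "x + y \<in> K" by (auto intro: K_add)
  fix N
  have eq: "x + y - psum (f + g) N = (x - psum f N) + (y - psum g N)"
    by (simp add: psum_def sum.distrib distrib_right)
  show "ereal (real N) \<le> v (x + y - psum (f + g) N)"
    unfolding eq by (rule v_add_ge[OF K_diff[OF _ psum_K] K_diff[OF _ psum_K]]) (use * in auto)
qed

lemma psum_split:
  "M \<le> N \<Longrightarrow> psum f N = psum f M + (\<Sum>k\<in>{M..<N}. of_padic_int (fps_nth f k) * \<epsilon> ^ k)"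
  unfolding psum_def lessThan_atLeast0
  using sum.atLeastLessThan_concat[of 0 M N "\<lambda>k. of_padic_int (fps_nth f k) * \<epsilon> ^ k"] by simp

lemma conv_short:
  assumes "\<And>i. i \<ge> d \<Longrightarrow> fps_nth f i = 0"
  shows "conv f (psum f d)"
  unfolding conv_def
proof (intro conjI allI)
  show "psum f d \<in> K" by (rule psum_K)
  fix N
  show "ereal (real N) \<le> v (psum f d - psum f N)"
  proof (cases "N \<le> d")
    case True
    then have "psum f d - psum f N = (\<Sum>k\<in>{N..<d}. of_padic_int (fps_nth f k) * \<epsilon> ^ k)"
      by (simp only: psum_split add_diff_cancel_left')
    also have "ereal (real N) \<le> v \<dots>"
    proof (rule v_sum_ge)
      fix k assume "k \<in> {N..<d}"
      then have "ereal (real N) \<le> ereal (real k)" by simp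
      then show "ereal (real N) \<le> v (of_padic_int (fps_nth f k) * \<epsilon> ^ k)" by (rule order_trans[OF _ v_term])
    qed (intro K_mult K_of K_power K_eps)
    finally show ?thesis .
  next
    case False
    then have "psum f N = psum f d + (\<Sum>k\<in>{d..<N}. of_padic_int (fps_nth f k) * \<epsilon> ^ k)"
      by (intro psum_split) simp
    also have "(\<Sum>k\<in>{d..<N}. of_padic_int (fps_nth f k) * \<epsilon> ^ k) = 0"
      by (rule sum.neutral) (simp add: assms)
    finally show ?thesis using v_infinite(1)[OF K_0] by simp
  qed
qed

definition peval :: "'p padic_int poly \<Rightarrow> 'p Qp_closure" where
  "peval q = poly (map_poly of_padic_int q) \<epsilon>"

lemma peval_pCons: "peval (pCons a q) = of_padic_int a + \<epsilon> * peval q"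
  by (cases "a = 0 \<and> q = 0") (auto simp: peval_def map_poly_pCons)

lemma peval_0: "peval 0 = 0" by (simp add: peval_def)

lemma peval_1: "peval 1 = 1"
  unfolding one_pCons peval_pCons peval_0 by simp

lemma peval_add: "peval (q + r) = peval q + peval r"
  by (induction q r rule: poly_induct2) (simp_all add: peval_0 peval_pCons algebra_simps)

lemma peval_smult: "peval (Polynomial.smult c q) = of_padic_int c * peval q"
  by (induction q) (simp_all add: peval_0 peval_pCons algebra_simps)

lemma peval_mult: "peval (q * r) = peval q * peval r"
  by (induction q) (simp_all add: peval_0 peval_pCons peval_add peval_smult algebra_simps)

lemma peval_power: "peval (q ^ k) = peval q ^ k"
  by (induction k) (simp_all add: peval_1 peval_mult)

lemma peval_sum: "peval (sum f I) = (\<Sum>i\<in>I. peval (f i))"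
  by (induction I rule: infinite_finite_induct) (simp_all add: peval_0 peval_add)

lemma psum_fps_of_poly: "(\<And>i. i \<ge> M \<Longrightarrow> poly.coeff q i = 0) \<Longrightarrow> psum (fps_of_poly q) M = peval q"
proof (induction q arbitrary: M)
  case 0
  then show ?case by (simp add: psum_def peval_0)
next
  case (pCons a q)
  show ?case
  proof (cases M)
    case 0
    then have "pCons a q = 0" using pCons.prems by (intro poly_eqI) simp
    then show ?thesis using pCons.hyps by simp
  next
    case (Suc M')
    have "poly.coeff q i = 0" if "i \<ge> M'" for i using pCons.prems[of "Suc i"] that Suc by simp
    then have q: "psum (fps_of_poly q) M' = peval q" by (rule pCons.IH)
    show ?thesis
      unfolding Suc peval_pCons q[symmetric] psum_def
      by (subst sum.lessThan_Suc_shift) (simp add: sum_distrib_left mult_ac)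
  qed
qed

lemma conv_fps_of_poly: "conv (fps_of_poly q) (peval q)"
proof -
  have c: "poly.coeff q i = 0" if "i \<ge> Suc (Polynomial.degree q)" for i using that by (simp add: coeff_eq_0)
  have "conv (fps_of_poly q) (psum (fps_of_poly q) (Suc (Polynomial.degree q)))"
    by (rule conv_short) (simp add: c)
  then show ?thesis by (simp only: psum_fps_of_poly[OF c])
qed

lemma psum_cong: "(\<And>i. i < N \<Longrightarrow> fps_nth f i = fps_nth g i) \<Longrightarrow> psum f N = psum g N"
  unfolding psum_def by (intro sum.cong) auto

lemma psum_truncate: "psum f N = peval (truncate_fps N f)"
proof -
  have "psum f N = psum (fps_of_poly (truncate_fps N f)) N" by (rule psum_cong) simp
  also have "\<dots> = peval (truncate_fps N f)" by (rule psum_fps_of_poly) simp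
  finally show ?thesis .
qed

lemma psum_mult_cong:
  assumes "\<And>i. i < N \<Longrightarrow> fps_nth f i = fps_nth f' i" "\<And>i. i < N \<Longrightarrow> fps_nth g i = fps_nth g' i"
  shows "psum (f * g) N = psum (f' * g') N"
  by (rule psum_cong) (use assms in \<open>auto simp: fps_mult_nth intro!: sum.cong\<close>)

text \<open>The N-th partial sum of the product depends on g only up to degree N, so g may be
  truncated. What remains is a polynomial that vanishes at \<epsilon>, and nothing has to be known
  about convergence of g.\<close>

lemma conv_multiple:
  assumes "peval q = 0"
  shows "conv (fps_of_poly q * g) 0"
  unfolding conv_def
proof (intro conjI allI K_0)
  fix N
  have "psum (fps_of_poly q * g) N = psum (fps_of_poly (q * truncate_fps N g)) N"
    unfolding fps_of_poly_mult by (rule psum_mult_cong) auto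
  moreover have "conv (fps_of_poly (q * truncate_fps N g)) 0"
    using conv_fps_of_poly[of "q * truncate_fps N g"] by (simp add: peval_mult assms)
  ultimately show "ereal (real N) \<le> v (0 - psum (fps_of_poly q * g) N)"
    unfolding conv_def by simp
qed

text \<open>Both factors are truncated to polynomials. The value of their product at \<epsilon> is
  the product of the partial sums, and it differs from the partial sum of the product only in terms
  of degree at least N.\<close>

lemma conv_mult:
  assumes x: "conv f x" and y: "conv g y"
  shows "conv (f * g) (x * y)"
  unfolding conv_def
proof (intro conjI allI)
  have xK: "x \<in> K" and yK: "y \<in> K" using x y by (auto simp: conv_def)
  then show "x * y \<in> K" by (rule K_mult)
  fix N
  let ?q = "truncate_fps N f * truncate_fps N g"
  have "psum (f * g) N = psum (fps_of_poly ?q) N"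
    unfolding fps_of_poly_mult by (rule psum_mult_cong) auto
  moreover have "peval ?q = psum f N * psum g N" by (simp add: peval_mult psum_truncate)
  ultimately have eq: "x * y - psum (f * g) N =
      (x - psum f N) * y + (y - psum g N) * psum f N + (peval ?q - psum (fps_of_poly ?q) N)"
    by (simp add: algebra_simps)
  have 1: "ereal (real N) \<le> v ((x - psum f N) * y)"
    using x conv_v_ge_0[OF y] yK xK by (intro v_mult_ge K_diff psum_K) (auto simp: conv_def)
  have 2: "ereal (real N) \<le> v ((y - psum g N) * psum f N)"
    using y yK by (intro v_mult_ge K_diff psum_K v_psum_ge_0) (auto simp: conv_def)
  have 3: "ereal (real N) \<le> v (peval ?q - psum (fps_of_poly ?q) N)" "peval ?q \<in> K"
    using conv_fps_of_poly[of ?q] by (auto simp: conv_def)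
  show "ereal (real N) \<le> v (x * y - psum (f * g) N)"
    unfolding eq using xK yK 1 2 3 by (intro v_add_ge K_add K_mult K_diff psum_K)
qed

lemma limit_unique:
  assumes x: "x \<in> K" "(\<lambda>N. v (x - psum f N)) \<longlonglongrightarrow> \<infinity>" and y: "y \<in> K" "(\<lambda>N. v (y - psum f N)) \<longlonglongrightarrow> \<infinity>"
  shows "x = y"
proof -
  have "ereal r \<le> v (x - y)" for r
  proof -
    have "\<forall>\<^sub>F N in sequentially. ereal r < v (x - psum f N) \<and> ereal r < v (y - psum f N)"
      using x(2) y(2) unfolding tendsto_PInfty by (intro eventually_conj) blast+
    then obtain N where N: "ereal r < v (x - psum f N)" "ereal r < v (y - psum f N)"
      unfolding eventually_sequentially by blast
    have "ereal r \<le> v ((x - psum f N) - (y - psum f N))"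
      by (rule v_diff_ge[OF K_diff[OF x(1) psum_K] K_diff[OF y(1) psum_K]]) (use N in auto)
    also have "(x - psum f N) - (y - psum f N) = x - y"
      by (simp only: diff_diff_eq2 diff_add_cancel)
    finally show ?thesis .
  qed
  then have "v (x - y) = \<infinity>" by (rule ereal_top)
  then show ?thesis using v_infinite(1)[OF K_diff[OF x(1) y(1)]] by simp
qed

lemma conv_limit:
  assumes "conv f y"
  shows "y \<in> K" "(\<lambda>N. v (y - psum f N)) \<longlonglongrightarrow> \<infinity>"
proof -
  show "y \<in> K" using assms by (simp add: conv_def)
  show "(\<lambda>N. v (y - psum f N)) \<longlonglongrightarrow> \<infinity>"
    unfolding tendsto_PInfty eventually_sequentially
  proof (intro allI)
    fix r
    obtain M where M: "r < real M" using reals_Archimedean2 by blast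
    have "ereal r < v (y - psum f N)" if "N \<ge> M" for N
    proof -
      have "ereal r < ereal (real N)" using M that by simp
      also have "\<dots> \<le> v (y - psum f N)" using assms by (simp add: conv_def)
      finally show ?thesis .
    qed
    then show "\<exists>M. \<forall>N\<ge>M. ereal r < v (y - psum f N)" by blast
  qed
qed

lemma iwasawa_eval_conv:
  assumes "conv f y"
  shows "iwasawa_eval K v f \<epsilon> = y"
  unfolding iwasawa_eval_def psum_def[symmetric]
proof (rule the_equality)
  show "y \<in> K \<and> (\<lambda>N. v (y - psum f N)) \<longlonglongrightarrow> \<infinity>"
    using conv_limit[OF assms] by (rule conjI)
  fix x assume "x \<in> K \<and> (\<lambda>N. v (x - psum f N)) \<longlonglongrightarrow> \<infinity>"
  then show "x = y" by (elim conjE) (rule limit_unique[OF _ _ conv_limit[OF assms]])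
qed

lemma peval_Phi_poly:
  assumes "primitive_unity_root (CARD('p) ^ Suc m) \<zeta>"
  shows "peval (Phi_poly CARD('p) TYPE('p padic_int) m) = 0"
proof -
  have \<zeta>: "\<zeta> ^ (CARD('p) ^ Suc m) = 1" "\<zeta> ^ (CARD('p) ^ m) \<noteq> 1"
    using assms unfolding primitive_unity_root_prime_power_iff[OF prime_CARD] by auto
  have "peval [:1, 1:] = \<zeta>" by (simp add: peval_pCons peval_0)
  then have p: "peval (Phi_poly CARD('p) TYPE('p padic_int) m) = (\<Sum>i<CARD('p). (\<zeta> ^ (CARD('p) ^ m)) ^ i)"
    by (simp only: Phi_poly_def peval_sum peval_power)
  have "(\<zeta> ^ (CARD('p) ^ m) - 1) * (\<Sum>i<CARD('p). (\<zeta> ^ (CARD('p) ^ m)) ^ i) = (\<zeta> ^ (CARD('p) ^ m)) ^ CARD('p) - 1"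
    by (rule geometric_sum_mult)
  also have "\<dots> = 0" using \<zeta>(1) by (simp add: mult.commute flip: power_mult)
  finally show ?thesis using \<zeta>(2) p by simp
qed

text \<open>Evaluation at \<epsilon> kills the multiples of \<Phi>_(m + 1). It sends a unit to an
  element of valuation 0, since the values of the unit and of its inverse both have nonnegative
  valuation. Only the factor X^k is left.\<close>

lemma iwasawa_eval_x_ord:
  assumes \<zeta>: "primitive_unity_root (CARD('p) ^ Suc m) \<zeta>" and k: "x_ord (\<Phi> (Suc m)) f k"
  shows "v (iwasawa_eval K v f \<epsilon>) = ereal (real k)"
proof -
  let ?D = "\<Phi> (Suc m) :: 'p iwasawa"
  obtain d P where D: "?D = fps_X ^ d + PP * P" using cyc_factor_shape by blast
  have mult: "conv (?D * g) 0" for g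
    unfolding cyc_factor_eq_fps_of_poly by (rule conv_multiple[OF peval_Phi_poly[OF \<zeta>]])
  have ex: "\<exists>y. conv h y" for h
  proof -
    obtain q r where qr: "h = q * (fps_X ^ d + PP * P) + r" "\<And>i. i \<ge> d \<Longrightarrow> fps_nth r i = 0"
      using weierstrass_division[of h d P] by blast
    have "conv (?D * q + r) (0 + psum r d)" by (rule conv_add[OF mult conv_short[OF qr(2)]])
    then show ?thesis using qr(1) D by (metis mult.commute)
  qed
  obtain u g where u: "u dvd 1" "f = fps_X ^ k * u + ?D * g" using k by (auto simp: x_ord_def)
  obtain u' where u': "1 = u * u'" using u(1) by (rule dvdE)
  obtain y y' where y: "conv u y" "conv u' y'" using ex by blast
  have "conv 1 (y * y')" unfolding u' by (rule conv_mult[OF y])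
  moreover have "conv 1 1" using conv_fps_of_poly[of 1] by (simp add: peval_1)
  \<comment> \<open>Both are limits of the constant series 1, and \<open>iwasawa_eval_conv\<close>
    makes each of them equal to its evaluation.\<close>
  ultimately have "y * y' = 1" using iwasawa_eval_conv by metis
  then have "v y + v y' = 0" using v_mult[of y y'] y v_1 by (simp add: conv_def)
  then have vy: "v y = 0"
    by (rule ereal_add_eq_0_D[OF conv_v_ge_0[OF y(1)] conv_v_ge_0[OF y(2)]])
  have "conv (fps_of_poly ([:0, 1:] ^ k)) (peval ([:0, 1:] ^ k))" by (rule conv_fps_of_poly)
  then have "conv (fps_X ^ k) (\<epsilon> ^ k)"
    by (simp add: fps_of_poly_power peval_power peval_pCons peval_0)
  then have "conv f (\<epsilon> ^ k * y + 0)"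
    unfolding u(2) by (intro conv_add conv_mult y(1) mult)
  then have "iwasawa_eval K v f \<epsilon> = \<epsilon> ^ k * y" by (simp add: iwasawa_eval_conv)
  moreover have "v (\<epsilon> ^ k * y) = ereal (real k)"
    using v_mult[OF K_power[OF K_eps, of k], of y] y(1) vy v_eps_power[of k] by (simp add: conv_def)
  ultimately show ?thesis by simp
qed

end

section \<open>The Kobayashi rank\<close>

lemma module_vector_scalar_mult: "Modules.module ((*s) :: 'a :: comm_ring_1 \<Rightarrow> 'a ^ 'n \<Rightarrow> 'a ^ 'n)"
  by unfold_locales (simp_all add: vector_add_ldistrib vector_sadd_rdistrib vector_smult_assoc)

lemma level_submodule_eq: "level_submodule A n = gen2 (\<omega> n) (column 1 A) (column 2 A)"
proof -
  interpret Modules.module "(*s) :: 'a iwasawa \<Rightarrow> 'a iwasawa ^ 2 \<Rightarrow> 'a iwasawa ^ 2"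
    by (rule module_vector_scalar_mult)
  let ?w = "\<omega> n :: 'a iwasawa"
  let ?S = "columns (mat ?w) \<union> columns A" and ?G = "gen2 ?w (column 1 A) (column 2 A)"
  have S: "?S = {?w *s axis 1 1, ?w *s axis 2 1, column 1 A, column 2 A}"
  proof -
    have cols: "columns B = {column 1 B, column 2 B}" for B :: "'a iwasawa ^ 2 ^ 2"
    proof -
      have "columns B = (\<lambda>i. column i B) ` UNIV" by (auto simp: columns_def)
      then show ?thesis by (simp only: UNIV_2 image_insert image_empty)
    qed
    have "column j (mat ?w) = ?w *s axis j 1" for j :: 2
      by (simp add: vec_eq_iff column_def mat_def axis_def)
    then show ?thesis by (simp only: cols Un_insert_left Un_empty_left)
  qed
  have "span ?S = ?G"
  proof
    have "subspace ?G" using lsub_gen2[of ?w] by (simp add: subspace_def lsub_def)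
    moreover have "?S \<subseteq> ?G" unfolding S using gen2_mem by blast
    ultimately show "span ?S \<subseteq> ?G" by (intro span_minimal)
    have "lsub (span ?S)" by (simp add: lsub_def span_zero span_add span_scale)
    moreover have "?w *s v \<in> span ?S" for v
    proof -
      have "?w *s v = v $ 1 *s (?w *s axis 1 1) + v $ 2 *s (?w *s axis 2 1)"
        by (simp add: vec2_eq axis_def mult.commute)
      also have "\<dots> \<in> span ?S" by (intro span_add span_scale span_base) (auto simp: S)
      finally show ?thesis .
    qed
    moreover have "column j A \<in> span ?S" for j :: 2
      by (rule span_base) (auto simp: columns_def)
    ultimately show "?G \<subseteq> span ?S" by (intro gen2_le)
  qed
  then show ?thesis by (simp only: level_submodule_def)
qed

lemma det_eq_det2: "det A = det2 (column 1 A) (column 2 (A :: 'p :: prime_card iwasawa ^ 2 ^ 2))"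
  by (simp add: det_2 det2_def column_def mult.commute)

lemma x_ord_prod:
  assumes "\<And>i. i \<in> I \<Longrightarrow> x_ord D (F i) (e i)"
  shows "x_ord D (prod F I) (sum e I)"
  using assms
proof (induction I rule: infinite_finite_induct)
  case (insert i I)
  then show ?case using x_ord_mult[of D "F i" "e i" "prod F I" "sum e I"] by simp
next
  case empty
  have "1 = fps_X ^ 0 * 1 + D * 0" by simp
  then show ?case unfolding x_ord_def by (metis dvd_refl prod.empty sum.empty)
next
  \<comment> \<open>Over an infinite set \<open>prod\<close> and \<open>sum\<close> default to 1 and
    0, which again match.\<close>
  case (infinite I)
  have "1 = fps_X ^ 0 * 1 + D * 0" by simp
  then show ?case unfolding x_ord_def by (metis dvd_refl infinite.hyps prod.infinite sum.infinite)
qed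

lemma gen2_omega_antimono: "gen2 (\<omega> (Suc k)) a b \<subseteq> gen2 (\<omega> k) a b"
proof (rule gen2_le[OF lsub_gen2 gen2_mem(1,2)])
  fix v
  show "\<omega> (Suc k) *s v \<in> gen2 (\<omega> k) a b"
    using gen2_mem(3)[of "\<omega> k" "\<Phi> (Suc k) *s v" a b]
    by (simp add: vector_smult_assoc cyc_factor_mult_omega)
qed

text \<open>Ranks add along the chain N_k, ..., N_0, \<Lambda>^2, whose factors are given by
  \<open>gen2_rank\<close>; that \<Phi>_(k + 1) does not divide \<omega>_k comes from the
  distinctness of the \<Phi>_i.\<close>

lemma level_rank:
  fixes a b :: "'p :: prime_card iwasawa ^ 2"
  assumes "\<And>m. m \<le> k \<Longrightarrow> \<Phi> m dvd det2 a b \<Longrightarrow> vdvd (\<Phi> m) a \<or> vdvd (\<Phi> m) b"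
  shows "has_rank (gen2 (\<omega> k) a b) UNIV
    (\<Sum>m\<le>k. cyc_deg CARD('p) m * (of_bool (vdvd (\<Phi> m) a) + of_bool (vdvd (\<Phi> m) b)))"
  using assms
proof (induction k)
  case 0
  \<comment> \<open>With the convention \<omega>_(-1) = 1, the factor at m = 0 has the same form as
    the others.\<close>
  have "gen2 1 a b = UNIV"
  proof -
    have "v \<in> gen2 1 a b" for v by (rule gen2_memI[of _ _ v 0 _ 0]) simp
    then show ?thesis by blast
  qed
  moreover have "\<not> \<Phi> 0 dvd (1 :: 'p iwasawa)"
    using cyc_factor_good_prime[of 0, where 'p='p] by (simp add: good_prime_def prime_elem_def)
  moreover have "(\<omega> 0 :: 'p iwasawa) = 1 * \<Phi> 0" by (simp add: omega_eq_prod)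
  ultimately show ?case using gen2_rank[OF cyc_factor_good_prime[of 0], of 1 a b] 0[of 0] by simp
next
  case (Suc k)
  have prime: "prime_elem (\<Phi> m :: 'p iwasawa)" for m using cyc_factor_good_prime by (auto simp: good_prime_def)
  have nd: "\<not> \<Phi> (Suc k) dvd (\<omega> k :: 'p iwasawa)"
  proof
    assume "\<Phi> (Suc k) dvd (\<omega> k :: 'p iwasawa)"
    then obtain i where "i \<in> {..k}" "\<Phi> (Suc k) dvd (\<Phi> i :: 'p iwasawa)"
      using prime_elem_dvd_prod[OF _ prime] unfolding omega_eq_prod by blast
    then show False using cyc_factor_not_dvd[of "Suc k" i] by auto
  qed
  have "has_rank (gen2 (\<omega> (Suc k)) a b) (gen2 (\<omega> k) a b)
      (cyc_deg CARD('p) (Suc k) * (of_bool (vdvd (\<Phi> (Suc k)) a) + of_bool (vdvd (\<Phi> (Suc k)) b)))"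
    unfolding cyc_factor_mult_omega[symmetric] by (rule gen2_rank[OF cyc_factor_good_prime nd]) (use Suc.prems in blast)
  moreover have "has_rank (gen2 (\<omega> k) a b) UNIV
    (\<Sum>m\<le>k. cyc_deg CARD('p) m * (of_bool (vdvd (\<Phi> m) a) + of_bool (vdvd (\<Phi> m) b)))"
    using Suc.prems by (intro Suc.IH) auto
  moreover note gen2_omega_antimono[of k a b]
  ultimately show ?case
    unfolding sum.atMost_Suc add.commute[of "sum _ _"]
    by (intro has_rank_trans[OF lsub_gen2 lsub_gen2, where b = "sum _ _"]) auto
qed

theorem theorem3p6:
  fixes A :: "'p :: prime_card iwasawa ^ 2 ^ 2"
    and n :: nat
    and \<zeta> :: "'p Qp_closure"
    and ord_eps :: "'p Qp_closure \<Rightarrow> ereal"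
  assumes "odd CARD('p)"
    and "n \<ge> 1"
    and "primitive_unity_root (CARD('p) ^ n) \<zeta>"
    and "normalized_valuation (Qp_adjoin \<zeta>) (\<zeta> - 1) ord_eps"
    and "special_relative_to A n"
    and "\<not> \<Phi> n dvd det A"
  shows "kobayashi_rank_defined (level_module A) (level_proj A) n \<and>
         ereal (of_int (kobayashi_rank (level_module A) (level_proj A) n)) =
           ord_eps (iwasawa_eval (Qp_adjoin \<zeta>) ord_eps (det A) (\<zeta> - 1))"
proof -
  let ?a = "column 1 A" and ?b = "column 2 A"
  define N where "N k = gen2 (\<omega> k) ?a ?b" for k
  have lev: "level_submodule A k = N k" for k by (simp add: level_submodule_eq N_def)
  have M: "level_module A k = plane_mod (N k)" for k by (simp add: level_module_eq lev)
  have N: "lsub (N k)" "zsub (N k)" for k by (auto simp: N_def intro: lsub_gen2 lsub_zsub)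
  have N_Suc: "N (Suc k) \<subseteq> N k" for k
    unfolding N_def by (rule gen2_omega_antimono)
  have proj: "level_proj A k (coset_of (N k) v) = coset_of (N (k - 1)) v" if "k \<ge> 1" for k v
    using level_proj_coset_of[of A k "N k" v] N(2) N_Suc[of "k - 1"] that by (simp add: lev)
  have fg: "finitely_generated_module Zp (level_module A k)" for k
  proof -
    obtain Q where Q: "(\<omega> k :: 'p iwasawa) = fps_X ^ (CARD('p) ^ k) + PP * Q" using omega_shape by blast
    have "\<omega> k *s v \<in> N k" for v unfolding N_def by (rule gen2_mem)
    then show ?thesis unfolding M by (rule finitely_generated_plane_mod[OF N(2) Q])
  qed
  have system: "projective_system (level_module A) (level_proj A)"
    unfolding projective_system_def M
    using fg[unfolded M] mod_hom_plane_mod[OF N(2) N(2) proj] by blast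

  obtain m where n: "n = Suc m" using assms(2) by (cases n) auto
  let ?D = "\<Phi> n :: 'p iwasawa"
  have D: "eisenstein (cyc_deg CARD('p) n) ?D" unfolding n by (rule cyc_factor_eisenstein)
  have special: "vdvd (\<Phi> i) ?a \<or> vdvd (\<Phi> i) ?b" if "i \<le> n" "\<Phi> i dvd det2 ?a ?b" for i
    using assms(5) that unfolding special_relative_to_def det_eq_det2 by (auto simp: vdvd_def column_def)
  have prime: "prime_elem (\<Phi> i :: 'p iwasawa)" for i using cyc_factor_good_prime by (auto simp: good_prime_def)
  \<comment> \<open>The factors stop at m = n - 1: they are to be cancelled against \<omega>_m, and
    \<Phi>_n, which does not divide the determinant, divides neither column.\<close>
  define Ia where "Ia = {i \<in> {..m}. vdvd (\<Phi> i) ?a}"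
  define Ib where "Ib = {i \<in> {..m}. vdvd (\<Phi> i) ?b}"
  have fin: "finite Ia" "finite Ib" by (auto simp: Ia_def Ib_def)
  obtain a' where a': "?a = prod \<Phi> Ia *s a'"
  proof (rule prod_primes_vdvd[OF fin(1), of \<Phi> ?a])
    show "vdvd (\<Phi> i) ?a" if "i \<in> Ia" for i using that by (simp add: Ia_def)
  qed (use prime cyc_factor_not_dvd that in blast)+
  obtain b' where b': "?b = prod \<Phi> Ib *s b'"
  proof (rule prod_primes_vdvd[OF fin(2), of \<Phi> ?b])
    show "vdvd (\<Phi> i) ?b" if "i \<in> Ib" for i using that by (simp add: Ib_def)
  qed (use prime cyc_factor_not_dvd that in blast)+
  have colon: "{v. \<omega> m *s v \<in> N n} = gen2 ?D a' b'"
  proof -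
    have "{v. prod \<Phi> {..m} *s v \<in> gen2 (prod \<Phi> {..m} * ?D) ?a ?b} = gen2 ?D a' b'"
    proof (rule gen2_colon)
      show "prime_elem (\<Phi> i :: 'p iwasawa)" for i by (rule prime)
      show "\<not> \<Phi> i dvd (\<Phi> j :: 'p iwasawa)" if "i \<noteq> j" for i j using that by (rule cyc_factor_not_dvd)
      show "vdvd (\<Phi> i) ?a \<or> vdvd (\<Phi> i) ?b" if "i \<in> {..m}" "\<Phi> i dvd det2 ?a ?b" for i
        using special[of i] that n by simp
      show "?a = prod \<Phi> {i \<in> {..m}. vdvd (\<Phi> i) ?a} *s a'" using a' unfolding Ia_def .
      show "?b = prod \<Phi> {i \<in> {..m}. vdvd (\<Phi> i) ?b} *s b'" using b' unfolding Ib_def .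
    qed simp
    then show ?thesis
      unfolding N_def by (simp add: n flip: omega_eq_prod cyc_factor_mult_omega)
  qed
  obtain L where L: "x_ord ?D (det A) L" using x_ord_exists[OF D assms(6)] by blast
  have det: "det A = prod \<Phi> Ia * prod \<Phi> Ib * det2 a' b'"
  proof -
    have "det2 (f *s x) (g *s y) = f * g * det2 x y" for f g :: "'p iwasawa" and x y
      by (simp add: det2_def algebra_simps)
    then have "det2 (prod \<Phi> Ia *s a') (prod \<Phi> Ib *s b') = prod \<Phi> Ia * prod \<Phi> Ib * det2 a' b'" .
    then show ?thesis unfolding det_eq_det2 by (simp only: a'[symmetric] b'[symmetric])
  qed
  have "\<not> ?D dvd det2 a' b'" using assms(6) unfolding det by (meson dvd_mult)
  then obtain L' where L': "x_ord ?D (det2 a' b') L'" using x_ord_exists[OF D] by blast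
  have ord: "x_ord ?D (prod \<Phi> I) (sum (cyc_deg CARD('p)) I)" if "I \<subseteq> {..m}" for I
    by (rule x_ord_prod) (use that in \<open>auto simp: n intro!: cyc_factor_x_ord\<close>)
  \<comment> \<open>The order of the determinant is computed a second time, from the factorization.
    Uniqueness of orders then splits L into the future rank and the future length of the
    kernel.\<close>
  have "x_ord ?D (det A) (sum (cyc_deg CARD('p)) Ia + sum (cyc_deg CARD('p)) Ib + L')"
    unfolding det by (intro x_ord_mult ord L') (auto simp: Ia_def Ib_def)
  then have L_eq: "L = sum (cyc_deg CARD('p)) Ia + sum (cyc_deg CARD('p)) Ib + L'"
    by (rule x_ord_unique[OF D L])

  \<comment> \<open>The chain is built in the plane modulo \<Phi>_n and A', then transported by
    multiplication by \<omega>_m to one from N_n to N_m.\<close>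
  have "(pstep ^^ L') {v. \<omega> m *s v \<in> N n} UNIV"
    unfolding colon by (rule gen2_length[OF D L'])
  then have "(pstep ^^ L') (N n) {\<omega> m *s v + x | v x. v \<in> UNIV \<and> x \<in> N n}"
    by (rule relpowp_pstep_image[OF N(1)])
  moreover have "{\<omega> m *s v + x | v x. v \<in> UNIV \<and> x \<in> N n} = N m"
    using gen2_image[of "\<omega> m" ?a ?b ?D] by (simp add: N_def n cyc_factor_mult_omega)
  ultimately have chain: "(pstep ^^ L') (N n) (N m)" by simp

  have "has_rank (N m) UNIV (\<Sum>i\<le>m. cyc_deg CARD('p) i * (of_bool (vdvd (\<Phi> i) ?a) + of_bool (vdvd (\<Phi> i) ?b)))"
    unfolding N_def by (rule level_rank) (use special n in auto)
  moreover have "(\<Sum>i\<le>m. cyc_deg CARD('p) i * (of_bool (vdvd (\<Phi> i) ?a) + of_bool (vdvd (\<Phi> i) ?b))) =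
      sum (cyc_deg CARD('p)) Ia + sum (cyc_deg CARD('p)) Ib"
  proof -
    have "sum g {i \<in> {..m}. P i} = (\<Sum>i\<le>m. g i * of_bool (P i))" for g :: "nat \<Rightarrow> nat" and P
      by (subst sum.inter_filter, simp, intro sum.cong refl) simp
    then show ?thesis by (simp only: Ia_def Ib_def distrib_left sum.distrib)
  qed
  ultimately have rank: "Qp_dim (plane_mod (N m)) = sum (cyc_deg CARD('p)) Ia + sum (cyc_deg CARD('p)) Ib"
    using Qp_dim_plane_mod[OF N(2)] by metis

  have pr: "level_proj A n (coset_of (N n) v) = coset_of (N m) v" for v
    using proj[OF assms(2)] by (simp add: n)
  have ker: "ker_module (level_module A n) (level_module A (n - 1)) (level_proj A n) =
      plane_mod (N n)\<lparr>carrier := coset_of (N n) ` N m\<rparr>"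
    using ker_plane_mod[OF N(2) N(2) pr] by (simp add: M n)
  have coker: "coker_module (level_module A n) (level_module A (n - 1)) (level_proj A n) =
      coker_module (plane_mod (N n)) (plane_mod (N m)) (level_proj A n)"
    by (simp add: M n)
  have "kobayashi_rank_defined (level_module A) (level_proj A) n"
    unfolding kobayashi_rank_defined_def ker coker
    using system card_coset_relpowp[OF N(2) chain] coker_plane_mod(1)[OF N(2) N(2) pr] by simp
  moreover have "kobayashi_rank (level_module A) (level_proj A) n = int L"
    unfolding kobayashi_rank_def ker coker module_length_plane_mod[OF N(2) chain N(1) N(1)]
      coker_plane_mod(2)[OF N(2) N(2) pr]
    using rank by (simp add: M n L_eq zero_enat_def)
  moreover have "ord_eps (iwasawa_eval (Qp_adjoin \<zeta>) ord_eps (det A) (\<zeta> - 1)) = ereal (real L)"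
    using iwasawa_eval_x_ord[OF assms(4), of m "det A" L] assms(3) L by (simp only: n)
  ultimately show ?thesis by simp
qed

end
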